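(* Assume that $\Gamma$ is one side of the rectangle $\Omega$. Then the wave equation with observation $\frac{\partial u}{\partial n}\big|_\Gamma$ is weakly observable; that is, there exist constants $c_i=c_i(\Gamma,\Omega,\|C_0\|)>0$, $i=1,3,4$, and a universal constant $c_2>0$ such that, with $$\Psi(\lambda)=\frac{c_4}{c_3+c_2\lambda^2},\qquad\mathtt T(\lambda)=c_1+c_2\lambda^2,$$ ($\Psi\in\Sigma_d$, $\mathtt T\in\Sigma_i$) and $$\Lambda(u_0,u_1)=\frac{\lVert\Delta u_0\rVert_{L^2(\Omega)}^2+\lVert\nabla u_1\rVert_{L^2(\Omega)}^2}{\lVert\nabla u_0\rVert_{L^2(\Omega)}^2+\lVert u_1\rVert_{L^2(\Omega)}^2},$$ the solution $u$ with initial data $(u_0,u_1)$ satisfies $$\Psi\big(\Lambda(u_0,u_1)\big)\Big(\lVert\nabla u_0\rVert_{L^2(\Omega)}^2+\lVert u_1\rVert_{L^2(\Omega)}^2\Big)\le\int_0^T\int_\Gamma\Big|\frac{\partial u}{\partial n}\Big|^2ds(x)\,dt$$ for all $(u_0,u_1)\in\big((H^2(\Omega)\cap H_0^1(\Omega))\times H_0^1(\Omega)\big)\setminus\{(0,0)\}$ and all $T\ge\mathtt T(\Lambda(u_0,u_1))$.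
   Context: Let $a,b>0$, $\Omega=(0,a\pi)\times(0,b\pi)$, with boundary $\partial\Omega$ and outward unit normal $n$; $\Gamma$ is one (open) side of $\Omega$, for instance $(0,a\pi)\times\{0\}$. The wave equation is $$\ddot u-\Delta u=0\ \text{ in }\Omega\times(0,\infty),\qquad u=0\ \text{ on }\partial\Omega\times\mathbb{R}_+,\qquad u(\cdot,0)=u_0,\ \dot u(\cdot,0)=u_1.$$ The observation operator $C_0:H^2(\Omega)\cap H_0^1(\Omega)\to L^2(\Gamma)$, $C_0u=\frac{\partial u}{\partial n}\big|_\Gamma$, is bounded, where the domain $D(-\Delta)=H^2(\Omega)\cap H_0^1(\Omega)$ of the Dirichlet Laplacian carries the norm $\|\Delta u\|_{L^2(\Omega)}$; $\|C_0\|$ denotes its operator norm. $\Sigma_d$ (resp. $\Sigma_i$) is the set of functions $\mathbb{R}\to(0,\infty)$ that are even, continuous, and non-increasing (resp. non-decreasing) on $[0,\infty)$. *)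

theory Defs
  imports "HOL-Analysis.Analysis"
begin

text \<open>
  Elements of function spaces are represented by functions; everything below depends on such a
  function only through its almost-everywhere class. Scalars are complex, which includes the real
  case.
\<close>

definition L2 :: "'a measure \<Rightarrow> ('a \<Rightarrow> complex) set" where
  "L2 M = {f. f \<in> borel_measurable M \<and> integrable M (\<lambda>x. (cmod (f x))\<^sup>2)}"

definition L2_norm :: "'a measure \<Rightarrow> ('a \<Rightarrow> complex) \<Rightarrow> real" where
  "L2_norm M f = sqrt (LINT x|M. (cmod (f x))\<^sup>2)"

type_synonym plane = "real \<times> real"
type_synonym field2 = "plane \<Rightarrow> complex"

primrec Ck :: "nat \<Rightarrow> field2 \<Rightarrow> bool" where
  "Ck 0 f \<longleftrightarrow> continuous_on UNIV f"
| "Ck (Suc k) f \<longleftrightarrow> (\<forall>x. f differentiable (at x))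
     \<and> Ck k (\<lambda>x. frechet_derivative f (at x) (1, 0))
     \<and> Ck k (\<lambda>x. frechet_derivative f (at x) (0, 1))"

definition smooth :: "field2 \<Rightarrow> bool" where
  "smooth f \<longleftrightarrow> (\<forall>k. Ck k f)"

definition test_fun :: "plane set \<Rightarrow> field2 set" where
  "test_fun \<Omega> = {\<phi>. smooth \<phi> \<and> compact (closure {x. \<phi> x \<noteq> 0}) \<and> closure {x. \<phi> x \<noteq> 0} \<subseteq> \<Omega>}"

definition has_weak_deriv :: "plane set \<Rightarrow> plane \<Rightarrow> field2 \<Rightarrow> field2 \<Rightarrow> bool" where
  "has_weak_deriv \<Omega> v f g \<longleftrightarrow> f \<in> L2 (lebesgue_on \<Omega>) \<and> g \<in> L2 (lebesgue_on \<Omega>) \<and>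
     (\<forall>\<phi>\<in>test_fun \<Omega>. (LINT x|lebesgue_on \<Omega>. f x * frechet_derivative \<phi> (at x) v)
                      = - (LINT x|lebesgue_on \<Omega>. g x * \<phi> x))"

definition weak_deriv :: "plane set \<Rightarrow> plane \<Rightarrow> field2 \<Rightarrow> field2" where
  "weak_deriv \<Omega> v f = (SOME g. has_weak_deriv \<Omega> v f g)"

abbreviation "weak_dx \<Omega> \<equiv> weak_deriv \<Omega> (1, 0)"
abbreviation "weak_dy \<Omega> \<equiv> weak_deriv \<Omega> (0, 1)"

definition H1 :: "plane set \<Rightarrow> field2 set" where
  "H1 \<Omega> = {f \<in> L2 (lebesgue_on \<Omega>).
     (\<exists>g. has_weak_deriv \<Omega> (1, 0) f g) \<and> (\<exists>g. has_weak_deriv \<Omega> (0, 1) f g)}"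

definition H2 :: "plane set \<Rightarrow> field2 set" where
  "H2 \<Omega> = {f \<in> H1 \<Omega>. weak_dx \<Omega> f \<in> H1 \<Omega> \<and> weak_dy \<Omega> f \<in> H1 \<Omega>}"

definition grad_norm :: "plane set \<Rightarrow> field2 \<Rightarrow> real" where
  "grad_norm \<Omega> f = sqrt ((L2_norm (lebesgue_on \<Omega>) (weak_dx \<Omega> f))\<^sup>2
                       + (L2_norm (lebesgue_on \<Omega>) (weak_dy \<Omega> f))\<^sup>2)"

definition H1_norm :: "plane set \<Rightarrow> field2 \<Rightarrow> real" where
  "H1_norm \<Omega> f = sqrt ((L2_norm (lebesgue_on \<Omega>) f)\<^sup>2 + (grad_norm \<Omega> f)\<^sup>2)"

definition H10 :: "plane set \<Rightarrow> field2 set" where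
  "H10 \<Omega> = {f \<in> H1 \<Omega>. \<exists>\<phi>. (\<forall>n. \<phi> n \<in> test_fun \<Omega>) \<and>
                (\<lambda>n::nat. H1_norm \<Omega> (\<lambda>x. \<phi> n x - f x)) \<longlonglongrightarrow> 0}"

definition laplacian :: "plane set \<Rightarrow> field2 \<Rightarrow> field2" where
  "laplacian \<Omega> f = (\<lambda>x. weak_dx \<Omega> (weak_dx \<Omega> f) x + weak_dy \<Omega> (weak_dy \<Omega> f) x)"

definition dom_laplacian :: "plane set \<Rightarrow> field2 set" where
  "dom_laplacian \<Omega> = H2 \<Omega> \<inter> H10 \<Omega>"

definition laplacian_norm :: "plane set \<Rightarrow> field2 \<Rightarrow> real" where
  "laplacian_norm \<Omega> f = L2_norm (lebesgue_on \<Omega>) (laplacian \<Omega> f)"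

definition rect :: "real \<Rightarrow> real \<Rightarrow> plane set" where
  "rect a b = {0<..<a * pi} \<times> {0<..<b * pi}"

datatype side = Bottom | Top | Left | Right

primrec side_length :: "real \<Rightarrow> real \<Rightarrow> side \<Rightarrow> real" where
  "side_length a b Bottom = a * pi"
| "side_length a b Top = a * pi"
| "side_length a b Left = b * pi"
| "side_length a b Right = b * pi"

primrec side_param :: "real \<Rightarrow> real \<Rightarrow> side \<Rightarrow> real \<Rightarrow> plane" where
  "side_param a b Bottom = (\<lambda>s. (s, 0))"
| "side_param a b Top = (\<lambda>s. (s, b * pi))"
| "side_param a b Left = (\<lambda>s. (0, s))"
| "side_param a b Right = (\<lambda>s. (a * pi, s))"

definition side_set :: "real \<Rightarrow> real \<Rightarrow> side \<Rightarrow> plane set" where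
  "side_set a b S = side_param a b S ` {0<..<side_length a b S}"

text \<open>
  The arc length measure \<open>ds\<close> on the side: Lebesgue measure transported along the (injective)
  arc length parametrisation; its underlying space is \<open>side_set a b S\<close>.
\<close>

definition side_measure :: "real \<Rightarrow> real \<Rightarrow> side \<Rightarrow> plane measure" where
  "side_measure a b S =
     embed_measure (lebesgue_on {0<..<side_length a b S}) (side_param a b S)"

primrec outward_normal :: "side \<Rightarrow> plane" where
  "outward_normal Bottom = (0, -1)"
| "outward_normal Top = (0, 1)"
| "outward_normal Left = (-1, 0)"
| "outward_normal Right = (1, 0)"

text \<open>
  \<open>g\<close> is the trace of \<open>f \<in> H\<^sup>1\<close> on the side: the trace operator is the continuous extension to
  \<open>H\<^sup>1\<close> of the restriction of smooth functions to the side.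
\<close>

definition has_trace :: "real \<Rightarrow> real \<Rightarrow> side \<Rightarrow> field2 \<Rightarrow> field2 \<Rightarrow> bool" where
  "has_trace a b S f g \<longleftrightarrow> f \<in> H1 (rect a b) \<and> g \<in> L2 (side_measure a b S) \<and>
     (\<exists>\<phi>. (\<forall>n. smooth (\<phi> n)) \<and>
        (\<lambda>n::nat. H1_norm (rect a b) (\<lambda>x. \<phi> n x - f x)) \<longlonglongrightarrow> 0 \<and>
        (\<lambda>n. L2_norm (side_measure a b S) (\<lambda>x. \<phi> n x - g x)) \<longlonglongrightarrow> 0)"

definition trace :: "real \<Rightarrow> real \<Rightarrow> side \<Rightarrow> field2 \<Rightarrow> field2" where
  "trace a b S f = (SOME g. has_trace a b S f g)"

text \<open>
  The observation operator \<open>C\<^sub>0\<close>: trace of \<open>n \<cdot> \<nabla>u\<close>, where the normal \<open>n\<close> is constant along a side.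
\<close>

definition normal_deriv :: "real \<Rightarrow> real \<Rightarrow> side \<Rightarrow> field2 \<Rightarrow> field2" where
  "normal_deriv a b S u = trace a b S
     (\<lambda>x. complex_of_real (fst (outward_normal S)) * weak_dx (rect a b) u x
        + complex_of_real (snd (outward_normal S)) * weak_dy (rect a b) u x)"

definition obs_norm :: "real \<Rightarrow> real \<Rightarrow> side \<Rightarrow> real" where
  "obs_norm a b S = Inf {K. 0 \<le> K \<and> (\<forall>u\<in>dom_laplacian (rect a b).
      L2_norm (side_measure a b S) (normal_deriv a b S u) \<le> K * laplacian_norm (rect a b) u)}"

text \<open>
  Continuity and differentiability on \<open>[0, \<infinity>)\<close> of a curve of functions with respect to the norm
  \<open>N\<close>; at time \<open>0\<close> both notions are one-sided.
\<close>

definition time_continuous :: "(field2 \<Rightarrow> real) \<Rightarrow> (real \<Rightarrow> field2) \<Rightarrow> bool" where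
  "time_continuous N u \<longleftrightarrow>
     (\<forall>t\<ge>0. ((\<lambda>s. N (\<lambda>x. u s x - u t x)) \<longlongrightarrow> 0) (at t within {0..}))"

definition has_time_deriv :: "(field2 \<Rightarrow> real) \<Rightarrow> (real \<Rightarrow> field2) \<Rightarrow> (real \<Rightarrow> field2) \<Rightarrow> bool" where
  "has_time_deriv N u v \<longleftrightarrow>
     (\<forall>t\<ge>0. ((\<lambda>s. N (\<lambda>x. (u s x - u t x) / complex_of_real (s - t) - v t x)) \<longlongrightarrow> 0)
        (at t within {0..}))"

text \<open>
  Solutions with data in the domain of the wave generator: \<open>u\<close> belongs to
  \<open>C([0,\<infinity>); H\<^sup>2 \<inter> H\<^sub>0\<^sup>1) \<inter> C\<^sup>1([0,\<infinity>); H\<^sub>0\<^sup>1) \<inter> C\<^sup>2([0,\<infinity>); L\<^sup>2)\<close>, with first and second time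
  derivatives \<open>v\<close> and \<open>w\<close>. The Dirichlet condition is membership in \<open>H\<^sub>0\<^sup>1\<close>, on which
  \<open>grad_norm\<close> is a norm.
\<close>

definition wave_solution :: "plane set \<Rightarrow> field2 \<Rightarrow> field2 \<Rightarrow> (real \<Rightarrow> field2) \<Rightarrow> bool" where
  "wave_solution \<Omega> u0 u1 u \<longleftrightarrow> (\<exists>v w.
     (\<forall>t\<ge>0. u t \<in> dom_laplacian \<Omega> \<and> v t \<in> H10 \<Omega> \<and> w t \<in> L2 (lebesgue_on \<Omega>)) \<and>
     time_continuous (laplacian_norm \<Omega>) u \<and>
     time_continuous (grad_norm \<Omega>) v \<and>
     time_continuous (L2_norm (lebesgue_on \<Omega>)) w \<and>
     has_time_deriv (grad_norm \<Omega>) u v \<and>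
     has_time_deriv (L2_norm (lebesgue_on \<Omega>)) v w \<and>
     (\<forall>t\<ge>0. AE x in lebesgue_on \<Omega>. w t x - laplacian \<Omega> (u t) x = 0) \<and>
     (AE x in lebesgue_on \<Omega>. u 0 x = u0 x) \<and>
     (AE x in lebesgue_on \<Omega>. v 0 x = u1 x))"

definition energy :: "plane set \<Rightarrow> field2 \<Rightarrow> field2 \<Rightarrow> real" where
  "energy \<Omega> u0 u1 = (grad_norm \<Omega> u0)\<^sup>2 + (L2_norm (lebesgue_on \<Omega>) u1)\<^sup>2"

definition Lam :: "plane set \<Rightarrow> field2 \<Rightarrow> field2 \<Rightarrow> real" where
  "Lam \<Omega> u0 u1 = ((laplacian_norm \<Omega> u0)\<^sup>2 + (grad_norm \<Omega> u1)\<^sup>2) / energy \<Omega> u0 u1"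

definition Sigma_d :: "(real \<Rightarrow> real) set" where
  "Sigma_d = {f. (\<forall>x. 0 < f x) \<and> (\<forall>x. f (- x) = f x) \<and> continuous_on UNIV f \<and> antimono_on {0..} f}"

definition Sigma_i :: "(real \<Rightarrow> real) set" where
  "Sigma_i = {f. (\<forall>x. 0 < f x) \<and> (\<forall>x. f (- x) = f x) \<and> continuous_on UNIV f \<and> mono_on {0..} f}"

text \<open>
  The integrals are Bochner integrals with value \<open>0\<close> on non-integrable functions, so that the
  inequality also requires integrability in time. The pair \<open>(u0, u1)\<close> is nonzero as a pair of
  almost-everywhere classes.
\<close>

definition weakly_observable ::
    "real \<Rightarrow> real \<Rightarrow> side \<Rightarrow> (real \<Rightarrow> real) \<Rightarrow> (real \<Rightarrow> real) \<Rightarrow> bool" where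
  "weakly_observable a b S \<Psi> \<T> \<longleftrightarrow> \<Psi> \<in> Sigma_d \<and> \<T> \<in> Sigma_i \<and>
     (\<forall>u0 u1 u T.
        u0 \<in> dom_laplacian (rect a b) \<longrightarrow> u1 \<in> H10 (rect a b) \<longrightarrow>
        \<not> ((AE x in lebesgue_on (rect a b). u0 x = 0) \<and> (AE x in lebesgue_on (rect a b). u1 x = 0)) \<longrightarrow>
        wave_solution (rect a b) u0 u1 u \<longrightarrow>
        \<T> (Lam (rect a b) u0 u1) \<le> T \<longrightarrow>
        \<Psi> (Lam (rect a b) u0 u1) * energy (rect a b) u0 u1
          \<le> (LINT t:{0..T}|lborel. LINT x|side_measure a b S. (cmod (normal_deriv a b S (u t) x))\<^sup>2))"

end

theory Submission
  imports Defs
begin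

text \<open>
  The proof is a multiplier argument. Let \<open>l\<close> be the depth of the rectangle measured from the
  observed side \<open>\<Gamma>\<close>, let \<open>D\<close> be the partial derivative in the direction normal to \<open>\<Gamma>\<close>, and let \<open>h\<close> be
  the distance to the side opposite to \<open>\<Gamma>\<close>, with the sign of the outward normal, so that \<open>D h = 1\<close>. The
  field \<open>h D\<close> vanishes on the opposite side and is tangential to the two adjacent ones, so that the
  Rellich identity (lemma \<open>rellich\<close>) has boundary terms only on \<open>\<Gamma>\<close>. For a solution \<open>u\<close> with velocity
  \<open>v\<close> it gives

    \<open>d/dt (Re <v, h D u> + Re <v, u> / 2) = l/2 \<parallel>\<partial>u/\<partial>n\<parallel>\<^sup>2 - \<parallel>D u\<parallel>\<^sup>2\<close>,

  the norm of the normal derivative being that of \<open>L\<^sup>2(\<Gamma>)\<close>. The quantity that is differentiated on the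
  left is bounded by a multiple of the energy \<open>E = \<parallel>\<nabla>u\<parallel>\<^sup>2 + \<parallel>v\<parallel>\<^sup>2\<close>, which is conserved. The observation
  over \<open>[0, T]\<close> therefore controls the energy as soon as the integral of \<open>\<parallel>D u\<parallel>\<^sup>2\<close> over \<open>[0, T]\<close> exceeds
  a fixed multiple of \<open>E\<close>.

  Waves that travel along \<open>\<Gamma>\<close> make \<open>\<parallel>D u\<parallel>\<close> small, but only as far as their frequency is large, and
  \<open>\<Lambda>\<close> measures the frequency. Indeed, the Poincare inequality in the normal direction and the
  interpolation \<open>\<parallel>\<nabla>u\<parallel>\<^sup>2 \<le> \<parallel>u\<parallel> \<parallel>\<Delta>u\<parallel>\<close> give \<open>\<parallel>\<nabla>u\<parallel>\<^sup>4 \<le> 4 l\<^sup>2 \<parallel>D u\<parallel>\<^sup>2 \<parallel>\<Delta>u\<parallel>\<^sup>2\<close>; the second energy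
  \<open>\<parallel>\<Delta>u\<parallel>\<^sup>2 + \<parallel>\<nabla>v\<parallel>\<^sup>2 = \<Lambda> E\<close> is conserved as well; and \<open>\<parallel>\<nabla>u\<parallel>\<^sup>2\<close> equals \<open>E/2\<close> on average in time, up to a
  bounded error. Hence the integral of \<open>\<parallel>D u\<parallel>\<^sup>2\<close> over \<open>[0, T]\<close> is at least of the order of \<open>T E / \<Lambda>\<close>, and
  it suffices that \<open>T\<close> exceeds a multiple of \<open>1 + \<Lambda>\<close> that depends on \<open>l\<close>. By Young's inequality
  \<open>T \<ge> c\<^sub>1 + \<Lambda>\<^sup>2\<close> is enough for a suitable \<open>c\<^sub>1\<close> (lemma \<open>observability_estimate\<close>). In this range the
  observation even dominates the energy itself, so that \<open>1 / (1 + \<Lambda>\<^sup>2)\<close> serves as \<open>\<Psi>\<close>.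

  The work lies in the justification of these identities for weak derivatives. Its core is the
  lemma \<open>sine_approximation\<close>: a function in the domain of the Dirichlet Laplacian is the limit,
  together with all derivatives up to the second order, of its partial sums with respect to the
  Dirichlet eigenfunctions. These are smooth up to the boundary, the identities hold for them by
  the fundamental theorem of calculus, and both the existence of the trace of the normal
  derivative and the Rellich identity follow in the limit. The second energy of \<open>u\<close> is the limit of
  the first energies of the difference quotients of \<open>u\<close> in time, which are solutions themselves.
\<close>

section \<open>The Hilbert space of square integrable functions\<close>

definition ip :: "'a measure \<Rightarrow> ('a \<Rightarrow> complex) \<Rightarrow> ('a \<Rightarrow> complex) \<Rightarrow> complex" where
  "ip M f g = (LINT x|M. f x * cnj (g x))"

lemma L2_measurable: "f \<in> L2 M \<Longrightarrow> f \<in> borel_measurable M"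
  by (simp add: L2_def)

lemma L2_integrable_square: "f \<in> L2 M \<Longrightarrow> integrable M (\<lambda>x. (cmod (f x))\<^sup>2)"
  by (simp add: L2_def)

lemma L2_integrable_mult:
  assumes "f \<in> L2 M" "g \<in> L2 M"
  shows "integrable M (\<lambda>x. f x * g x)"
proof (rule Bochner_Integration.integrable_bound)
  show "integrable M (\<lambda>x. (cmod (f x))\<^sup>2 + (cmod (g x))\<^sup>2)"
    using assms by (intro Bochner_Integration.integrable_add) (auto simp: L2_def)
  show "(\<lambda>x. f x * g x) \<in> borel_measurable M"
    using assms by (intro borel_measurable_times) (auto simp: L2_def)
  have "cmod z * cmod w \<le> (cmod z)\<^sup>2 + (cmod w)\<^sup>2" for z w
    using sum_squares_bound[of "cmod z" "cmod w"] mult_nonneg_nonneg[of "cmod z" "cmod w"]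
    by (simp del: mult_nonneg_nonneg)
  then show "AE x in M. norm (f x * g x) \<le> norm ((cmod (f x))\<^sup>2 + (cmod (g x))\<^sup>2)"
    by (auto simp: norm_mult)
qed

lemma L2_cnj:
  assumes "f \<in> L2 M" shows "(\<lambda>x. cnj (f x)) \<in> L2 M"
proof -
  have "(\<lambda>x. cnj (f x)) \<in> borel_measurable M"
    using borel_measurable_continuous_on[of cnj f M] assms
    by (auto simp: L2_def intro: continuous_intros)
  then show ?thesis using assms by (simp add: L2_def)
qed

lemma L2_integrable_ip:
  assumes "f \<in> L2 M" "g \<in> L2 M"
  shows "integrable M (\<lambda>x. f x * cnj (g x))"
  using L2_integrable_mult[OF assms(1) L2_cnj[OF assms(2)]] .

lemma L2_add:
  assumes "f \<in> L2 M" "g \<in> L2 M" shows "(\<lambda>x. f x + g x) \<in> L2 M"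
proof -
  have m: "(\<lambda>x. f x + g x) \<in> borel_measurable M"
    using assms by (intro borel_measurable_add) (auto simp: L2_def)
  have "integrable M (\<lambda>x. (cmod (f x + g x))\<^sup>2)"
  proof (rule Bochner_Integration.integrable_bound)
    show "integrable M (\<lambda>x. 2 * (cmod (f x))\<^sup>2 + 2 * (cmod (g x))\<^sup>2)"
      using assms by (intro Bochner_Integration.integrable_add integrable_mult_right) (auto simp: L2_def)
    show "(\<lambda>x. (cmod (f x + g x))\<^sup>2) \<in> borel_measurable M"
      using m by measurable
    have "(cmod (z + w))\<^sup>2 \<le> 2 * (cmod z)\<^sup>2 + 2 * (cmod w)\<^sup>2" for z w
    proof -
      have "(cmod (z + w))\<^sup>2 \<le> (cmod z + cmod w)\<^sup>2"
        by (intro power_mono norm_triangle_ineq) auto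
      also have "\<dots> \<le> 2 * (cmod z)\<^sup>2 + 2 * (cmod w)\<^sup>2"
        using sum_squares_bound[of "cmod z" "cmod w"] by (simp add: power2_sum)
      finally show ?thesis .
    qed
    then show "AE x in M. norm ((cmod (f x + g x))\<^sup>2) \<le> norm (2 * (cmod (f x))\<^sup>2 + 2 * (cmod (g x))\<^sup>2)"
      by auto
  qed
  with m show ?thesis by (simp add: L2_def)
qed

lemma L2_mult_bounded:
  assumes "f \<in> L2 M" "h \<in> borel_measurable M" "\<And>x. x \<in> space M \<Longrightarrow> cmod (h x) \<le> B"
  shows "(\<lambda>x. h x * f x) \<in> L2 M"
proof -
  have m: "(\<lambda>x. h x * f x) \<in> borel_measurable M"
    using assms by (intro borel_measurable_times) (auto simp: L2_def)
  have "integrable M (\<lambda>x. (cmod (h x * f x))\<^sup>2)"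
  proof (rule Bochner_Integration.integrable_bound)
    show "integrable M (\<lambda>x. B\<^sup>2 * (cmod (f x))\<^sup>2)"
      using assms by (intro integrable_mult_right) (auto simp: L2_def)
    show "(\<lambda>x. (cmod (h x * f x))\<^sup>2) \<in> borel_measurable M"
      using m by measurable
    have "(cmod (h x * f x))\<^sup>2 \<le> B\<^sup>2 * (cmod (f x))\<^sup>2" if "x \<in> space M" for x
      using power_mono[OF assms(3)[OF that], of 2]
      by (simp add: norm_mult power_mult_distrib mult_right_mono)
    then show "AE x in M. norm ((cmod (h x * f x))\<^sup>2) \<le> norm (B\<^sup>2 * (cmod (f x))\<^sup>2)"
      by auto
  qed
  with m show ?thesis by (simp add: L2_def)
qed

lemma L2_scale: "f \<in> L2 M \<Longrightarrow> (\<lambda>x. c * f x) \<in> L2 M"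
  by (rule L2_mult_bounded[where B="cmod c"]) auto

lemma L2_zero: "(\<lambda>x. 0) \<in> L2 M"
  by (simp add: L2_def)

lemma L2_diff: "f \<in> L2 M \<Longrightarrow> g \<in> L2 M \<Longrightarrow> (\<lambda>x. f x - g x) \<in> L2 M"
  using L2_add[of f M "\<lambda>x. -1 * g x"] L2_scale[of g M "-1"] by simp

lemma L2_divide: "f \<in> L2 M \<Longrightarrow> (\<lambda>x. f x / c) \<in> L2 M"
  using L2_scale[of f M "inverse c"] by (simp add: field_simps)

lemma L2_sum: "(\<And>i. i \<in> A \<Longrightarrow> f i \<in> L2 M) \<Longrightarrow> (\<lambda>x. \<Sum>i\<in>A. f i x) \<in> L2 M"
  by (induction A rule: infinite_finite_induct) (auto intro: L2_add L2_zero)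

lemmas L2_intros = L2_add L2_diff L2_scale L2_divide L2_zero L2_sum L2_cnj

lemma L2_norm_nonneg [simp]: "0 \<le> L2_norm M f"
  by (simp add: L2_norm_def)

lemma L2_norm_power2: "(L2_norm M f)\<^sup>2 = (LINT x|M. (cmod (f x))\<^sup>2)"
  by (simp add: L2_norm_def)

lemma L2_norm_cong_AE:
  assumes "f \<in> borel_measurable M" "g \<in> borel_measurable M" "AE x in M. f x = g x"
  shows "L2_norm M f = L2_norm M g"
  unfolding L2_norm_def using assms by (intro arg_cong[where f=sqrt] integral_cong_AE) auto

lemma ip_cong_AE:
  assumes "f \<in> L2 M" "g \<in> L2 M" "f' \<in> L2 M" "g' \<in> L2 M"
    and "AE x in M. f x = f' x" "AE x in M. g x = g' x"
  shows "ip M f g = ip M f' g'"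
  unfolding ip_def
proof (rule integral_cong_AE)
  show "AE x in M. f x * cnj (g x) = f' x * cnj (g' x)" using assms(5,6) by eventually_elim simp
qed (use assms in \<open>auto intro!: borel_measurable_integrable L2_integrable_ip\<close>)

lemma ip_self: "ip M f f = complex_of_real ((L2_norm M f)\<^sup>2)"
proof -
  have "ip M f f = (LINT x|M. complex_of_real ((cmod (f x))\<^sup>2))"
    unfolding ip_def by (intro Bochner_Integration.integral_cong refl) (rule complex_norm_square[symmetric])
  then show ?thesis by (simp only: integral_complex_of_real L2_norm_power2)
qed

lemma Re_ip_self: "Re (ip M f f) = (L2_norm M f)\<^sup>2"
  by (simp only: ip_self Re_complex_of_real)

lemma ip_cnj: "cnj (ip M f g) = ip M g f"
  by (simp add: ip_def mult.commute flip: Bochner_Integration.integral_cnj)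

lemma Re_ip_sym: "Re (ip M f g) = Re (ip M g f)"
  by (metis ip_cnj cnj.simps(1))

lemma ip_add_left: "f \<in> L2 M \<Longrightarrow> g \<in> L2 M \<Longrightarrow> h \<in> L2 M \<Longrightarrow>
    ip M (\<lambda>x. f x + g x) h = ip M f h + ip M g h"
  by (simp add: ip_def L2_integrable_ip algebra_simps)

lemma ip_diff_left: "f \<in> L2 M \<Longrightarrow> g \<in> L2 M \<Longrightarrow> h \<in> L2 M \<Longrightarrow>
    ip M (\<lambda>x. f x - g x) h = ip M f h - ip M g h"
  by (simp add: ip_def L2_integrable_ip algebra_simps)

lemma ip_scale_left: "ip M (\<lambda>x. c * f x) h = c * ip M f h"
  by (simp add: ip_def mult.assoc)

lemma ip_add_right: "f \<in> L2 M \<Longrightarrow> g \<in> L2 M \<Longrightarrow> h \<in> L2 M \<Longrightarrow>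
    ip M h (\<lambda>x. f x + g x) = ip M h f + ip M h g"
  by (simp add: ip_def L2_integrable_ip algebra_simps)

lemma ip_diff_right: "f \<in> L2 M \<Longrightarrow> g \<in> L2 M \<Longrightarrow> h \<in> L2 M \<Longrightarrow>
    ip M h (\<lambda>x. f x - g x) = ip M h f - ip M h g"
  by (simp add: ip_def L2_integrable_ip algebra_simps)

lemma ip_scale_right: "ip M h (\<lambda>x. c * f x) = cnj c * ip M h f"
  by (simp add: ip_def mult.left_commute[of _ "cnj c"])

lemma ip_zero_left [simp]: "ip M (\<lambda>x. 0) h = 0"
  by (simp add: ip_def)

lemma ip_sum_left: "(\<And>i. i \<in> A \<Longrightarrow> f i \<in> L2 M) \<Longrightarrow> h \<in> L2 M \<Longrightarrow>
    ip M (\<lambda>x. \<Sum>i\<in>A. f i x) h = (\<Sum>i\<in>A. ip M (f i) h)"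
  by (induction A rule: infinite_finite_induct) (auto simp: ip_add_left L2_sum)

lemma L2_norm_scale: "L2_norm M (\<lambda>x. c * f x) = cmod c * L2_norm M f"
  by (simp add: L2_norm_def norm_mult power_mult_distrib real_sqrt_mult)

lemma L2_norm_diff_commute: "L2_norm M (\<lambda>x. f x - g x) = L2_norm M (\<lambda>x. g x - f x)"
  by (simp add: L2_norm_def norm_minus_commute)

text \<open>
  Integrate the weighted inequality \<open>|f g| \<le> t/2 |f|\<^sup>2 + 1/(2t) |g|\<^sup>2\<close> whose optimal weight is \<open>t = \<parallel>g\<parallel> / \<parallel>f\<parallel>\<close>.
\<close>

lemma cauchy_schwarz:
  assumes "f \<in> L2 M" "g \<in> L2 M"
  shows "cmod (ip M f g) \<le> L2_norm M f * L2_norm M g"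
proof (rule field_le_epsilon)
  let ?a = "L2_norm M f" and ?b = "L2_norm M g"
  fix e :: real assume e: "0 < e"
  \<comment> \<open>Weighted arithmetic-geometric mean, the weight being shifted so that it never degenerates.\<close>
  define d where "d = min 1 (e / (?a + ?b + 1))"
  have ab: "0 < ?a + ?b + 1" using L2_norm_nonneg[of M f] L2_norm_nonneg[of M g] by linarith
  have d: "0 < d" "d \<le> 1" using e ab by (auto simp: d_def)
  have d3: "d * (?a + ?b + 1) \<le> e"
    using mult_right_mono[of d "e / (?a + ?b + 1)" "?a + ?b + 1"] ab by (simp add: d_def)
  define t where "t = (?b + d) / (?a + d)"
  have ad: "0 < ?a + d" "0 < ?b + d" using d by (auto intro: add_nonneg_pos)
  then have t: "0 < t" by (simp add: t_def)
  have pt: "cmod (f x * cnj (g x)) \<le> (t / 2) * (cmod (f x))\<^sup>2 + (1 / (2 * t)) * (cmod (g x))\<^sup>2" for x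
  proof -
    have "0 \<le> (t * cmod (f x) - cmod (g x))\<^sup>2 / (2 * t)" using t by simp
    also have "\<dots> = (t / 2) * (cmod (f x))\<^sup>2 + (1 / (2 * t)) * (cmod (g x))\<^sup>2 - cmod (f x) * cmod (g x)"
      using t by (simp add: field_simps power2_eq_square)
    finally show ?thesis by (simp add: norm_mult)
  qed
  have "cmod (ip M f g) \<le> (LINT x|M. cmod (f x * cnj (g x)))"
    unfolding ip_def by (rule integral_norm_bound)
  also have "\<dots> \<le> (LINT x|M. (t / 2) * (cmod (f x))\<^sup>2 + (1 / (2 * t)) * (cmod (g x))\<^sup>2)"
    using assms pt by (intro integral_mono integrable_norm L2_integrable_ip
        Bochner_Integration.integrable_add integrable_mult_right L2_integrable_square) auto
  also have "\<dots> = (t / 2) * ?a\<^sup>2 + (1 / (2 * t)) * ?b\<^sup>2"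
    using assms by (simp add: L2_norm_power2 L2_integrable_square)
  also have "\<dots> \<le> (t / 2) * (?a + d)\<^sup>2 + (1 / (2 * t)) * (?b + d)\<^sup>2"
    using t d by (intro add_mono mult_left_mono power_mono) auto
  also have "\<dots> = (?a + d) * (?b + d)"
  proof -
    have "p / q / 2 * q\<^sup>2 + 1 / (2 * (p / q)) * p\<^sup>2 = q * p" if "0 < p" "0 < q" for p q :: real
      using that by (simp add: field_simps power2_eq_square)
    from this[OF ad(2,1)] show ?thesis unfolding t_def .
  qed
  also have "\<dots> \<le> ?a * ?b + e"
  proof -
    have "(?a + d) * (?b + d) = ?a * ?b + d * (?a + ?b + d)" by (simp add: algebra_simps)
    also have "d * (?a + ?b + d) \<le> d * (?a + ?b + 1)" using d by (intro mult_left_mono) auto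
    finally show ?thesis using d3 by linarith
  qed
  finally show "cmod (ip M f g) \<le> ?a * ?b + e" .
qed

lemma Re_ip_le:
  assumes "f \<in> L2 M" "g \<in> L2 M"
  shows "\<bar>Re (ip M f g)\<bar> \<le> L2_norm M f * L2_norm M g"
  using cauchy_schwarz[OF assms] abs_Re_le_cmod order_trans by blast

lemma L2_norm_add_power2:
  assumes "f \<in> L2 M" "g \<in> L2 M"
  shows "(L2_norm M (\<lambda>x. f x + g x))\<^sup>2 = (L2_norm M f)\<^sup>2 + 2 * Re (ip M f g) + (L2_norm M g)\<^sup>2"
  using assms Re_ip_sym[of M g f]
  by (simp flip: Re_ip_self add: ip_add_left ip_add_right L2_add)

lemma L2_norm_triangle:
  assumes "f \<in> L2 M" "g \<in> L2 M"
  shows "L2_norm M (\<lambda>x. f x + g x) \<le> L2_norm M f + L2_norm M g"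
proof (rule power2_le_imp_le)
  show "(L2_norm M (\<lambda>x. f x + g x))\<^sup>2 \<le> (L2_norm M f + L2_norm M g)\<^sup>2"
    using L2_norm_add_power2[OF assms] Re_ip_le[OF assms] by (simp add: power2_sum)
qed simp

lemma L2_norm_triangle_diff:
  assumes "f \<in> L2 M" "g \<in> L2 M" "h \<in> L2 M"
  shows "L2_norm M (\<lambda>x. f x - h x) \<le> L2_norm M (\<lambda>x. f x - g x) + L2_norm M (\<lambda>x. g x - h x)"
  using L2_norm_triangle[of "\<lambda>x. f x - g x" M "\<lambda>x. g x - h x"] assms by (simp add: L2_diff)

lemma L2_norm_triangle_rev:
  assumes "f \<in> L2 M" "g \<in> L2 M"
  shows "\<bar>L2_norm M f - L2_norm M g\<bar> \<le> L2_norm M (\<lambda>x. f x - g x)"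
  using L2_norm_triangle[of "\<lambda>x. f x - g x" M g] L2_norm_triangle[of "\<lambda>x. g x - f x" M f]
    L2_norm_diff_commute[of M f g] assms by (simp add: L2_diff abs_le_iff)

text \<open>
  The norm of a function that is not square integrable may be 0, the default value of the integral, so
  that membership in \<open>L2\<close> must be part of convergence. It is demanded only eventually, because curves
  of functions will be controlled only for nonnegative times.
\<close>

definition L2_lim :: "'i filter \<Rightarrow> 'a measure \<Rightarrow> ('i \<Rightarrow> 'a \<Rightarrow> complex) \<Rightarrow> ('a \<Rightarrow> complex) \<Rightarrow> bool" where
  "L2_lim F M u f \<longleftrightarrow> f \<in> L2 M \<and> (\<forall>\<^sub>F i in F. u i \<in> L2 M) \<and>
     ((\<lambda>i. L2_norm M (\<lambda>x. u i x - f x)) \<longlongrightarrow> 0) F"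

lemma L2_limD:
  assumes "L2_lim F M u f"
  shows "f \<in> L2 M" "\<forall>\<^sub>F i in F. u i \<in> L2 M" "((\<lambda>i. L2_norm M (\<lambda>x. u i x - f x)) \<longlongrightarrow> 0) F"
  using assms by (auto simp: L2_lim_def)

lemma L2_lim_bound:
  assumes "f \<in> L2 M" "\<forall>\<^sub>F i in F. u i \<in> L2 M"
    "\<forall>\<^sub>F i in F. L2_norm M (\<lambda>x. u i x - f x) \<le> b i" "(b \<longlongrightarrow> 0) F"
  shows "L2_lim F M u f"
  unfolding L2_lim_def using assms
  by (auto intro!: tendsto_sandwich[OF _ assms(3) tendsto_const assms(4)])

lemma L2_lim_const: "f \<in> L2 M \<Longrightarrow> L2_lim F M (\<lambda>i. f) f"
  by (simp add: L2_lim_def L2_norm_def)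

lemma L2_lim_add:
  assumes "L2_lim F M u f" "L2_lim F M v g"
  shows "L2_lim F M (\<lambda>i x. u i x + v i x) (\<lambda>x. f x + g x)"
proof (rule L2_lim_bound)
  note u = L2_limD[OF assms(1)] and v = L2_limD[OF assms(2)]
  show "(\<lambda>x. f x + g x) \<in> L2 M" using u v by (auto intro: L2_intros)
  show "\<forall>\<^sub>F i in F. (\<lambda>x. u i x + v i x) \<in> L2 M"
    using u(2) v(2) by eventually_elim (rule L2_add)
  show "\<forall>\<^sub>F i in F. L2_norm M (\<lambda>x. u i x + v i x - (f x + g x)) \<le>
      L2_norm M (\<lambda>x. u i x - f x) + L2_norm M (\<lambda>x. v i x - g x)"
    using u(2) v(2)
  proof eventually_elim
    case (elim i)
    then show ?case
      using L2_norm_triangle[of "\<lambda>x. u i x - f x" M "\<lambda>x. v i x - g x"] u(1) v(1)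
      by (simp add: L2_diff algebra_simps)
  qed
  show "((\<lambda>i. L2_norm M (\<lambda>x. u i x - f x) + L2_norm M (\<lambda>x. v i x - g x)) \<longlongrightarrow> 0) F"
    using tendsto_add[OF u(3) v(3)] by simp
qed

lemma L2_lim_mult_bounded:
  assumes "L2_lim F M u f" "h \<in> borel_measurable M" "\<And>x. x \<in> space M \<Longrightarrow> cmod (h x) \<le> B"
  shows "L2_lim F M (\<lambda>i x. h x * u i x) (\<lambda>x. h x * f x)"
proof (rule L2_lim_bound)
  note u = L2_limD[OF assms(1)]
  show "(\<lambda>x. h x * f x) \<in> L2 M" by (rule L2_mult_bounded[OF u(1) assms(2,3)])
  show "\<forall>\<^sub>F i in F. (\<lambda>x. h x * u i x) \<in> L2 M"
    using u(2) by eventually_elim (rule L2_mult_bounded[OF _ assms(2,3)])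
  show "\<forall>\<^sub>F i in F. L2_norm M (\<lambda>x. h x * u i x - h x * f x) \<le> \<bar>B\<bar> * L2_norm M (\<lambda>x. u i x - f x)"
    using u(2)
  proof eventually_elim
    case (elim i)
    have d: "(\<lambda>x. u i x - f x) \<in> L2 M" using elim u by (auto intro: L2_intros)
    have "(L2_norm M (\<lambda>x. h x * u i x - h x * f x))\<^sup>2 \<le> (LINT x|M. B\<^sup>2 * (cmod (u i x - f x))\<^sup>2)"
      unfolding L2_norm_power2
    proof (rule integral_mono)
      show "integrable M (\<lambda>x. (cmod (h x * u i x - h x * f x))\<^sup>2)"
        using L2_integrable_square[OF L2_mult_bounded[OF d assms(2,3)]] by (simp add: algebra_simps)
      show "integrable M (\<lambda>x. B\<^sup>2 * (cmod (u i x - f x))\<^sup>2)"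
        using d by (intro integrable_mult_right L2_integrable_square)
      fix x assume "x \<in> space M"
      then have "(cmod (h x))\<^sup>2 \<le> B\<^sup>2" using assms(3) by (intro power_mono) auto
      then have "(cmod (h x))\<^sup>2 * (cmod (u i x - f x))\<^sup>2 \<le> B\<^sup>2 * (cmod (u i x - f x))\<^sup>2"
        by (rule mult_right_mono) simp
      then show "(cmod (h x * u i x - h x * f x))\<^sup>2 \<le> B\<^sup>2 * (cmod (u i x - f x))\<^sup>2"
        by (simp flip: right_diff_distrib power_mult_distrib norm_mult)
    qed
    then have "(L2_norm M (\<lambda>x. h x * u i x - h x * f x))\<^sup>2 \<le> (\<bar>B\<bar> * L2_norm M (\<lambda>x. u i x - f x))\<^sup>2"
      by (simp add: power_mult_distrib L2_norm_power2)
    then show ?case by (rule power2_le_imp_le) simp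
  qed
  show "((\<lambda>i. \<bar>B\<bar> * L2_norm M (\<lambda>x. u i x - f x)) \<longlongrightarrow> 0) F"
    using tendsto_mult_right_zero[OF u(3)] by simp
qed

lemma L2_lim_scale: "L2_lim F M u f \<Longrightarrow> L2_lim F M (\<lambda>i x. c * u i x) (\<lambda>x. c * f x)"
  by (rule L2_lim_mult_bounded[where B="cmod c"]) auto

lemma L2_lim_diff:
  assumes "L2_lim F M u f" "L2_lim F M v g"
  shows "L2_lim F M (\<lambda>i x. u i x - v i x) (\<lambda>x. f x - g x)"
  using L2_lim_add[OF assms(1) L2_lim_scale[OF assms(2), of "-1"]] by simp

lemma L2_lim_cong_AE:
  assumes "L2_lim F M u f" "\<forall>\<^sub>F i in F. v i \<in> L2 M \<and> (AE x in M. v i x = u i x)"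
    "g \<in> L2 M" "AE x in M. g x = f x"
  shows "L2_lim F M v g"
proof (rule L2_lim_bound[OF assms(3)])
  note u = L2_limD[OF assms(1)]
  show "\<forall>\<^sub>F i in F. v i \<in> L2 M" using assms(2) by eventually_elim auto
  show "\<forall>\<^sub>F i in F. L2_norm M (\<lambda>x. v i x - g x) \<le> L2_norm M (\<lambda>x. u i x - f x)"
    using assms(2) u(2)
  proof eventually_elim
    case (elim i)
    have "L2_norm M (\<lambda>x. v i x - g x) = L2_norm M (\<lambda>x. u i x - f x)"
    proof (rule L2_norm_cong_AE)
      show "AE x in M. v i x - g x = u i x - f x" using elim assms(4) by auto
    qed (use elim assms(3) u(1) in \<open>auto intro!: L2_measurable L2_diff\<close>)
    then show ?case by simp
  qed
  show "((\<lambda>i. L2_norm M (\<lambda>x. u i x - f x)) \<longlongrightarrow> 0) F" by (rule u(3))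
qed

lemma L2_lim_norm:
  assumes "L2_lim F M u f" shows "((\<lambda>i. L2_norm M (u i)) \<longlongrightarrow> L2_norm M f) F"
proof (rule LIM_zero_cancel, rule tendsto_rabs_zero_cancel)
  note u = L2_limD[OF assms]
  show "((\<lambda>i. \<bar>L2_norm M (u i) - L2_norm M f\<bar>) \<longlongrightarrow> 0) F"
  proof (rule tendsto_sandwich[OF _ _ tendsto_const u(3)])
    show "\<forall>\<^sub>F i in F. \<bar>L2_norm M (u i) - L2_norm M f\<bar> \<le> L2_norm M (\<lambda>x. u i x - f x)"
      using u(2) by eventually_elim (rule L2_norm_triangle_rev[OF _ u(1)])
  qed simp
qed

lemma L2_lim_ip:
  assumes "L2_lim F M u f" "L2_lim F M v g"
  shows "((\<lambda>i. ip M (u i) (v i)) \<longlongrightarrow> ip M f g) F"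
proof (rule LIM_zero_cancel, rule Lim_null_comparison)
  note u = L2_limD[OF assms(1)] and v = L2_limD[OF assms(2)]
  show "\<forall>\<^sub>F i in F. cmod (ip M (u i) (v i) - ip M f g) \<le>
     L2_norm M (\<lambda>x. u i x - f x) * L2_norm M (v i) + L2_norm M f * L2_norm M (\<lambda>x. v i x - g x)"
    using u(2) v(2)
  proof eventually_elim
    case (elim i)
    have eq: "ip M (u i) (v i) - ip M f g = ip M (\<lambda>x. u i x - f x) (v i) + ip M f (\<lambda>x. v i x - g x)"
      using elim u(1) v(1) by (simp add: ip_diff_left ip_diff_right)
    moreover have "cmod (ip M (\<lambda>x. u i x - f x) (v i)) \<le> L2_norm M (\<lambda>x. u i x - f x) * L2_norm M (v i)"
      using elim u(1) by (intro cauchy_schwarz L2_diff)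
    moreover have "cmod (ip M f (\<lambda>x. v i x - g x)) \<le> L2_norm M f * L2_norm M (\<lambda>x. v i x - g x)"
      using elim u(1) v(1) by (intro cauchy_schwarz L2_diff)
    ultimately show ?case
      unfolding eq using norm_triangle_ineq[of "ip M (\<lambda>x. u i x - f x) (v i)" "ip M f (\<lambda>x. v i x - g x)"] by linarith
  qed
  show "((\<lambda>i. L2_norm M (\<lambda>x. u i x - f x) * L2_norm M (v i) + L2_norm M f * L2_norm M (\<lambda>x. v i x - g x)) \<longlongrightarrow> 0) F"
    using tendsto_add[OF tendsto_mult[OF u(3) L2_lim_norm[OF assms(2)]]
        tendsto_mult[OF tendsto_const[of "L2_norm M f"] v(3)]] by simp
qed

section \<open>Completeness\<close>

text \<open>
  A subsequence whose consecutive distances are at most \<open>2\<^sup>-\<^sup>k\<close> converges almost everywhere, because the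
  sum of the moduli of its increments is square integrable by monotone convergence. Fatou's lemma
  turns the Cauchy property into convergence in norm to this pointwise limit.
\<close>

lemma L2_complete:
  assumes mem: "\<And>n. u n \<in> L2 M"
    and cauchy: "\<And>e. 0 < e \<Longrightarrow> \<exists>N::nat. \<forall>m\<ge>N. \<forall>n\<ge>N. L2_norm M (\<lambda>x. u m x - u n x) < e"
  shows "\<exists>f. L2_lim sequentially M u f"
proof -
  have "\<forall>k. \<exists>N. \<forall>m\<ge>N. \<forall>n\<ge>N. L2_norm M (\<lambda>x. u m x - u n x) < (1/2)^k"
    using cauchy by simp
  then obtain N where N: "\<And>k m n. m \<ge> N k \<Longrightarrow> n \<ge> N k \<Longrightarrow> L2_norm M (\<lambda>x. u m x - u n x) < (1/2)^k"
    by metis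
  define r where "r k = (\<Sum>i\<le>k. N i) + k" for k
  have rN: "N k \<le> r k" for k unfolding r_def by (rule trans_le_add1) (simp add: member_le_sum)
  have rmono: "r k \<le> r (Suc k)" for k by (simp add: r_def)
  have rk: "k \<le> r k" for k by (simp add: r_def)
  define d where "d k = (\<lambda>x. u (r (Suc k)) x - u (r k) x)" for k
  have dL2: "d k \<in> L2 M" for k unfolding d_def by (intro L2_diff mem)
  have dn: "L2_norm M (d k) \<le> (1/2)^k" for k
    unfolding d_def using N[of k "r (Suc k)" "r k"] rN[of k] rmono[of k] by simp
  define s where "s n = (\<lambda>x. \<Sum>k<n. cmod (d k x))" for n
  have sL2: "(\<lambda>x. complex_of_real (s n x)) \<in> L2 M" for n
  proof -
    have "(\<lambda>x. complex_of_real (cmod (f x))) \<in> L2 M" if "f \<in> L2 M" for f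
      using that by (auto simp: L2_def intro!: borel_measurable_of_real)
    from this[OF dL2] show ?thesis unfolding s_def of_real_sum by (intro L2_sum) auto
  qed
  have sn: "L2_norm M (\<lambda>x. complex_of_real (s n x)) \<le> (\<Sum>k<n. (1/2)^k)" for n
  proof (induction n)
    case 0 show ?case by (simp add: s_def L2_norm_def)
  next
    case (Suc n)
    have c: "(\<lambda>x. complex_of_real (cmod (d n x))) \<in> L2 M"
      using dL2[of n] by (auto simp: L2_def intro!: borel_measurable_of_real)
    have "L2_norm M (\<lambda>x. complex_of_real (s (Suc n) x)) =
        L2_norm M (\<lambda>x. complex_of_real (s n x) + complex_of_real (cmod (d n x)))"
      by (simp add: s_def)
    also have "\<dots> \<le> L2_norm M (\<lambda>x. complex_of_real (s n x)) + L2_norm M (\<lambda>x. complex_of_real (cmod (d n x)))"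
      by (rule L2_norm_triangle[OF sL2 c])
    also have "L2_norm M (\<lambda>x. complex_of_real (cmod (d n x))) = L2_norm M (d n)" by (simp add: L2_norm_def)
    finally show ?case using Suc dn[of n] by simp
  qed
  have sm: "s n \<in> borel_measurable M" for n
    unfolding s_def using L2_measurable[OF dL2] by measurable
  have s2: "(\<integral>\<^sup>+x. ennreal ((s n x)\<^sup>2) \<partial>M) \<le> 4" for n
  proof -
    have int: "integrable M (\<lambda>x. (s n x)\<^sup>2)" using L2_integrable_square[OF sL2[of n]] by (simp only: norm_of_real power2_abs)
    have "(\<Sum>k<n. (1/2)^k) \<le> (2::real)" by (subst sum_gp_strict) simp
    then have "L2_norm M (\<lambda>x. complex_of_real (s n x)) \<le> 2" using sn[of n] by linarith
    then have "(L2_norm M (\<lambda>x. complex_of_real (s n x)))\<^sup>2 \<le> 2\<^sup>2" by (intro power_mono) auto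
    then have "(LINT x|M. (s n x)\<^sup>2) \<le> 4" unfolding L2_norm_power2 by (simp only: norm_of_real power2_abs) simp
    then show ?thesis by (subst nn_integral_eq_integral[OF int]) (auto simp flip: ennreal_numeral intro: ennreal_leI)
  qed
  have "AE x in M. (SUP n. ennreal ((s n x)\<^sup>2)) \<noteq> \<infinity>"
  proof (rule nn_integral_PInf_AE)
    have "(\<integral>\<^sup>+x. (SUP n. ennreal ((s n x)\<^sup>2)) \<partial>M) = (SUP n. (\<integral>\<^sup>+x. ennreal ((s n x)\<^sup>2) \<partial>M))"
    proof (rule nn_integral_monotone_convergence_SUP)
      show "incseq (\<lambda>n x. ennreal ((s n x)\<^sup>2))"
        by (intro incseq_SucI le_funI ennreal_leI power_mono) (auto simp: s_def sum_nonneg)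
    qed (use sm in measurable)
    also have "\<dots> \<le> 4" by (intro SUP_least s2)
    also have "4 < (\<infinity>::ennreal)" by simp
    finally show "(\<integral>\<^sup>+x. (SUP n. ennreal ((s n x)\<^sup>2)) \<partial>M) \<noteq> \<infinity>" by simp
  qed (use sm in measurable)
  then have AEconv: "AE x in M. convergent (\<lambda>k. u (r k) x)"
  proof (rule AE_mp, intro AE_I2 impI)
    fix x assume "(SUP n. ennreal ((s n x)\<^sup>2)) \<noteq> \<infinity>"
    then obtain B where B: "(SUP n. ennreal ((s n x)\<^sup>2)) = ennreal B" "0 \<le> B"
      by (cases "SUP n. ennreal ((s n x)\<^sup>2)") auto
    have "s n x \<le> sqrt B" for n
    proof -
      have "ennreal ((s n x)\<^sup>2) \<le> ennreal B" using SUP_upper[of n UNIV "\<lambda>n. ennreal ((s n x)\<^sup>2)"] B by simp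
      then show ?thesis using B by (intro real_le_rsqrt) simp
    qed
    then have "summable (\<lambda>k. cmod (d k x))"
      by (intro summableI_nonneg_bounded[of _ "sqrt B"]) (auto simp: s_def)
    then have "summable (\<lambda>k. d k x)" by (rule summable_norm_cancel)
    then have "convergent (\<lambda>n. \<Sum>k<n. d k x)" by (simp add: summable_iff_convergent)
    moreover have "(\<Sum>k<n. d k x) = u (r n) x - u (r 0) x" for n
      unfolding d_def by (rule sum_lessThan_telescope)
    ultimately have "convergent (\<lambda>n. (u (r n) x - u (r 0) x) + u (r 0) x)"
      by (intro convergent_add convergent_const) simp
    then show "convergent (\<lambda>k. u (r k) x)" by simp
  qed
  define f where "f = (\<lambda>x. lim (\<lambda>k. u (r k) x))"
  have fm: "f \<in> borel_measurable M"
    unfolding f_def using L2_measurable[OF mem] by (intro borel_measurable_lim_metric) auto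
  have AEf: "AE x in M. (\<lambda>k. u (r k) x) \<longlonglongrightarrow> f x"
    using AEconv by (auto simp: f_def convergent_LIMSEQ_iff)
  have fatou: "(\<integral>\<^sup>+x. ennreal ((cmod (u m x - f x))\<^sup>2) \<partial>M) \<le> ennreal (e\<^sup>2)"
    if le: "\<And>n. n \<ge> N0 \<Longrightarrow> L2_norm M (\<lambda>x. u m x - u n x) \<le> e" for m N0 e
  proof -
    have "(\<integral>\<^sup>+x. ennreal ((cmod (u m x - f x))\<^sup>2) \<partial>M) =
        (\<integral>\<^sup>+x. liminf (\<lambda>k. ennreal ((cmod (u m x - u (r k) x))\<^sup>2)) \<partial>M)"
    proof (rule nn_integral_cong_AE, use AEf in \<open>rule AE_mp\<close>, intro AE_I2 impI)
      fix x assume "(\<lambda>k. u (r k) x) \<longlonglongrightarrow> f x"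
      then have "(\<lambda>k. ennreal ((cmod (u m x - u (r k) x))\<^sup>2)) \<longlonglongrightarrow> ennreal ((cmod (u m x - f x))\<^sup>2)"
        by (intro tendsto_intros)
      then show "ennreal ((cmod (u m x - f x))\<^sup>2) = liminf (\<lambda>k. ennreal ((cmod (u m x - u (r k) x))\<^sup>2))"
        using lim_imp_Liminf[OF sequentially_bot] by metis
    qed
    also have "\<dots> \<le> liminf (\<lambda>k. (\<integral>\<^sup>+x. ennreal ((cmod (u m x - u (r k) x))\<^sup>2) \<partial>M))"
      using L2_measurable[OF mem] by (intro nn_integral_liminf) measurable
    also have "\<dots> \<le> liminf (\<lambda>k::nat. ennreal (e\<^sup>2))"
    proof (rule Liminf_mono)
      show "\<forall>\<^sub>F k in sequentially. (\<integral>\<^sup>+x. ennreal ((cmod (u m x - u (r k) x))\<^sup>2) \<partial>M) \<le> ennreal (e\<^sup>2)"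
        using eventually_ge_at_top[of N0]
      proof eventually_elim
        case (elim k)
        have "(L2_norm M (\<lambda>x. u m x - u (r k) x))\<^sup>2 \<le> e\<^sup>2"
          using le[of "r k"] rk[of k] elim by (intro power_mono) auto
        then show ?case unfolding L2_norm_power2
          by (subst nn_integral_eq_integral[OF L2_integrable_square]) (auto intro: L2_diff mem ennreal_leI)
      qed
    qed
    also have "\<dots> = ennreal (e\<^sup>2)" by (rule Liminf_const) simp
    finally show ?thesis .
  qed
  have dm: "(\<lambda>x. u m x - f x) \<in> borel_measurable M" for m
    using L2_measurable[OF mem[of m]] fm by simp
  have dL2: "(\<lambda>x. u m x - f x) \<in> L2 M \<and> L2_norm M (\<lambda>x. u m x - f x) \<le> e"
    if le: "\<And>n. n \<ge> N0 \<Longrightarrow> L2_norm M (\<lambda>x. u m x - u n x) \<le> e" for m N0 e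
  proof -
    have e: "0 \<le> e" using le[of N0] L2_norm_nonneg order_trans by blast
    have F: "(\<integral>\<^sup>+x. ennreal ((cmod (u m x - f x))\<^sup>2) \<partial>M) \<le> ennreal (e\<^sup>2)" by (rule fatou[OF le])
    have int: "integrable M (\<lambda>x. (cmod (u m x - f x))\<^sup>2)"
    proof (rule integrableI_bounded)
      show "(\<lambda>x. (cmod (u m x - f x))\<^sup>2) \<in> borel_measurable M" using dm by measurable
      show "(\<integral>\<^sup>+x. ennreal (norm ((cmod (u m x - f x))\<^sup>2)) \<partial>M) < \<infinity>"
        using F by (simp add: le_less_trans)
    qed
    have "(LINT x|M. (cmod (u m x - f x))\<^sup>2) \<le> e\<^sup>2"
      using F by (subst (asm) nn_integral_eq_integral[OF int]) auto
    then have "(L2_norm M (\<lambda>x. u m x - f x))\<^sup>2 \<le> e\<^sup>2" by (simp add: L2_norm_power2)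
    then have "L2_norm M (\<lambda>x. u m x - f x) \<le> e" by (rule power2_le_imp_le[OF _ e])
    with int dm show ?thesis by (simp add: L2_def)
  qed
  have "(\<lambda>x. u (N 0) x - f x) \<in> L2 M"
    using dL2[of "N 0" "N 0" 1] N[of 0 "N 0"] by (auto intro: less_imp_le)
  from L2_diff[OF mem[of "N 0"] this] have fL2: "f \<in> L2 M" by simp
  have "(\<lambda>n. L2_norm M (\<lambda>x. u n x - f x)) \<longlonglongrightarrow> 0"
  proof (rule LIMSEQ_I)
    fix e :: real assume "0 < e"
    then obtain N1 where N1: "\<And>m n. m \<ge> N1 \<Longrightarrow> n \<ge> N1 \<Longrightarrow> L2_norm M (\<lambda>x. u m x - u n x) < e/2"
      using cauchy[of "e/2"] by auto
    have "L2_norm M (\<lambda>x. u m x - f x) \<le> e/2" if "m \<ge> N1" for m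
      using dL2[of N1 m "e/2"] N1[OF that] by (auto intro: less_imp_le)
    then show "\<exists>no. \<forall>n\<ge>no. norm (L2_norm M (\<lambda>x. u n x - f x) - 0) < e"
      using \<open>0 < e\<close> by (intro exI[of _ N1]) force
  qed
  with fL2 mem show ?thesis unfolding L2_lim_def by auto
qed

text \<open>
  By Pythagoras the squared distance of two partial sums is a difference of two partial sums of a
  series that Bessel's inequality bounds. The vectors \<open>e i\<close> are orthogonal but not normalised, whence
  the quotient in the coefficient; for a vector of norm 0 it has the default value 0, which agrees
  with \<open>ip M f (e i) = 0\<close>.
\<close>

lemma riesz_fischer:
  fixes e :: "'i \<Rightarrow> 'a \<Rightarrow> complex" and A :: "nat \<Rightarrow> 'i set"
  assumes f: "f \<in> L2 M" and e: "\<And>i. e i \<in> L2 M"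
    and orth: "\<And>i j. i \<noteq> j \<Longrightarrow> ip M (e i) (e j) = 0"
    and A: "mono A" "\<And>n. finite (A n)"
    and c: "c = (\<lambda>i. ip M f (e i) / ip M (e i) (e i))"
  shows "\<exists>g. L2_lim sequentially M (\<lambda>n x. \<Sum>i\<in>A n. c i * e i x) g \<and>
     (\<forall>i\<in>\<Union>n. A n. ip M g (e i) = ip M f (e i))"
proof -
  define P where "P B = (\<lambda>x. \<Sum>i\<in>B. c i * e i x)" for B
  have PL2: "P B \<in> L2 M" for B unfolding P_def by (intro L2_sum L2_scale e)
  have ce: "c i * ip M (e i) (e i) = ip M f (e i)" for i
  proof (cases "ip M (e i) (e i) = 0")
    case True
    then have "cmod (ip M f (e i)) \<le> 0"
      using cauchy_schwarz[OF f e, of i] by (simp add: ip_self)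
    with True show ?thesis by simp
  qed (simp add: c)
  have Pe: "ip M (P B) (e j) = (if j \<in> B then ip M f (e j) else 0)" if "finite B" for B j
  proof -
    have "ip M (P B) (e j) = (\<Sum>i\<in>B. c i * ip M (e i) (e j))"
      unfolding P_def by (subst ip_sum_left) (auto intro: L2_scale e simp: ip_scale_left)
    also have "\<dots> = (\<Sum>i\<in>B. if i = j then c i * ip M (e i) (e i) else 0)"
      by (rule sum.cong) (auto simp: orth)
    finally show ?thesis using that ce by simp
  qed
  define q where "q i = Re (cnj (c i) * ip M f (e i))" for i
  have q: "q i = (cmod (c i))\<^sup>2 * (L2_norm M (e i))\<^sup>2" for i
  proof -
    have "cnj (c i) * ip M f (e i) = cnj (c i) * c i * ip M (e i) (e i)" using ce[of i] by (simp add: mult.assoc)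
    also have "\<dots> = complex_of_real ((cmod (c i))\<^sup>2 * (L2_norm M (e i))\<^sup>2)"
      by (simp only: ip_self of_real_mult complex_norm_square mult.commute)
    finally show ?thesis unfolding q_def by (simp only: Re_complex_of_real)
  qed
  have q0: "0 \<le> q i" for i by (simp add: q)
  have ipfP: "Re (ip M g (P B)) = (\<Sum>i\<in>B. q i)"
    if "finite B" "g \<in> L2 M" "\<And>i. i \<in> B \<Longrightarrow> ip M g (e i) = ip M f (e i)" for B g
  proof -
    have "Re (ip M g (P B)) = Re (cnj (ip M (P B) g))" by (simp only: ip_cnj)
    also have "ip M (P B) g = (\<Sum>i\<in>B. c i * ip M (e i) g)"
      unfolding P_def by (subst ip_sum_left) (auto intro: L2_scale e that simp: ip_scale_left)
    also have "cnj \<dots> = (\<Sum>i\<in>B. cnj (c i) * ip M f (e i))"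
      using that(3) by (simp add: ip_cnj)
    finally show ?thesis by (simp add: q_def)
  qed
  have nP: "(L2_norm M (P B))\<^sup>2 = (\<Sum>i\<in>B. q i)" if "finite B" for B
    using ipfP[OF that PL2, of B] Pe[OF that] by (simp add: Re_ip_self)
  have bessel: "(\<Sum>i\<in>B. q i) \<le> (L2_norm M f)\<^sup>2" if "finite B" for B
  proof -
    have "(\<Sum>i\<in>B. q i) \<le> L2_norm M f * L2_norm M (P B)"
      using ipfP[OF that f refl] Re_ip_le[OF f PL2[of B]] by linarith
    then have "L2_norm M (P B) * L2_norm M (P B) \<le> L2_norm M f * L2_norm M (P B)"
      using nP[OF that] by (simp add: power2_eq_square)
    then have "L2_norm M (P B) \<le> L2_norm M f"
      using L2_norm_nonneg[of M "P B"] by (cases "L2_norm M (P B) = 0") (auto simp: mult_le_cancel_right less_le)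
    from power_mono[OF this L2_norm_nonneg, of 2] show ?thesis using nP[OF that] by simp
  qed
  define a where "a n = (\<Sum>i\<in>A n. q i)" for n
  have "incseq a" unfolding a_def
    using A by (intro incseq_SucI sum_mono2) (auto simp: mono_def q0)
  moreover have "\<And>n. a n \<le> (L2_norm M f)\<^sup>2" unfolding a_def using bessel A by auto
  ultimately have "convergent a"
    by (metis incseq_convergent convergentI)
  then have "Cauchy a" by (rule convergent_Cauchy)
  have diff: "(L2_norm M (\<lambda>x. P (A m) x - P (A n) x))\<^sup>2 = a m - a n" if "n \<le> m" for m n
  proof -
    have sub: "A n \<subseteq> A m" using A(1) that by (auto simp: mono_def)
    have "(\<lambda>x. P (A m) x - P (A n) x) = P (A m - A n)"
      unfolding P_def by (rule ext) (rule sum_diff[OF A(2) sub, symmetric])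
    moreover have "(\<Sum>i\<in>A m - A n. q i) = a m - a n" unfolding a_def by (rule sum_diff[OF A(2) sub])
    ultimately show ?thesis using nP[of "A m - A n"] A(2) by simp
  qed
  have "\<exists>g. L2_lim sequentially M (\<lambda>n. P (A n)) g"
  proof (rule L2_complete[OF PL2])
    fix \<epsilon> :: real assume "0 < \<epsilon>"
    then have "\<exists>N. \<forall>m\<ge>N. \<forall>n\<ge>N. norm (a m - a n) < \<epsilon>\<^sup>2" by (intro CauchyD \<open>Cauchy a\<close>) simp
    then obtain N where N: "\<And>m n. m \<ge> N \<Longrightarrow> n \<ge> N \<Longrightarrow> \<bar>a m - a n\<bar> < \<epsilon>\<^sup>2"
      unfolding real_norm_def by blast
    have *: "L2_norm M (\<lambda>x. P (A m) x - P (A n) x) < \<epsilon>" if "N \<le> n" "n \<le> m" for m n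
    proof (rule power2_less_imp_less)
      show "(L2_norm M (\<lambda>x. P (A m) x - P (A n) x))\<^sup>2 < \<epsilon>\<^sup>2"
        unfolding diff[OF that(2)] using N[of m n] that by linarith
    qed (use \<open>0 < \<epsilon>\<close> in simp)
    have "L2_norm M (\<lambda>x. P (A m) x - P (A n) x) < \<epsilon>" if "N \<le> n" "N \<le> m" for m n
    proof (cases "n \<le> m")
      case False
      then show ?thesis using *[of m n] that by (subst L2_norm_diff_commute) simp
    qed (use that * in blast)
    then show "\<exists>N. \<forall>m\<ge>N. \<forall>n\<ge>N. L2_norm M (\<lambda>x. P (A m) x - P (A n) x) < \<epsilon>" by blast
  qed
  then obtain g where g: "L2_lim sequentially M (\<lambda>n. P (A n)) g" by blast
  have "ip M g (e i) = ip M f (e i)" if "i \<in> A n" for i n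
  proof (rule LIMSEQ_unique)
    show "(\<lambda>n. ip M (P (A n)) (e i)) \<longlonglongrightarrow> ip M g (e i)" by (rule L2_lim_ip[OF g L2_lim_const[OF e]])
    show "(\<lambda>n. ip M (P (A n)) (e i)) \<longlonglongrightarrow> ip M f (e i)"
      using that A(1) by (intro tendsto_eventually eventually_sequentiallyI[of n]) (auto simp: Pe A(2) mono_def)
  qed
  with g show ?thesis unfolding P_def by (intro exI[of _ g]) auto
qed

section \<open>Smooth functions\<close>

abbreviation pd :: "plane \<Rightarrow> field2 \<Rightarrow> field2" where
  "pd v f \<equiv> (\<lambda>x. frechet_derivative f (at x) v)"

lemma pd_eqI: "(f has_derivative f') (at x) \<Longrightarrow> frechet_derivative f (at x) v = f' v"
  using frechet_derivative_at by metis

lemma pd_add: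
  assumes "\<forall>x. f differentiable at x" "\<forall>x. g differentiable at x"
  shows "pd v (\<lambda>x. f x + g x) x = pd v f x + pd v g x"
proof -
  have "((\<lambda>x. f x + g x) has_derivative
      (\<lambda>h. frechet_derivative f (at x) h + frechet_derivative g (at x) h)) (at x)"
    using assms by (intro has_derivative_add) (use assms frechet_derivative_works in blast)+
  then show "pd v (\<lambda>x. f x + g x) x = pd v f x + pd v g x" by (rule pd_eqI)
qed

lemma pd_mult:
  assumes "\<forall>x. f differentiable at x" "\<forall>x. g differentiable at x"
  shows "pd v (\<lambda>x. f x * g x) x = f x * pd v g x + pd v f x * g x"
proof -
  have "((\<lambda>x. f x * g x) has_derivative
      (\<lambda>h. f x * frechet_derivative g (at x) h + frechet_derivative f (at x) h * g x)) (at x)"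
    using assms by (intro has_derivative_mult) (use assms frechet_derivative_works in blast)+
  then show "pd v (\<lambda>x. f x * g x) x = f x * pd v g x + pd v f x * g x" by (rule pd_eqI)
qed

lemma pd_cnj:
  assumes "\<forall>x. f differentiable at x"
  shows "pd v (\<lambda>x. cnj (f x)) x = cnj (pd v f x)"
proof -
  have "((\<lambda>x. cnj (f x)) has_derivative (\<lambda>h. cnj (frechet_derivative f (at x) h))) (at x)"
    using assms by (intro has_derivative_cnj) (use assms frechet_derivative_works in blast)+
  then show "pd v (\<lambda>x. cnj (f x)) x = cnj (pd v f x)" by (rule pd_eqI)
qed

lemma Ck_Suc_imp_Ck: "Ck (Suc k) f \<Longrightarrow> Ck k f"
proof (induction k arbitrary: f)
  case 0
  then have "continuous (at x) f" for x using Ck.simps(2)[of 0 f] differentiable_imp_continuous_within[of f x UNIV] by blast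
  then show ?case unfolding Ck.simps continuous_on_eq_continuous_at[OF open_UNIV] by blast
next
  case (Suc k)
  from Suc.prems[unfolded Ck.simps(2)[of "Suc k" f]] Suc.IH show ?case
    unfolding Ck.simps(2)[of k f] by blast
qed

lemma Ck_const: "Ck k (\<lambda>x. c)"
  by (induction k arbitrary: c) auto

lemma Ck_add: "Ck k f \<Longrightarrow> Ck k g \<Longrightarrow> Ck k (\<lambda>x. f x + g x)"
proof (induction k arbitrary: f g)
  case 0 then show ?case by (auto intro: continuous_intros)
next
  case (Suc k) then show ?case by (simp add: pd_add)
qed

lemma Ck_mult: "Ck k f \<Longrightarrow> Ck k g \<Longrightarrow> Ck k (\<lambda>x. f x * g x)"
proof (induction k arbitrary: f g)
  case 0 then show ?case by (auto intro: continuous_intros)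
next
  case (Suc k)
  then have "Ck k f" "Ck k g" by (auto intro: Ck_Suc_imp_Ck)
  with Suc show ?case by (simp add: pd_mult Ck_add)
qed

lemma Ck_cnj: "Ck k f \<Longrightarrow> Ck k (\<lambda>x. cnj (f x))"
proof (induction k arbitrary: f)
  case 0 then show ?case by (auto intro: continuous_intros)
next
  case (Suc k)
  from Suc.prems have d: "\<forall>x. f differentiable at x" unfolding Ck.simps(2) by blast
  have "(\<lambda>x. cnj (f x)) differentiable at x" for x
    by (rule differentiableI[OF has_derivative_cnj[OF frechet_derivative_works[THEN iffD1, OF spec[OF d]]]])
  with Suc show ?case by (simp add: pd_cnj)
qed

lemma smooth_const: "smooth (\<lambda>x. c)"
  and smooth_add: "smooth f \<Longrightarrow> smooth g \<Longrightarrow> smooth (\<lambda>x. f x + g x)"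
  and smooth_mult: "smooth f \<Longrightarrow> smooth g \<Longrightarrow> smooth (\<lambda>x. f x * g x)"
  and smooth_cnj: "smooth f \<Longrightarrow> smooth (\<lambda>x. cnj (f x))"
  by (simp_all add: smooth_def Ck_const Ck_add Ck_mult Ck_cnj)

lemma smooth_diff: "smooth f \<Longrightarrow> smooth g \<Longrightarrow> smooth (\<lambda>x. f x - g x)"
  using smooth_add[of f "\<lambda>x. -1 * g x"] smooth_mult[OF smooth_const, of g "-1"] by simp

lemma smooth_sum: "(\<And>i. i \<in> A \<Longrightarrow> smooth (f i)) \<Longrightarrow> smooth (\<lambda>x. \<Sum>i\<in>A. f i x)"
  by (induction A rule: infinite_finite_induct) (auto intro: smooth_add smooth_const)

lemma smooth_continuous: "smooth f \<Longrightarrow> continuous_on A f"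
  using continuous_on_subset[of UNIV f A] Ck.simps(1)[of f] unfolding smooth_def by blast

lemma smooth_differentiable: "smooth f \<Longrightarrow> f differentiable at x"
  using Ck.simps(2)[of 0 f] unfolding smooth_def by blast

lemma smooth_has_derivative: "smooth f \<Longrightarrow> (f has_derivative frechet_derivative f (at x)) (at x)"
  using smooth_differentiable frechet_derivative_works by blast

text \<open>
  The directions in which \<open>Ck\<close> prescribes the differentiability of derivatives.
\<close>

definition is_axis :: "plane \<Rightarrow> bool" where
  "is_axis v \<longleftrightarrow> v = (1, 0) \<or> v = (0, 1)"

lemma axis_simps [simp]: "is_axis (1, 0)" "is_axis (0, 1)"
  by (simp_all add: is_axis_def)

lemma smooth_pd: "smooth f \<Longrightarrow> is_axis v \<Longrightarrow> smooth (pd v f)"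
  unfolding smooth_def is_axis_def by (metis Ck.simps(2))

lemma smooth_pd_add: "smooth f \<Longrightarrow> smooth g \<Longrightarrow> pd v (\<lambda>x. f x + g x) x = pd v f x + pd v g x"
  by (simp add: pd_add smooth_differentiable)

lemma smooth_pd_mult: "smooth f \<Longrightarrow> smooth g \<Longrightarrow>
    pd v (\<lambda>x. f x * g x) x = f x * pd v g x + pd v f x * g x"
  by (simp add: pd_mult smooth_differentiable)

lemma smooth_pd_cnj: "smooth f \<Longrightarrow> pd v (\<lambda>x. cnj (f x)) x = cnj (pd v f x)"
  by (simp add: pd_cnj smooth_differentiable)

lemma smooth_pd_scale: "smooth f \<Longrightarrow> pd v (\<lambda>x. c * f x) x = c * pd v f x"
  by (simp add: smooth_pd_mult smooth_const)

lemma smooth_pd_diff: "smooth f \<Longrightarrow> smooth g \<Longrightarrow> pd v (\<lambda>x. f x - g x) x = pd v f x - pd v g x"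
  using smooth_pd_add[of f "\<lambda>x. -1 * g x" x v] smooth_pd_scale[of g "-1" x v]
    smooth_mult[OF smooth_const, of g "-1"] by simp

lemma smooth_pd_sum: "(\<And>i. i \<in> A \<Longrightarrow> smooth (f i)) \<Longrightarrow>
    pd v (\<lambda>x. \<Sum>i\<in>A. f i x) x = (\<Sum>i\<in>A. pd v (f i) x)"
  by (induction A rule: infinite_finite_induct) (simp_all add: smooth_pd_add smooth_sum)

lemma coordinate_function_has_derivative:
  assumes "\<And>n x. (P n has_vector_derivative P (Suc n) x) (at x)" "bounded_linear p"
  shows "((\<lambda>z::plane. P n (p z)) has_derivative (\<lambda>h. p h *\<^sub>R P (Suc n) (p z))) (at z)"
  using has_derivative_compose[OF bounded_linear_imp_has_derivative[OF assms(2)], of "P n" "\<lambda>t. t *\<^sub>R P (Suc n) (p z)" z UNIV]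
    assms(1)[of n "p z"] unfolding has_vector_derivative_def by simp

text \<open>
  A function of one coordinate is recognised as smooth by exhibiting the whole sequence of its
  derivatives, so that the induction on the order of differentiability has a stable hypothesis.
\<close>

lemma coordinate_function_smooth:
  assumes P: "\<And>n x. (P n has_vector_derivative P (Suc n) x) (at x)" and p: "bounded_linear p"
  shows "smooth (\<lambda>z. P n (p z))" "pd v (\<lambda>z. P n (p z)) z = p v *\<^sub>R P (Suc n) (p z)"
proof -
  note d = coordinate_function_has_derivative[where P=P, OF P p]
  show pd: "pd v (\<lambda>z. P n (p z)) z = p v *\<^sub>R P (Suc n) (p z)" for n v z by (rule pd_eqI[OF d])
  have diff: "\<forall>z. (\<lambda>z::plane. P n (p z)) differentiable at z" for n by (intro allI differentiableI[OF d])
  have "Ck k (\<lambda>z. c * P n (p z))" for k c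
  proof (induction k arbitrary: c n)
    case 0
    have "continuous_on UNIV (\<lambda>z::plane. P n (p z))"
      by (rule has_derivative_continuous_on) (rule has_derivative_at_withinI[OF d])
    then show ?case by (auto intro: continuous_intros)
  next
    case (Suc k)
    have "pd v (\<lambda>z. c * P n (p z)) = (\<lambda>z. (c * of_real (p v)) * P (Suc n) (p z))" for v
      by (rule ext, subst pd_mult) (simp_all add: diff pd scaleR_conv_of_real)
    moreover have "(\<lambda>z::plane. c * P n (p z)) differentiable at z" for z
      by (intro derivative_intros spec[OF diff])
    ultimately show ?case using Suc.IH by simp
  qed
  from this[of _ 1] show "smooth (\<lambda>z. P n (p z))" by (simp add: smooth_def)
qed

lemma derivatives_affine:
  assumes "\<And>n x. (P n has_vector_derivative P (Suc n) x) (at x)"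
  shows "((\<lambda>x. complex_of_real (r ^ n) * P n (r * x + s)) has_vector_derivative
     complex_of_real (r ^ Suc n) * P (Suc n) (r * x + s)) (at x)"
proof -
  have "((P n \<circ> (\<lambda>x. r * x + s)) has_vector_derivative r *\<^sub>R P (Suc n) (r * x + s)) (at x)"
    by (rule vector_diff_chain_at[OF _ assms]) (auto intro!: derivative_eq_intros simp: has_vector_derivative_def)
  then have "((\<lambda>x. complex_of_real (r ^ n) * (P n \<circ> (\<lambda>x. r * x + s)) x) has_vector_derivative
     complex_of_real (r ^ n) * r *\<^sub>R P (Suc n) (r * x + s)) (at x)"
    by (rule has_vector_derivative_mult_right)
  then show ?thesis by (simp add: scaleR_conv_of_real algebra_simps)
qed

subsection \<open>Cutoff functions\<close>

text \<open>
  The standard function that is smooth but not analytic at 0. The cutoffs below are built from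
  it.
\<close>

definition flat :: "real \<Rightarrow> real" where
  "flat t = (if t \<le> 0 then 0 else exp (- 1 / t))"

text \<open>
  For positive \<open>t\<close> the \<open>n\<close>-th derivative of \<open>exp (- 1 / t)\<close> is \<open>p\<^sub>n (1 / t) exp (- 1 / t)\<close>. As \<open>1 / t\<close> has the
  derivative \<open>- (1 / t)\<^sup>2\<close>, these polynomials satisfy the recursion below.
\<close>

primrec flat_poly :: "nat \<Rightarrow> real poly" where
  "flat_poly 0 = 1"
| "flat_poly (Suc n) = [:0, 0, 1:] * (flat_poly n - pderiv (flat_poly n))"

definition flat_deriv :: "nat \<Rightarrow> real \<Rightarrow> real" where
  "flat_deriv n t = (if t \<le> 0 then 0 else poly (flat_poly n) (1 / t) * exp (- 1 / t))"

lemma poly_times_exp_minus_tendsto: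
  "((\<lambda>s. poly p s * exp (- s)) \<longlongrightarrow> (0::real)) at_top"
proof -
  have "((\<lambda>s. \<Sum>i\<le>degree p. coeff p i * (s ^ i / exp s)) \<longlongrightarrow> (\<Sum>i\<le>degree p. coeff p i * 0)) at_top"
    by (intro tendsto_sum tendsto_mult tendsto_const tendsto_power_div_exp_0)
  then show ?thesis by (simp add: poly_altdef exp_minus field_simps sum_distrib_left sum_divide_distrib)
qed

lemma poly_inverse_times_flat_tendsto:
  "((\<lambda>t. poly p (1 / t) * exp (- 1 / t)) \<longlongrightarrow> (0::real)) (at_right 0)"
proof -
  have "filterlim (\<lambda>t::real. 1 / t) at_top (at_right 0)"
    using filterlim_inverse_at_top_right by (simp add: inverse_eq_divide)
  from filterlim_compose[OF poly_times_exp_minus_tendsto this] show ?thesis by simp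
qed

text \<open>
  Only the origin needs an argument: there the difference quotient is again a polynomial in \<open>1 / t\<close>
  times \<open>exp (- 1 / t)\<close>, which tends to 0.
\<close>

lemma flat_deriv_has_derivative:
  "(flat_deriv n has_field_derivative flat_deriv (Suc n) t) (at t)"
proof -
  define p where "p = flat_poly n"
  have f: "flat_deriv n t = (if t \<le> 0 then 0 else poly p (1 / t) * exp (- 1 / t))" for t
    by (simp add: flat_deriv_def p_def)
  have f': "flat_deriv (Suc n) t = (if t \<le> 0 then 0 else
      (1/t)\<^sup>2 * (poly p (1/t) - poly (pderiv p) (1/t)) * exp (- 1 / t))" for t
    by (simp add: flat_deriv_def p_def[symmetric] power2_eq_square algebra_simps)
  consider "t < 0" | "t = 0" | "0 < t" by linarith
  then show ?thesis
  proof cases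
    case 1
    have "((\<lambda>t. 0) has_field_derivative flat_deriv (Suc n) t) (at t)" using 1 by (simp add: f')
    then show ?thesis
      by (rule has_field_derivative_transform_within_open[where S="{..<0}"]) (use 1 in \<open>auto simp: f\<close>)
  next
    case 3
    have "((\<lambda>t. poly p (1 / t) * exp (- 1 / t)) has_field_derivative flat_deriv (Suc n) t) (at t)"
      using 3 by (auto intro!: derivative_eq_intros poly_DERIV[THEN DERIV_chain2] simp: f' field_simps power2_eq_square)
    then show ?thesis
      by (rule has_field_derivative_transform_within_open[where S="{0<..}"]) (use 3 in \<open>auto simp: f\<close>)
  next
    case 2
    have "((\<lambda>h. flat_deriv n h / h) \<longlongrightarrow> 0) (at_right 0)"
    proof (rule Lim_transform_eventually[OF poly_inverse_times_flat_tendsto[of "[:0, 1:] * p"]])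
      show "\<forall>\<^sub>F x in at_right 0. poly ([:0, 1:] * p) (1 / x) * exp (- 1 / x) = flat_deriv n x / x"
        by (auto simp: eventually_at_filter f)
    qed
    moreover have "((\<lambda>h. flat_deriv n h / h) \<longlongrightarrow> 0) (at_left 0)"
      by (rule tendsto_eventually) (auto simp: eventually_at_filter f)
    ultimately have "((\<lambda>h. flat_deriv n h / h) \<longlongrightarrow> 0) (at 0)"
      using filterlim_split_at by blast
    then show ?thesis using 2 by (simp add: DERIV_def f f')
  qed
qed

lemma flat_deriv_0: "flat_deriv 0 = flat"
  by (auto simp: flat_def flat_deriv_def)

lemma flat_bounds: "0 \<le> flat t" "flat t \<le> 1"
  by (auto simp: flat_def)

lemma flat_tendsto: "(flat \<longlongrightarrow> 1) at_top"
proof -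
  have "((\<lambda>t::real. exp (- (1 / t))) \<longlongrightarrow> exp (- 0)) at_top"
    by (intro tendsto_intros tendsto_divide_0[OF tendsto_const] filterlim_at_top_imp_at_infinity filterlim_ident)
  then have "((\<lambda>t::real. exp (- 1 / t)) \<longlongrightarrow> 1) at_top" by simp
  then show ?thesis
    by (rule Lim_transform_eventually) (use eventually_gt_at_top[of 0] in eventually_elim, simp add: flat_def)
qed

text \<open>
  With \<open>t = n x - 1\<close> this bounds \<open>n x flat' (n x - 1)\<close>, the derivative of the cutoff at distance \<open>1 / n\<close>
  from the boundary multiplied by the distance \<open>x\<close> to the boundary: it is bounded uniformly in \<open>n\<close> and
  tends to 0 for every fixed \<open>x\<close>. The constant 2 comes from \<open>exp s \<ge> 1 + s + s\<^sup>2 / 2\<close> at \<open>s = 1 / t\<close>.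
\<close>

lemma flat_derivative_bound:
  "\<bar>(t + 1) * flat_deriv 1 t\<bar> \<le> 2"
  "0 < t \<Longrightarrow> \<bar>(t + 1) * flat_deriv 1 t\<bar> \<le> (t + 1) / t\<^sup>2"
proof -
  have f: "flat_deriv (Suc 0) t = (if t \<le> 0 then 0 else exp (- 1 / t) / t\<^sup>2)"
    by (simp add: flat_deriv_def power2_eq_square)
  show "\<bar>(t + 1) * flat_deriv 1 t\<bar> \<le> (t + 1) / t\<^sup>2" if "0 < t"
    using that by (auto simp: f abs_mult intro!: divide_right_mono mult_left_le)
  show "\<bar>(t + 1) * flat_deriv 1 t\<bar> \<le> 2"
  proof (cases "t \<le> 0")
    case False
    then have t: "0 < t" by simp
    have "(t + 1) \<le> 2 * t\<^sup>2 * exp (1/t)"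
    proof -
      have "1 + 1/t + (1/t)\<^sup>2 / 2 \<le> exp (1/t)" using t exp_lower_Taylor_quadratic[of "1/t"] by simp
      then have "2 * t\<^sup>2 * (1 + 1/t + (1/t)\<^sup>2 / 2) \<le> 2 * t\<^sup>2 * exp (1/t)"
        by (intro mult_left_mono) auto
      moreover have "2 * t\<^sup>2 * (1 + 1/t + (1/t)\<^sup>2 / 2) = 2 * t\<^sup>2 + 2 * t + 1"
        using t by (simp add: field_simps power2_eq_square)
      ultimately show ?thesis using t zero_le_power2[of t] by linarith
    qed
    then show ?thesis using t by (simp add: f exp_minus field_simps abs_mult)
  qed (simp add: f)
qed

text \<open>
  A smooth function with values in \<open>[0, 1]\<close> that vanishes outside of \<open>(c + 1/n, d - 1/n)\<close> and tends to
  1 on \<open>(c, d)\<close> as \<open>n\<close> grows.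
\<close>

definition cutoff :: "real \<Rightarrow> real \<Rightarrow> real \<Rightarrow> real \<Rightarrow> real" where
  "cutoff c d n x = flat (n * (x - c) - 1) * flat (n * (d - x) - 1)"

definition cutoff_deriv :: "real \<Rightarrow> real \<Rightarrow> real \<Rightarrow> real \<Rightarrow> real" where
  "cutoff_deriv c d n x = n * flat_deriv 1 (n * (x - c) - 1) * flat (n * (d - x) - 1)
     - flat (n * (x - c) - 1) * (n * flat_deriv 1 (n * (d - x) - 1))"

lemma flat_affine_smooth:
  assumes "bounded_linear p"
  shows "smooth (\<lambda>z. complex_of_real (flat (r * p z + s)))"
    "pd v (\<lambda>z. complex_of_real (flat (r * p z + s))) z = of_real (p v * (r * flat_deriv 1 (r * p z + s)))"
proof -
  define P where "P n x = complex_of_real (r ^ n) * complex_of_real (flat_deriv n (r * x + s))" for n x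
  have P: "(P n has_vector_derivative P (Suc n) x) (at x)" for n x
    unfolding P_def
  proof (rule derivatives_affine)
    fix n x
    show "((\<lambda>x. complex_of_real (flat_deriv n x)) has_vector_derivative complex_of_real (flat_deriv (Suc n) x)) (at x)"
      using flat_deriv_has_derivative[of n x] by (intro has_vector_derivative_of_real)
        (simp add: has_real_derivative_iff_has_vector_derivative)
  qed
  have P0: "P 0 x = complex_of_real (flat (r * x + s))" for x by (simp add: P_def flat_deriv_0)
  note c = coordinate_function_smooth[where P=P, OF P assms, of 0]
  show "smooth (\<lambda>z. complex_of_real (flat (r * p z + s)))" using c(1) by (simp add: P0)
  show "pd v (\<lambda>z. complex_of_real (flat (r * p z + s))) z = of_real (p v * (r * flat_deriv 1 (r * p z + s)))"
    using c(2)[of z v] by (simp add: P0) (simp add: P_def scaleR_conv_of_real)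
qed

lemma
  assumes "bounded_linear p"
  shows smooth_cutoff: "smooth (\<lambda>z. complex_of_real (cutoff c d n (p z)))"
    and pd_cutoff: "pd v (\<lambda>z. complex_of_real (cutoff c d n (p z))) z = of_real (p v * cutoff_deriv c d n (p z))"
proof -
  note f = flat_affine_smooth[OF assms]
  have e: "cutoff c d n x = flat (n * x + (- n * c - 1)) * flat (- n * x + (n * d - 1))"
    "cutoff_deriv c d n x = n * flat_deriv 1 (n * x + (- n * c - 1)) * flat (- n * x + (n * d - 1))
     + flat (n * x + (- n * c - 1)) * (- n * flat_deriv 1 (- n * x + (n * d - 1)))" for x
    by (simp_all add: cutoff_def cutoff_deriv_def algebra_simps)
  show "smooth (\<lambda>z. complex_of_real (cutoff c d n (p z)))"
    unfolding e of_real_mult by (intro smooth_mult f)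
  show "pd v (\<lambda>z. complex_of_real (cutoff c d n (p z))) z = of_real (p v * cutoff_deriv c d n (p z))"
    unfolding e of_real_mult
    by (subst smooth_pd_mult[OF f(1) f(1)]) (simp only: f(2), simp add: algebra_simps)
qed

lemmas cutoff_smooth = smooth_cutoff[OF bounded_linear_fst] smooth_cutoff[OF bounded_linear_snd]
  pd_cutoff[OF bounded_linear_fst] pd_cutoff[OF bounded_linear_snd]

lemma cutoff_bounds: "0 \<le> cutoff c d n x" "cutoff c d n x \<le> 1"
  by (auto simp: cutoff_def flat_bounds intro: mult_le_one)

lemma cutoff_nonzero: "0 < n \<Longrightarrow> cutoff c d n x \<noteq> 0 \<Longrightarrow> c + 1 / n < x \<and> x < d - 1 / n"
  by (auto simp: cutoff_def flat_def field_simps split: if_splits)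

lemma cutoff_tendsto:
  assumes "c < x" "x < d"
  shows "(\<lambda>n. cutoff c d (real n) x) \<longlonglongrightarrow> 1"
proof -
  have "filterlim (\<lambda>n. real n * y - 1) at_top sequentially" if "0 < y" for y
    using filterlim_tendsto_add_at_top[OF tendsto_const[of "-1"]
        filterlim_at_top_mult_tendsto_pos[OF tendsto_const that filterlim_real_sequentially]] by simp
  then have "(\<lambda>n. flat (real n * y - 1)) \<longlonglongrightarrow> 1" if "0 < y" for y
    using filterlim_compose[OF flat_tendsto] that by blast
  from tendsto_mult[OF this[of "x - c"] this[of "d - x"]] show ?thesis
    using assms by (simp add: cutoff_def)
qed

lemma cutoff_test_fun:
  assumes "smooth f" "0 < n" "{c<..<d} \<times> {c'<..<d'} \<subseteq> \<Omega>"
  shows "(\<lambda>z. f z * (complex_of_real (cutoff c d n (fst z)) * complex_of_real (cutoff c' d' n (snd z)))) \<in> test_fun \<Omega>"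
proof -
  let ?g = "\<lambda>z. f z * (complex_of_real (cutoff c d n (fst z)) * complex_of_real (cutoff c' d' n (snd z)))"
  let ?K = "{c + 1/n..d - 1/n} \<times> {c' + 1/n..d' - 1/n}"
  have "compact ?K" by (intro compact_Times) auto
  moreover have "{z. ?g z \<noteq> 0} \<subseteq> ?K"
    using cutoff_nonzero[OF assms(2)] by (auto simp: less_imp_le)
  ultimately have cl: "closure {z. ?g z \<noteq> 0} \<subseteq> ?K"
    by (intro closure_minimal) (auto intro: compact_imp_closed)
  have sub: "{a + e..b - e} \<subseteq> {a<..<b}" if "0 < e" for a b e :: real
    unfolding subset_iff atLeastAtMost_iff greaterThanLessThan_iff using that by linarith
  have "?K \<subseteq> {c<..<d} \<times> {c'<..<d'}"
    using assms(2) by (intro Sigma_mono sub) simp_all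
  moreover have "compact (closure {z. ?g z \<noteq> 0})"
  proof -
    have "compact (?K \<inter> closure {z. ?g z \<noteq> 0})" by (rule compact_Int_closed[OF \<open>compact ?K\<close> closed_closure])
    then show ?thesis using Int_absorb1[OF cl] by simp
  qed
  moreover have "smooth ?g" by (intro smooth_mult assms cutoff_smooth)
  ultimately show ?thesis unfolding test_fun_def using cl assms(3) by blast
qed

section \<open>Integration by parts on the rectangle\<close>

abbreviation box_measure :: "real \<Rightarrow> real \<Rightarrow> plane measure" where
  "box_measure a b \<equiv> lebesgue_on (rect a b)"

lemma rect_eq_box: "rect a b = box (0, 0) (a * pi, b * pi)"
  by (auto simp: rect_def box_def Basis_prod_def)

lemma rect_sets: "rect a b \<in> sets lebesgue" "rect a b \<in> lmeasurable"
  by (simp_all add: rect_eq_box)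

lemma finite_measure_box: "finite_measure (box_measure a b)"
  by (rule finite_measure_lebesgue_on[OF rect_sets(2)])

lemma continuous_measurable_box:
  "continuous_on UNIV f \<Longrightarrow> f \<in> borel_measurable (box_measure a b)"
  by (rule continuous_imp_measurable_on_sets_lebesgue[OF continuous_on_subset rect_sets(1)]) auto

lemma continuous_bounded_box:
  fixes f :: "plane \<Rightarrow> 'a::real_normed_vector"
  assumes "continuous_on UNIV f"
  obtains B where "0 \<le> B" "\<And>x. x \<in> cbox (0, 0) (a * pi, b * pi) \<Longrightarrow> norm (f x) \<le> B"
    "\<And>x. x \<in> rect a b \<Longrightarrow> norm (f x) \<le> B"
proof -
  have "compact (f ` cbox (0, 0) (a * pi, b * pi))"
    by (intro compact_continuous_image continuous_on_subset[OF assms]) auto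
  then have "bounded (f ` cbox (0, 0) (a * pi, b * pi))" by (rule compact_imp_bounded)
  then obtain B where B: "0 < B" "\<And>y. y \<in> f ` cbox (0, 0) (a * pi, b * pi) \<Longrightarrow> norm y \<le> B"
    unfolding bounded_pos by blast
  then show thesis using that[of B] box_subset_cbox[of "(0, 0)" "(a * pi, b * pi)"] unfolding rect_eq_box by auto
qed

lemma L2_box_bounded:
  assumes "f \<in> borel_measurable (box_measure a b)" "\<And>x. x \<in> rect a b \<Longrightarrow> cmod (f x) \<le> B"
  shows "f \<in> L2 (box_measure a b)"
proof -
  have "integrable (box_measure a b) (\<lambda>x. (cmod (f x))\<^sup>2)"
    using assms power_mono[OF assms(2) norm_ge_zero, of _ 2]
    by (intro finite_measure.integrable_const_bound[OF finite_measure_box, where B="B\<^sup>2"] AE_I2) auto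
  with assms show ?thesis by (simp add: L2_def)
qed

lemma L2_box_continuous: "continuous_on UNIV f \<Longrightarrow> f \<in> L2 (box_measure a b)"
proof -
  assume f: "continuous_on UNIV f"
  obtain B where "\<And>x. x \<in> rect a b \<Longrightarrow> cmod (f x) \<le> B" by (rule continuous_bounded_box[OF f]) auto
  then show ?thesis by (rule L2_box_bounded[OF continuous_measurable_box[OF f]])
qed

lemma L2_box_smooth: "smooth f \<Longrightarrow> f \<in> L2 (box_measure a b)"
  by (intro L2_box_continuous smooth_continuous)

lemma L2_mult_continuous:
  assumes "f \<in> L2 (box_measure a b)" "continuous_on UNIV h"
  shows "(\<lambda>x. h x * f x) \<in> L2 (box_measure a b)"
proof -
  obtain B where "\<And>x. x \<in> rect a b \<Longrightarrow> cmod (h x) \<le> B" by (rule continuous_bounded_box[OF assms(2)]) auto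
  then show ?thesis by (intro L2_mult_bounded[OF assms(1)] continuous_measurable_box assms(2)) auto
qed

lemma L2_lim_mult_continuous:
  assumes "L2_lim F (box_measure a b) u f" "continuous_on UNIV h"
  shows "L2_lim F (box_measure a b) (\<lambda>i x. h x * u i x) (\<lambda>x. h x * f x)"
proof -
  obtain B where "\<And>x. x \<in> rect a b \<Longrightarrow> cmod (h x) \<le> B" by (rule continuous_bounded_box[OF assms(2)]) auto
  then show ?thesis by (intro L2_lim_mult_bounded[OF assms(1)] continuous_measurable_box assms(2)) auto
qed

lemma box_integral_continuous:
  fixes f :: field2
  assumes "continuous_on UNIV f"
  shows "integral\<^sup>L (box_measure a b) f = integral (cbox (0, 0) (a * pi, b * pi)) f"
proof -
  obtain B where B: "\<And>x. x \<in> rect a b \<Longrightarrow> norm (f x) \<le> B" by (rule continuous_bounded_box[OF assms]) auto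
  have "integrable (box_measure a b) f"
    using B by (intro finite_measure.integrable_const_bound[OF finite_measure_box, where B=B] AE_I2
        continuous_measurable_box assms) auto
  from lebesgue_integral_eq_integral[OF this rect_sets(1)] show ?thesis
    unfolding rect_eq_box integral_open_interval .
qed

lemma smooth_line_derivative:
  assumes "smooth F"
  shows "((\<lambda>t. F (z + t *\<^sub>R v)) has_vector_derivative pd v F (z + t *\<^sub>R v)) (at t within A)"
proof -
  let ?D = "frechet_derivative F (at (z + t *\<^sub>R v))"
  have "((\<lambda>t. F (z + t *\<^sub>R v)) has_derivative (\<lambda>h. ?D (h *\<^sub>R v))) (at t within A)"
    by (rule has_derivative_compose[of "\<lambda>t. z + t *\<^sub>R v" "\<lambda>h. h *\<^sub>R v", OF _ smooth_has_derivative[OF assms]])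
       (auto intro!: derivative_eq_intros)
  then show ?thesis
    unfolding has_vector_derivative_def linear_scale[OF linear_frechet_derivative[OF smooth_differentiable[OF assms]]] .
qed

lemma box_integral_pd_snd:
  assumes "smooth F" "0 < b"
  shows "integral\<^sup>L (box_measure a b) (pd (0, 1) F) = integral {0..a * pi} (\<lambda>x. F (x, b * pi) - F (x, 0))"
proof -
  have c: "continuous_on A (pd (0, 1) F)" for A by (intro smooth_continuous smooth_pd assms) simp
  have "integral\<^sup>L (box_measure a b) (pd (0, 1) F) =
      integral {0..a * pi} (\<lambda>x. integral {0..b * pi} (\<lambda>y. pd (0, 1) F (x, y)))"
    using integral_prod_continuous[OF c, of 0 0 "a * pi" "b * pi"] box_integral_continuous[OF c, of a b]
    by (simp add: cbox_interval)
  also have "\<dots> = integral {0..a * pi} (\<lambda>x. F (x, b * pi) - F (x, 0))"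
  proof (rule integral_cong, rule integral_unique, rule fundamental_theorem_of_calculus)
    show "((\<lambda>y. F (x, y)) has_vector_derivative pd (0, 1) F (x, y)) (at y within {0..b * pi})" for x y
      using smooth_line_derivative[OF assms(1), of "(x, 0)" "(0, 1)"] by simp
  qed (use assms in simp)
  finally show ?thesis .
qed

lemma box_integral_pd_fst:
  assumes "smooth F" "0 < a"
  shows "integral\<^sup>L (box_measure a b) (pd (1, 0) F) = integral {0..b * pi} (\<lambda>y. F (a * pi, y) - F (0, y))"
proof -
  have c: "continuous_on A (pd (1, 0) F)" for A by (intro smooth_continuous smooth_pd assms) simp
  have "integral\<^sup>L (box_measure a b) (pd (1, 0) F) =
      integral {0..b * pi} (\<lambda>y. integral {0..a * pi} (\<lambda>x. pd (1, 0) F (x, y)))"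
    using integral_prod_continuous[OF c, of 0 0 "a * pi" "b * pi"] box_integral_continuous[OF c, of a b]
      integral_swap_continuous[of 0 0 "a * pi" "b * pi" "\<lambda>x y. pd (1, 0) F (x, y)"] c
    by (simp add: cbox_interval case_prod_unfold)
  also have "\<dots> = integral {0..b * pi} (\<lambda>y. F (a * pi, y) - F (0, y))"
  proof (rule integral_cong, rule integral_unique, rule fundamental_theorem_of_calculus)
    show "((\<lambda>x. F (x, y)) has_vector_derivative pd (1, 0) F (x, y)) (at x within {0..a * pi})" for x y
      using smooth_line_derivative[OF assms(1), of "(0, y)" "(1, 0)"] by simp
  qed (use assms in simp)
  finally show ?thesis .
qed

lemma box_integral_pd_eq_0:
  assumes "smooth F" "0 < a" "0 < b" "is_axis v"
    and "v = (1, 0) \<Longrightarrow> (\<forall>y. F (0, y) = 0 \<and> F (a * pi, y) = 0)"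
    and "v = (0, 1) \<Longrightarrow> (\<forall>x. F (x, 0) = 0 \<and> F (x, b * pi) = 0)"
  shows "integral\<^sup>L (box_measure a b) (pd v F) = 0"
  using assms by (auto simp: is_axis_def box_integral_pd_fst box_integral_pd_snd)

text \<open>
  The normal and the tangential coordinate direction of a side. The sign of the outward normal is
  irrelevant in quadratic expressions and is kept in the multiplier \<open>opp_dist\<close> only.
\<close>

primrec side_axis :: "side \<Rightarrow> plane" where
  "side_axis Bottom = (0, 1)"
| "side_axis Top = (0, 1)"
| "side_axis Left = (1, 0)"
| "side_axis Right = (1, 0)"

primrec side_tangent :: "side \<Rightarrow> plane" where
  "side_tangent Bottom = (1, 0)"
| "side_tangent Top = (1, 0)"
| "side_tangent Left = (0, 1)"
| "side_tangent Right = (0, 1)"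

primrec side_depth :: "real \<Rightarrow> real \<Rightarrow> side \<Rightarrow> real" where
  "side_depth a b Bottom = b * pi"
| "side_depth a b Top = b * pi"
| "side_depth a b Left = a * pi"
| "side_depth a b Right = a * pi"

text \<open>
  The multiplier is the signed distance to the opposite side, with the sign of the outward normal
  in the coordinate direction.
\<close>

primrec opp_dist :: "real \<Rightarrow> real \<Rightarrow> side \<Rightarrow> plane \<Rightarrow> complex" where
  "opp_dist a b Bottom = (\<lambda>z. complex_of_real (snd z - b * pi))"
| "opp_dist a b Top = (\<lambda>z. complex_of_real (snd z))"
| "opp_dist a b Left = (\<lambda>z. complex_of_real (fst z - a * pi))"
| "opp_dist a b Right = (\<lambda>z. complex_of_real (fst z))"

lemma axis_side [simp]: "is_axis (side_axis S)" "is_axis (side_tangent S)"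
  by (cases S; simp)+

lemma side_depth_pos: "0 < a \<Longrightarrow> 0 < b \<Longrightarrow> 0 < side_depth a b S"
  by (cases S) simp_all

lemma smooth_shifted_coordinate:
  assumes "bounded_linear p"
  shows "smooth (\<lambda>z. complex_of_real (p z + s))" "pd v (\<lambda>z. complex_of_real (p z + s)) z = of_real (p v)"
proof -
  define P where "P = (\<lambda>(n::nat) x. if n = 0 then complex_of_real (x + s) else if n = 1 then 1 else 0)"
  have P: "(P n has_vector_derivative P (Suc n) x) (at x)" for n x
    unfolding P_def by (auto intro!: derivative_eq_intros has_vector_derivative_of_real)
  have P0: "P 0 x = complex_of_real (x + s)" and P1: "P (Suc 0) x = 1" for x by (simp_all add: P_def)
  note c = coordinate_function_smooth[where P=P, OF P assms, of 0, unfolded P0 P1]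
  show "smooth (\<lambda>z. complex_of_real (p z + s))" by (rule c(1))
  show "pd v (\<lambda>z. complex_of_real (p z + s)) z = of_real (p v)"
    using c(2)[of z v] by (simp add: scaleR_conv_of_real)
qed

lemma opp_dist_smooth: "smooth (opp_dist a b S)"
  and opp_dist_pd_axis: "pd (side_axis S) (opp_dist a b S) z = 1"
  and opp_dist_pd_tangent: "pd (side_tangent S) (opp_dist a b S) z = 0"
  using smooth_shifted_coordinate[OF bounded_linear_fst, of 0] smooth_shifted_coordinate[OF bounded_linear_fst, of "- a * pi"]
    smooth_shifted_coordinate[OF bounded_linear_snd, of 0] smooth_shifted_coordinate[OF bounded_linear_snd, of "- b * pi"]
  by (cases S; simp)+

lemma opp_dist_le: "z \<in> rect a b \<Longrightarrow> cmod (opp_dist a b S z) \<le> side_depth a b S"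
  by (cases S) (auto simp: rect_def simp del: of_real_diff)

lemma opp_dist_real: "cnj (opp_dist a b S z) = opp_dist a b S z"
  by (cases S) auto

lemma inj_side_param: "inj (side_param a b S)"
  by (cases S) (auto simp: inj_def)

lemma continuous_side_param: "continuous_on A (side_param a b S)"
  by (cases S) (auto intro!: continuous_intros)

text \<open>
  The arc length measure is an image measure, so that integrals are pulled back to an interval.
\<close>

lemma side_integral:
  fixes g :: field2
  shows "g \<circ> side_param a b S \<in> borel_measurable (lebesgue_on {0<..<side_length a b S}) \<Longrightarrow>
    integral\<^sup>L (side_measure a b S) g =
      integral\<^sup>L (lebesgue_on {0<..<side_length a b S}) (\<lambda>s. g (side_param a b S s))"
  unfolding side_measure_def
  by (subst embed_measure_eq_distr[OF inj_side_param], subst integral_distr)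
     (auto intro!: measurable_embed_measure2[OF inj_side_param] measurable_embed_measure1 simp: o_def)

lemma side_continuous:
  fixes g :: field2
  assumes g: "continuous_on UNIV g"
  shows "g \<in> L2 (side_measure a b S)"
    "integral\<^sup>L (side_measure a b S) g = integral {0..side_length a b S} (\<lambda>s. g (side_param a b S s))"
proof -
  let ?N = "lebesgue_on {0<..<side_length a b S}"
  have c: "continuous_on A (\<lambda>s. g (side_param a b S s))" for A
    by (rule continuous_on_compose2[OF g continuous_side_param]) auto
  then have m: "(\<lambda>s. g (side_param a b S s)) \<in> borel_measurable ?N"
    by (intro continuous_imp_measurable_on_sets_lebesgue) auto
  have "bounded ((\<lambda>s. g (side_param a b S s)) ` {0..side_length a b S})"
    by (intro compact_imp_bounded compact_continuous_image c) auto
  then obtain B where B: "\<And>s. s \<in> {0..side_length a b S} \<Longrightarrow> cmod (g (side_param a b S s)) \<le> B"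
    unfolding bounded_iff by blast
  have fin: "finite_measure ?N" by (rule finite_measure_lebesgue_on) simp
  have int: "integrable ?N (\<lambda>s. g (side_param a b S s))"
    using B m by (intro finite_measure.integrable_const_bound[OF fin, where B=B] AE_I2) auto
  have gm: "g \<in> borel_measurable (side_measure a b S)"
    unfolding side_measure_def by (rule measurable_embed_measure1) (use m in simp)
  have "(cmod (g x))\<^sup>2 \<le> B\<^sup>2" if "x \<in> space (side_measure a b S)" for x
  proof -
    from that have "x \<in> side_param a b S ` {0<..<side_length a b S}"
      by (simp add: side_measure_def space_embed_measure)
    then obtain s where "s \<in> {0<..<side_length a b S}" "x = side_param a b S s" by blast
    then show ?thesis using B[of s] by (intro power_mono) auto
  qed
  then have "AE x in side_measure a b S. norm ((cmod (g x))\<^sup>2) \<le> B\<^sup>2" by (intro AE_I2) simp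
  moreover have "finite_measure (side_measure a b S)"
    unfolding side_measure_def
    by (subst embed_measure_eq_distr[OF inj_side_param], rule finite_measure.finite_measure_distr[OF fin measurable_embed_measure2[OF inj_side_param]])
  ultimately have "integrable (side_measure a b S) (\<lambda>x. (cmod (g x))\<^sup>2)"
    using gm by (intro finite_measure.integrable_const_bound[where B="B\<^sup>2"]) auto
  with gm show "g \<in> L2 (side_measure a b S)" by (simp add: L2_def)
  show "integral\<^sup>L (side_measure a b S) g = integral {0..side_length a b S} (\<lambda>s. g (side_param a b S s))"
    using side_integral[of g a b S] m lebesgue_integral_eq_integral[OF int]
    by (simp add: o_def integral_open_interval_real)
qed

text \<open>
  The field \<open>opp_dist\<close> times the normal coordinate direction vanishes on the opposite side and is
  tangential on the adjacent ones, so that only the observed side contributes.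
\<close>

lemma box_integral_opp_dist:
  assumes "smooth G" "0 < a" "0 < b"
  shows "integral\<^sup>L (box_measure a b) (pd (side_axis S) (\<lambda>z. opp_dist a b S z * G z)) =
    of_real (side_depth a b S) * integral\<^sup>L (side_measure a b S) G"
proof -
  note sm = smooth_mult[OF opp_dist_smooth assms(1), of a b S]
  note side = side_continuous(2)[OF smooth_continuous[OF assms(1)], of a b S]
  show ?thesis
    using box_integral_pd_snd[OF sm assms(3)] box_integral_pd_fst[OF sm assms(2)] side
    by (cases S) (simp_all flip: integral_mult_right)
qed

section \<open>Weak derivatives\<close>

locale rectangle =
  fixes a b :: real
  assumes a_pos: "0 < a" and b_pos: "0 < b"
begin

abbreviation \<Omega> :: "plane set" where "\<Omega> \<equiv> rect a b"
abbreviation M :: "plane measure" where "M \<equiv> lebesgue_on (rect a b)"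

lemma test_fun_smooth: "\<phi> \<in> test_fun \<Omega> \<Longrightarrow> smooth \<phi>"
  by (simp add: test_fun_def)

lemma test_fun_outside: "\<phi> \<in> test_fun \<Omega> \<Longrightarrow> x \<notin> \<Omega> \<Longrightarrow> \<phi> x = 0"
  unfolding test_fun_def using closure_subset[of "{x. \<phi> x \<noteq> 0}"] by blast

lemma test_fun_support:
  assumes "\<phi> \<in> test_fun \<Omega>" "smooth f" "{x. f x \<noteq> 0} \<subseteq> {x. \<phi> x \<noteq> 0}"
  shows "f \<in> test_fun \<Omega>"
proof -
  let ?K = "closure {x. \<phi> x \<noteq> 0}"
  have sub: "closure {x. f x \<noteq> 0} \<subseteq> ?K" by (rule closure_mono[OF assms(3)])
  have K: "compact ?K" "?K \<subseteq> \<Omega>" using assms(1) by (auto simp: test_fun_def)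
  have "compact (?K \<inter> closure {x. f x \<noteq> 0})" by (rule compact_Int_closed[OF K(1) closed_closure])
  then have "compact (closure {x. f x \<noteq> 0})" using Int_absorb1[OF sub] by simp
  with sub K(2) assms(2) show ?thesis unfolding test_fun_def by blast
qed

lemma test_fun_mult: "\<phi> \<in> test_fun \<Omega> \<Longrightarrow> smooth f \<Longrightarrow> (\<lambda>x. f x * \<phi> x) \<in> test_fun \<Omega>"
  by (rule test_fun_support) (auto intro: smooth_mult test_fun_smooth)

lemma test_fun_cnj: "\<phi> \<in> test_fun \<Omega> \<Longrightarrow> (\<lambda>x. cnj (\<phi> x)) \<in> test_fun \<Omega>"
  by (rule test_fun_support) (auto intro: smooth_cnj test_fun_smooth)

lemma test_fun_add:
  assumes "\<phi> \<in> test_fun \<Omega>" "\<psi> \<in> test_fun \<Omega>"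
  shows "(\<lambda>x. \<phi> x + \<psi> x) \<in> test_fun \<Omega>"
proof -
  let ?K = "closure {x. \<phi> x \<noteq> 0} \<union> closure {x. \<psi> x \<noteq> 0}"
  have K: "compact ?K" "?K \<subseteq> \<Omega>" using assms by (auto simp: test_fun_def)
  have "{x. \<phi> x + \<psi> x \<noteq> 0} \<subseteq> {x. \<phi> x \<noteq> 0} \<union> {x. \<psi> x \<noteq> 0}" by auto
  then have sub: "closure {x. \<phi> x + \<psi> x \<noteq> 0} \<subseteq> ?K"
    using closure_mono by (simp only: flip: closure_Un)
  have "compact (?K \<inter> closure {x. \<phi> x + \<psi> x \<noteq> 0})" by (rule compact_Int_closed[OF K(1) closed_closure])
  then have "compact (closure {x. \<phi> x + \<psi> x \<noteq> 0})" using Int_absorb1[OF sub] by simp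
  with sub K(2) smooth_add[OF test_fun_smooth test_fun_smooth, OF assms] show ?thesis
    unfolding test_fun_def by blast
qed

lemma integral_pd_test_fun:
  assumes "\<phi> \<in> test_fun \<Omega>" "is_axis v"
  shows "integral\<^sup>L M (pd v \<phi>) = 0"
proof -
  have "(0, y) \<notin> \<Omega>" "(a * pi, y) \<notin> \<Omega>" "(x, 0) \<notin> \<Omega>" "(x, b * pi) \<notin> \<Omega>" for x y
    by (auto simp: rect_def)
  then show ?thesis
    using test_fun_outside[OF assms(1)] test_fun_smooth[OF assms(1)] a_pos b_pos assms(2)
    by (intro box_integral_pd_eq_0) blast+
qed

text \<open>
  Test functions are closed under conjugation, so that the bilinear pairing of the definition can be
  replaced by the inner product.
\<close>

lemma has_weak_deriv_iff_ip:
  "has_weak_deriv \<Omega> v f g \<longleftrightarrow> f \<in> L2 M \<and> g \<in> L2 M \<and> (\<forall>\<phi>\<in>test_fun \<Omega>. ip M f (pd v \<phi>) = - ip M g \<phi>)"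
proof -
  have *: "(LINT x|M. f x * pd v (\<lambda>x. cnj (\<phi> x)) x) = ip M f (pd v \<phi>)"
    "(LINT x|M. g x * cnj (\<phi> x)) = ip M g \<phi>" if "\<phi> \<in> test_fun \<Omega>" for \<phi>
    using smooth_pd_cnj[OF test_fun_smooth[OF that]] by (simp_all add: ip_def)
  show ?thesis
    unfolding has_weak_deriv_def
  proof (intro conj_cong refl iffI ballI)
    fix \<phi> assume H: "\<forall>\<phi>\<in>test_fun \<Omega>. (LINT x|M. f x * pd v \<phi> x) = - (LINT x|M. g x * \<phi> x)"
      and \<phi>: "\<phi> \<in> test_fun \<Omega>"
    show "ip M f (pd v \<phi>) = - ip M g \<phi>"
      using bspec[OF H test_fun_cnj[OF \<phi>]] *[OF \<phi>] by simp
  next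
    fix \<phi> assume H: "\<forall>\<phi>\<in>test_fun \<Omega>. ip M f (pd v \<phi>) = - ip M g \<phi>" and \<phi>: "\<phi> \<in> test_fun \<Omega>"
    show "(LINT x|M. f x * pd v \<phi> x) = - (LINT x|M. g x * \<phi> x)"
      using bspec[OF H test_fun_cnj[OF \<phi>]] *[OF test_fun_cnj[OF \<phi>]] by simp
  qed
qed

lemma L2_integrable: "f \<in> L2 M \<Longrightarrow> integrable M f"
  using L2_integrable_mult[OF _ L2_box_continuous[of "\<lambda>_. 1"], of f a b] by simp

text \<open>
  Products of two cutoffs are test functions that converge boundedly to the indicator function of a
  box.
\<close>

lemma integral_box_eq_0:
  assumes f: "f \<in> L2 M" and orth: "\<And>\<phi>. \<phi> \<in> test_fun \<Omega> \<Longrightarrow> ip M f \<phi> = 0"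
  shows "(LINT x|M. indicator (box c d) x *\<^sub>R f x) = 0"
proof -
  define c1 where "c1 = max 0 (fst c)"
  define c2 where "c2 = max 0 (snd c)"
  define d1 where "d1 = min (a * pi) (fst d)"
  define d2 where "d2 = min (b * pi) (snd d)"
  have R: "{c1<..<d1} \<times> {c2<..<d2} \<subseteq> \<Omega>" by (auto simp: rect_def c1_def c2_def d1_def d2_def)
  have box: "x \<in> box c d \<longleftrightarrow> x \<in> {c1<..<d1} \<times> {c2<..<d2}" if "x \<in> \<Omega>" for x
    using that by (cases x; cases c; cases d) (auto simp: rect_def c1_def c2_def d1_def d2_def box_def Basis_prod_def)
  define \<phi> where "\<phi> n = (\<lambda>z. complex_of_real (cutoff c1 d1 (real n) (fst z)) * complex_of_real (cutoff c2 d2 (real n) (snd z)))" for n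
  have \<phi>: "\<phi> n \<in> test_fun \<Omega>" if "0 < n" for n
    using cutoff_test_fun[OF smooth_const[of 1] _ R, of "real n"] that by (simp add: \<phi>_def)
  have "(\<lambda>n. ip M f (\<phi> n)) \<longlonglongrightarrow> (LINT x|M. indicator (box c d) x *\<^sub>R f x)"
    unfolding ip_def
  proof (rule integral_dominated_convergence)
    show "integrable M (\<lambda>x. cmod (f x))" using L2_integrable[OF f] by (rule integrable_norm)
    show "(\<lambda>x. indicator (box c d) x *\<^sub>R f x) \<in> borel_measurable M"
      using L2_measurable[OF f] by (intro borel_measurable_scaleR measurable_restrict_space1[OF borel_measurable_indicator]) auto
    show "(\<lambda>x. f x * cnj (\<phi> n x)) \<in> borel_measurable M" for n
    proof -
      have "smooth (\<phi> n)" unfolding \<phi>_def by (intro smooth_mult cutoff_smooth)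
      then show ?thesis by (intro borel_measurable_integrable L2_integrable_ip f L2_box_smooth)
    qed
    show "AE x in M. (\<lambda>n. f x * cnj (\<phi> n x)) \<longlonglongrightarrow> indicator (box c d) x *\<^sub>R f x"
    proof (rule AE_I2)
      fix x assume "x \<in> space M"
      then have x: "x \<in> \<Omega>" by simp
      show "(\<lambda>n. f x * cnj (\<phi> n x)) \<longlonglongrightarrow> indicator (box c d) x *\<^sub>R f x"
      proof (cases "x \<in> box c d")
        case True
        then have "c1 < fst x" "fst x < d1" "c2 < snd x" "snd x < d2" using box[OF x] by auto
        then have "(\<lambda>n. f x * cnj (\<phi> n x)) \<longlonglongrightarrow> f x * cnj (complex_of_real 1 * complex_of_real 1)"
          unfolding \<phi>_def by (intro tendsto_intros cutoff_tendsto)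
        with True show ?thesis by simp
      next
        case False
        have "\<phi> n x = 0" for n
        proof (rule ccontr)
          assume nz: "\<phi> n x \<noteq> 0"
          then have n: "0 < real n" by (cases n) (auto simp: \<phi>_def cutoff_def flat_def)
          have p: "0 < 1 / real n" using n by simp
          have "x \<in> {c1<..<d1} \<times> {c2<..<d2}"
            using cutoff_nonzero[OF n, of c1 d1 "fst x"] cutoff_nonzero[OF n, of c2 d2 "snd x"] nz p
            by (cases x) (auto simp: \<phi>_def simp del: zero_less_divide_1_iff)
          with False box[OF x] show False by simp
        qed
        with False show ?thesis by simp
      qed
    qed
    show "AE x in M. norm (f x * cnj (\<phi> n x)) \<le> cmod (f x)" for n
      by (intro AE_I2) (auto simp: norm_mult \<phi>_def abs_mult cutoff_bounds intro!: mult_left_le mult_le_one)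
  qed
  moreover have "(\<lambda>n. ip M f (\<phi> n)) \<longlonglongrightarrow> 0"
    by (intro tendsto_eventually eventually_sequentiallyI[of 1] orth \<phi>) simp
  ultimately show ?thesis by (rule LIMSEQ_unique)
qed

text \<open>
  Boxes form a generator of the Borel sets that is stable under intersections. As the integral of \<open>f\<close>
  over every box vanishes, so does its integral over every Borel set, and a Lebesgue set differs from
  a Borel set by a null set.
\<close>

lemma fundamental_lemma:
  assumes f: "f \<in> L2 M" and orth: "\<And>\<phi>. \<phi> \<in> test_fun \<Omega> \<Longrightarrow> ip M f \<phi> = 0"
  shows "AE x in M. f x = 0"
proof (rule sigma_finite_measure.density_zero[OF _ L2_integrable[OF f]])
  show "sigma_finite_measure M"
    by (rule finite_measure.axioms(1)[OF finite_measure_box])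
next
  note int = L2_integrable[OF f]
  note box0 = integral_box_eq_0[OF f orth]
  have Mset: "B \<inter> \<Omega> \<in> sets M" if "B \<in> sets lebesgue" for B
    using that by (auto simp: sets_restrict_space)
  have si: "integrable M (\<lambda>x. indicator B x *\<^sub>R f x)" if "B \<in> sets lebesgue" for B
  proof -
    have "integrable M (\<lambda>x. indicator (B \<inter> \<Omega>) x *\<^sub>R f x)"
      by (rule integrable_mult_indicator[OF Mset[OF that] int])
    moreover have "integrable M (\<lambda>x. indicator (B \<inter> \<Omega>) x *\<^sub>R f x) \<longleftrightarrow> integrable M (\<lambda>x. indicator B x *\<^sub>R f x)"
      by (intro Bochner_Integration.integrable_cong) (auto simp: indicator_def)
    ultimately show ?thesis by simp
  qed
  have full: "(LINT x|M. f x) = 0"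
  proof -
    have "(LINT x|M. indicator (box (0, 0) (a * pi, b * pi)) x *\<^sub>R f x) = (LINT x|M. f x)"
      by (intro Bochner_Integration.integral_cong) (auto simp flip: rect_eq_box)
    then show ?thesis using box0[of "(0, 0)" "(a * pi, b * pi)"] by simp
  qed
  let ?G = "range (\<lambda>(c, d). box c (d::plane))"
  have bs: "sets (borel :: plane measure) = sigma_sets UNIV ?G" by (simp add: borel_eq_box)
  have borel: "(LINT x|M. indicator B x *\<^sub>R f x) = 0" if "B \<in> sets borel" for B :: "plane set"
  proof -
    have "B \<in> sigma_sets UNIV ?G" using that by (simp add: borel_eq_box)
    have "Int_stable ?G" by (auto simp: Int_stable_def box_Int_box)
    from this subset_UNIV[of ?G, folded Pow_UNIV] \<open>B \<in> sigma_sets UNIV ?G\<close> show ?thesis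
    proof (induction rule: sigma_sets_induct_disjoint)
      case (compl A)
      have A: "A \<in> sets lebesgue" using compl(1)[folded bs] by simp
      have "(LINT x|M. indicator (UNIV - A) x *\<^sub>R f x) = (LINT x|M. f x - indicator A x *\<^sub>R f x)"
        by (intro Bochner_Integration.integral_cong) (auto simp: indicator_def)
      also have "\<dots> = 0" using compl(2) full by (simp add: int si[OF A])
      finally show ?case .
    next
      case (union A)
      have A: "A i \<in> sets lebesgue" for i using union(2)[unfolded bs[symmetric]] by (auto simp: subset_iff)
      have ind: "indicator (A i \<inter> \<Omega>) x *\<^sub>R f x = indicator (A i) x *\<^sub>R f x" if "x \<in> space M" for x i
        using that by (simp add: indicator_def)
      have "(LINT x|M. indicator (\<Union>i. A i \<inter> \<Omega>) x *\<^sub>R f x) = (\<Sum>i. LINT x|M. indicator (A i \<inter> \<Omega>) x *\<^sub>R f x)"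
      proof (rule lebesgue_integral_countable_add[unfolded set_lebesgue_integral_def set_integrable_def])
        show "A i \<inter> \<Omega> \<in> sets M" for i by (rule Mset[OF A])
        show "A i \<inter> \<Omega> \<inter> (A j \<inter> \<Omega>) = {}" if "i \<noteq> j" for i j
          using union(1) that by (auto simp: disjoint_family_on_def)
        show "integrable M (\<lambda>x. indicator (\<Union>i. A i \<inter> \<Omega>) x *\<^sub>R f x)"
          by (intro integrable_mult_indicator int sets.countable_UN) (use Mset[OF A] in auto)
      qed
      also have "\<dots> = (\<Sum>i. LINT x|M. indicator (A i) x *\<^sub>R f x)"
        by (intro suminf_cong Bochner_Integration.integral_cong refl ind)
      also have "\<dots> = 0" using union(3) by simp
      also have "(LINT x|M. indicator (\<Union>i. A i \<inter> \<Omega>) x *\<^sub>R f x) = (LINT x|M. indicator (\<Union>(range A)) x *\<^sub>R f x)"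
        by (intro Bochner_Integration.integral_cong) (auto simp: indicator_def)
      finally show ?case .
    qed (use box0 in auto)
  qed
  fix A assume "A \<in> sets M"
  then have "A \<in> sets lebesgue" using rect_sets(1) by (auto simp: sets_restrict_space)
  then obtain S N N' where S: "A = S \<union> N" "N \<subseteq> N'" "N' \<in> null_sets lborel" "S \<in> sets lborel"
    by (rule sets_completionE)
  have "AE x in lborel. x \<notin> N'" by (rule AE_not_in[OF S(3)])
  then have "AE x in lebesgue. x \<notin> N'" by (rule AE_completion)
  then have "AE x in M. x \<notin> N'" using rect_sets(1) by (auto simp: AE_restrict_space_iff)
  then have "AE x in M. indicator A x *\<^sub>R f x = indicator S x *\<^sub>R f x"
    by eventually_elim (use S(1,2) in \<open>auto simp: indicator_def\<close>)
  then have "(LINT x|M. indicator A x *\<^sub>R f x) = (LINT x|M. indicator S x *\<^sub>R f x)"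
    using \<open>A \<in> sets lebesgue\<close> S(4) by (intro integral_cong_AE borel_measurable_integrable si) auto
  also have "\<dots> = 0" using borel S(4) by simp
  finally show "set_lebesgue_integral M A f = 0" by (simp add: set_lebesgue_integral_def)
qed

lemma has_weak_deriv_L2: "has_weak_deriv \<Omega> v f g \<Longrightarrow> f \<in> L2 M" "has_weak_deriv \<Omega> v f g \<Longrightarrow> g \<in> L2 M"
  by (auto simp: has_weak_deriv_def)

lemma has_weak_deriv_unique:
  assumes "has_weak_deriv \<Omega> v f g" "has_weak_deriv \<Omega> v f g'"
  shows "AE x in M. g x = g' x"
proof -
  note L = has_weak_deriv_L2[OF assms(1)] has_weak_deriv_L2[OF assms(2)]
  have "AE x in M. g x - g' x = 0"
  proof (rule fundamental_lemma)
    fix \<phi> assume \<phi>: "\<phi> \<in> test_fun \<Omega>"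
    then have "ip M g \<phi> = ip M g' \<phi>" using assms by (auto simp: has_weak_deriv_iff_ip)
    then show "ip M (\<lambda>x. g x - g' x) \<phi> = 0"
      using L L2_box_smooth[OF test_fun_smooth[OF \<phi>]] by (simp add: ip_diff_left)
  qed (use L in \<open>auto intro: L2_diff\<close>)
  then show ?thesis by simp
qed

lemma has_weak_deriv_cong_AE:
  assumes "has_weak_deriv \<Omega> v f g" "f' \<in> L2 M" "g' \<in> L2 M"
    "AE x in M. f x = f' x" "AE x in M. g x = g' x" "is_axis v"
  shows "has_weak_deriv \<Omega> v f' g'"
proof -
  note L = has_weak_deriv_L2[OF assms(1)]
  have "ip M f' (pd v \<phi>) = - ip M g' \<phi>" if \<phi>: "\<phi> \<in> test_fun \<Omega>" for \<phi>
  proof -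
    note s = test_fun_smooth[OF \<phi>]
    have "ip M f' (pd v \<phi>) = ip M f (pd v \<phi>)"
      using L assms by (intro ip_cong_AE) (auto intro: L2_box_smooth smooth_pd s)
    moreover have "ip M g' \<phi> = ip M g \<phi>"
      using L assms by (intro ip_cong_AE) (auto intro: L2_box_smooth s)
    ultimately show ?thesis using assms(1) \<phi> by (simp add: has_weak_deriv_iff_ip)
  qed
  then show ?thesis using assms(2,3) by (simp add: has_weak_deriv_iff_ip)
qed

text \<open>
  The function \<open>weak_deriv\<close> is an arbitrary choice among the weak derivatives; by uniqueness it may be
  replaced by any of them.
\<close>

lemma weak_deriv_eq:
  assumes "has_weak_deriv \<Omega> v f g"
  shows "has_weak_deriv \<Omega> v f (weak_deriv \<Omega> v f)" "AE x in M. weak_deriv \<Omega> v f x = g x"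
proof -
  show *: "has_weak_deriv \<Omega> v f (weak_deriv \<Omega> v f)"
    unfolding weak_deriv_def using someI[of "\<lambda>g. has_weak_deriv \<Omega> v f g" g] assms by simp
  show "AE x in M. weak_deriv \<Omega> v f x = g x" by (rule has_weak_deriv_unique[OF * assms])
qed

lemma has_weak_deriv_add:
  assumes "has_weak_deriv \<Omega> v f g" "has_weak_deriv \<Omega> v f' g'" "is_axis v"
  shows "has_weak_deriv \<Omega> v (\<lambda>x. f x + f' x) (\<lambda>x. g x + g' x)"
proof -
  note L = has_weak_deriv_L2[OF assms(1)] has_weak_deriv_L2[OF assms(2)]
  show ?thesis unfolding has_weak_deriv_iff_ip
  proof (intro conjI ballI L2_add L)
    fix \<phi> assume \<phi>: "\<phi> \<in> test_fun \<Omega>"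
    have "\<phi> \<in> L2 M" "pd v \<phi> \<in> L2 M"
      using test_fun_smooth[OF \<phi>] assms(3) by (auto intro!: L2_box_smooth smooth_pd)
    with assms(1,2) \<phi> L show "ip M (\<lambda>x. f x + f' x) (pd v \<phi>) = - ip M (\<lambda>x. g x + g' x) \<phi>"
      by (simp add: has_weak_deriv_iff_ip ip_add_left)
  qed
qed

lemma has_weak_deriv_scale:
  "has_weak_deriv \<Omega> v f g \<Longrightarrow> has_weak_deriv \<Omega> v (\<lambda>x. c * f x) (\<lambda>x. c * g x)"
  unfolding has_weak_deriv_iff_ip by (simp add: ip_scale_left L2_scale)

lemma has_weak_deriv_diff:
  assumes "has_weak_deriv \<Omega> v f g" "has_weak_deriv \<Omega> v f' g'" "is_axis v"
  shows "has_weak_deriv \<Omega> v (\<lambda>x. f x - f' x) (\<lambda>x. g x - g' x)"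
  using has_weak_deriv_add[OF assms(1) has_weak_deriv_scale[OF assms(2), of "-1"] assms(3)] by simp

lemma has_weak_deriv_smooth:
  assumes "smooth f" "is_axis v" shows "has_weak_deriv \<Omega> v f (pd v f)"
  unfolding has_weak_deriv_def
proof (intro conjI ballI L2_box_smooth smooth_pd assms)
  fix \<phi> assume \<phi>: "\<phi> \<in> test_fun \<Omega>"
  note s = test_fun_smooth[OF \<phi>]
  have "0 = integral\<^sup>L M (pd v (\<lambda>x. f x * \<phi> x))"
    by (rule integral_pd_test_fun[OF test_fun_mult[OF \<phi> assms(1)] assms(2), symmetric])
  also have "\<dots> = (LINT x|M. f x * pd v \<phi> x + pd v f x * \<phi> x)"
    by (simp add: smooth_pd_mult[OF assms(1) s])
  also have "\<dots> = (LINT x|M. f x * pd v \<phi> x) + (LINT x|M. pd v f x * \<phi> x)"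
    by (intro Bochner_Integration.integral_add L2_integrable_mult L2_box_smooth smooth_pd assms s)
  finally show "(LINT x|M. f x * pd v \<phi> x) = - (LINT x|M. pd v f x * \<phi> x)"
    by (simp add: eq_neg_iff_add_eq_0)
qed

lemma has_weak_deriv_mult_smooth:
  assumes "has_weak_deriv \<Omega> v f g" "smooth h" "is_axis v"
  shows "has_weak_deriv \<Omega> v (\<lambda>x. h x * f x) (\<lambda>x. pd v h x * f x + h x * g x)"
  unfolding has_weak_deriv_def
proof (intro conjI ballI L2_add L2_mult_continuous smooth_continuous smooth_pd assms
    has_weak_deriv_L2[OF assms(1)])
  note L = has_weak_deriv_L2[OF assms(1)]
  fix \<phi> assume \<phi>: "\<phi> \<in> test_fun \<Omega>"
  note s = test_fun_smooth[OF \<phi>]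
  have "- (LINT x|M. g x * (h x * \<phi> x)) = (LINT x|M. f x * pd v (\<lambda>x. h x * \<phi> x) x)"
    using assms(1) test_fun_mult[OF \<phi> assms(2)] by (simp add: has_weak_deriv_def)
  also have "\<dots> = (LINT x|M. (h x * f x) * pd v \<phi> x + f x * (pd v h x * \<phi> x))"
    by (simp only: smooth_pd_mult[OF assms(2) s]) (simp add: algebra_simps)
  also have "\<dots> = (LINT x|M. (h x * f x) * pd v \<phi> x) + (LINT x|M. f x * (pd v h x * \<phi> x))"
    by (intro Bochner_Integration.integral_add L2_integrable_mult L2_mult_continuous L2_box_smooth
        smooth_continuous smooth_mult smooth_pd assms s L)
  finally have "(LINT x|M. (h x * f x) * pd v \<phi> x) =
      - ((LINT x|M. f x * (pd v h x * \<phi> x)) + (LINT x|M. g x * (h x * \<phi> x)))"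
    by (simp add: algebra_simps)
  also have "(LINT x|M. f x * (pd v h x * \<phi> x)) + (LINT x|M. g x * (h x * \<phi> x)) =
      (LINT x|M. f x * (pd v h x * \<phi> x) + g x * (h x * \<phi> x))"
    by (intro Bochner_Integration.integral_add[symmetric] L2_integrable_mult L2_box_smooth
        smooth_mult smooth_pd assms s L)
  finally show "(LINT x|M. h x * f x * pd v \<phi> x) = - (LINT x|M. (pd v h x * f x + h x * g x) * \<phi> x)"
    by (simp add: algebra_simps)
qed

text \<open>
  The weak derivative is a closed operator: its defining identities pass to limits.
\<close>

lemma has_weak_deriv_limit:
  assumes "L2_lim F M fs f" "L2_lim F M gs g" "\<forall>\<^sub>F i in F. has_weak_deriv \<Omega> v (fs i) (gs i)"
    "F \<noteq> bot" "is_axis v"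
  shows "has_weak_deriv \<Omega> v f g"
  unfolding has_weak_deriv_iff_ip
proof (intro conjI ballI L2_limD(1)[OF assms(1)] L2_limD(1)[OF assms(2)])
  fix \<phi> assume \<phi>: "\<phi> \<in> test_fun \<Omega>"
  note s = test_fun_smooth[OF \<phi>]
  have 1: "((\<lambda>i. ip M (fs i) (pd v \<phi>)) \<longlongrightarrow> ip M f (pd v \<phi>)) F"
    by (intro L2_lim_ip[OF assms(1)] L2_lim_const L2_box_smooth smooth_pd s assms)
  have "((\<lambda>i. - ip M (gs i) \<phi>) \<longlongrightarrow> - ip M g \<phi>) F"
    by (intro tendsto_minus L2_lim_ip[OF assms(2)] L2_lim_const L2_box_smooth s)
  moreover have "\<forall>\<^sub>F i in F. - ip M (gs i) \<phi> = ip M (fs i) (pd v \<phi>)"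
    using assms(3) by eventually_elim (use \<phi> in \<open>simp add: has_weak_deriv_iff_ip\<close>)
  ultimately have "((\<lambda>i. ip M (fs i) (pd v \<phi>)) \<longlongrightarrow> - ip M g \<phi>) F"
    by (rule Lim_transform_eventually)
  with 1 show "ip M f (pd v \<phi>) = - ip M g \<phi>" using tendsto_unique assms(4) by blast
qed


section \<open>Sobolev spaces\<close>

lemma H1D: "f \<in> H1 \<Omega> \<Longrightarrow> is_axis v \<Longrightarrow> has_weak_deriv \<Omega> v f (weak_deriv \<Omega> v f)"
  by (auto simp: H1_def is_axis_def intro: weak_deriv_eq(1))

lemma H1_L2: "f \<in> H1 \<Omega> \<Longrightarrow> f \<in> L2 M"
  by (simp add: H1_def)

lemma H1_weak_L2: "f \<in> H1 \<Omega> \<Longrightarrow> is_axis v \<Longrightarrow> weak_deriv \<Omega> v f \<in> L2 M"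
  using H1D has_weak_deriv_L2(2) by blast

lemma H1I: "(\<And>v. is_axis v \<Longrightarrow> \<exists>g. has_weak_deriv \<Omega> v f g) \<Longrightarrow> f \<in> H1 \<Omega>"
  unfolding H1_def is_axis_def by (auto dest: has_weak_deriv_L2)

lemma weak_deriv_smooth: "smooth f \<Longrightarrow> is_axis v \<Longrightarrow> AE x in M. weak_deriv \<Omega> v f x = pd v f x"
  by (rule weak_deriv_eq(2)[OF has_weak_deriv_smooth])

lemma H1_smooth: "smooth f \<Longrightarrow> f \<in> H1 \<Omega>"
  by (rule H1I) (blast intro: has_weak_deriv_smooth)

lemma weak_deriv_diff:
  assumes "f \<in> H1 \<Omega>" "g \<in> H1 \<Omega>" "is_axis v"
  shows "AE x in M. weak_deriv \<Omega> v (\<lambda>x. f x - g x) x = weak_deriv \<Omega> v f x - weak_deriv \<Omega> v g x"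
  by (rule weak_deriv_eq(2)[OF has_weak_deriv_diff[OF H1D H1D]]) (use assms in auto)

lemma weak_deriv_scale:
  assumes "f \<in> H1 \<Omega>" "is_axis v"
  shows "AE x in M. weak_deriv \<Omega> v (\<lambda>x. c * f x) x = c * weak_deriv \<Omega> v f x"
  by (rule weak_deriv_eq(2)[OF has_weak_deriv_scale[OF H1D]]) (use assms in auto)

lemma H1_diff: "f \<in> H1 \<Omega> \<Longrightarrow> g \<in> H1 \<Omega> \<Longrightarrow> (\<lambda>x. f x - g x) \<in> H1 \<Omega>"
  by (rule H1I) (blast intro: has_weak_deriv_diff H1D)

lemma H1_scale: "f \<in> H1 \<Omega> \<Longrightarrow> (\<lambda>x. c * f x) \<in> H1 \<Omega>"
  by (rule H1I) (blast intro: has_weak_deriv_scale H1D)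

lemma H1_divide: "f \<in> H1 \<Omega> \<Longrightarrow> (\<lambda>x. f x / c) \<in> H1 \<Omega>"
  using H1_scale[of f "inverse c"] by (simp add: field_simps)

lemma H1_cong_AE:
  assumes "f \<in> H1 \<Omega>" "g \<in> L2 M" "AE x in M. f x = g x"
  shows "g \<in> H1 \<Omega>" "is_axis v \<Longrightarrow> AE x in M. weak_deriv \<Omega> v g x = weak_deriv \<Omega> v f x"
proof -
  have *: "has_weak_deriv \<Omega> v g (weak_deriv \<Omega> v f)" if "is_axis v" for v
    by (rule has_weak_deriv_cong_AE[OF H1D[OF assms(1) that] assms(2) H1_weak_L2[OF assms(1) that] assms(3) _ that]) simp
  then show "g \<in> H1 \<Omega>" by (blast intro: H1I)
  show "AE x in M. weak_deriv \<Omega> v g x = weak_deriv \<Omega> v f x" if "is_axis v"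
    by (rule weak_deriv_eq(2)[OF *[OF that]])
qed

lemma norm_weak_deriv_diff:
  assumes "f \<in> H1 \<Omega>" "g \<in> H1 \<Omega>" "is_axis v"
  shows "L2_norm M (weak_deriv \<Omega> v (\<lambda>x. f x - g x)) = L2_norm M (\<lambda>x. weak_deriv \<Omega> v f x - weak_deriv \<Omega> v g x)"
  using assms by (intro L2_norm_cong_AE weak_deriv_diff L2_measurable L2_diff H1_weak_L2 H1_diff)

lemma grad_norm_ge: "is_axis v \<Longrightarrow> L2_norm M (weak_deriv \<Omega> v f) \<le> grad_norm \<Omega> f"
  by (auto simp: grad_norm_def is_axis_def intro!: real_le_rsqrt)

lemma grad_norm_le: "grad_norm \<Omega> f \<le> L2_norm M (weak_dx \<Omega> f) + L2_norm M (weak_dy \<Omega> f)"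
  unfolding grad_norm_def by (rule real_le_lsqrt) (auto simp: power2_sum)

lemma grad_norm_power2: "(grad_norm \<Omega> f)\<^sup>2 = (L2_norm M (weak_dx \<Omega> f))\<^sup>2 + (L2_norm M (weak_dy \<Omega> f))\<^sup>2"
  by (simp add: grad_norm_def)

lemma grad_norm_nonneg: "0 \<le> grad_norm \<Omega> f"
  by (simp add: grad_norm_def)

lemma H1_norm_ge: "L2_norm M f \<le> H1_norm \<Omega> f" "grad_norm \<Omega> f \<le> H1_norm \<Omega> f"
  by (auto simp: H1_norm_def intro!: real_le_rsqrt)

lemma H1_norm_le: "H1_norm \<Omega> f \<le> L2_norm M f + grad_norm \<Omega> f"
  unfolding H1_norm_def by (rule real_le_lsqrt) (auto simp: power2_sum grad_norm_nonneg)

text \<open>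
  The definitions of convergence in \<open>H\<^sup>1\<close> take the weak derivative of a difference. By uniqueness this is
  the difference of the weak derivatives, so that each partial derivative converges in \<open>L\<^sup>2\<close>.
\<close>

lemma grad_lim:
  assumes "\<forall>\<^sub>F i in F. fs i \<in> H1 \<Omega>" "f \<in> H1 \<Omega>" "((\<lambda>i. grad_norm \<Omega> (\<lambda>x. fs i x - f x)) \<longlongrightarrow> 0) F" "is_axis v"
  shows "L2_lim F M (\<lambda>i. weak_deriv \<Omega> v (fs i)) (weak_deriv \<Omega> v f)"
proof (rule L2_lim_bound[OF _ _ _ assms(3)])
  show "\<forall>\<^sub>F i in F. L2_norm M (\<lambda>x. weak_deriv \<Omega> v (fs i) x - weak_deriv \<Omega> v f x) \<le> grad_norm \<Omega> (\<lambda>x. fs i x - f x)"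
    using assms(1) by eventually_elim (metis norm_weak_deriv_diff[OF _ assms(2,4)] grad_norm_ge[OF assms(4)])
  show "\<forall>\<^sub>F i in F. weak_deriv \<Omega> v (fs i) \<in> L2 M"
    using assms(1) by eventually_elim (rule H1_weak_L2[OF _ assms(4)])
qed (rule H1_weak_L2[OF assms(2,4)])

lemma H1_norm_lim_iff:
  assumes "\<forall>\<^sub>F i in F. fs i \<in> H1 \<Omega>" "f \<in> H1 \<Omega>"
  shows "((\<lambda>i. H1_norm \<Omega> (\<lambda>x. fs i x - f x)) \<longlongrightarrow> 0) F \<longleftrightarrow>
    L2_lim F M fs f \<and> (\<forall>v. is_axis v \<longrightarrow> L2_lim F M (\<lambda>i. weak_deriv \<Omega> v (fs i)) (weak_deriv \<Omega> v f))"
proof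
  assume H: "((\<lambda>i. H1_norm \<Omega> (\<lambda>x. fs i x - f x)) \<longlongrightarrow> 0) F"
  have "L2_lim F M fs f"
    by (rule L2_lim_bound[OF H1_L2[OF assms(2)] _ _ H])
       (use assms(1) in \<open>auto elim: eventually_mono intro: H1_L2 H1_norm_ge\<close>)
  moreover have "((\<lambda>i. grad_norm \<Omega> (\<lambda>x. fs i x - f x)) \<longlongrightarrow> 0) F"
    by (rule tendsto_sandwich[OF _ _ tendsto_const H]) (auto simp: grad_norm_nonneg H1_norm_ge)
  ultimately show "L2_lim F M fs f \<and> (\<forall>v. is_axis v \<longrightarrow> L2_lim F M (\<lambda>i. weak_deriv \<Omega> v (fs i)) (weak_deriv \<Omega> v f))"
    using grad_lim[OF assms] by blast
next
  assume H: "L2_lim F M fs f \<and> (\<forall>v. is_axis v \<longrightarrow> L2_lim F M (\<lambda>i. weak_deriv \<Omega> v (fs i)) (weak_deriv \<Omega> v f))"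
  let ?d = "\<lambda>v i. L2_norm M (\<lambda>x. weak_deriv \<Omega> v (fs i) x - weak_deriv \<Omega> v f x)"
  have lim: "((\<lambda>i. L2_norm M (\<lambda>x. fs i x - f x) + (?d (1, 0) i + ?d (0, 1) i)) \<longlongrightarrow> 0 + (0 + 0)) F"
    using H by (intro tendsto_add L2_limD(3)) auto
  show "((\<lambda>i. H1_norm \<Omega> (\<lambda>x. fs i x - f x)) \<longlongrightarrow> 0) F"
  proof (rule tendsto_sandwich[OF _ _ tendsto_const])
    show "\<forall>\<^sub>F i in F. 0 \<le> H1_norm \<Omega> (\<lambda>x. fs i x - f x)" by (simp add: H1_norm_def)
    show "\<forall>\<^sub>F i in F. H1_norm \<Omega> (\<lambda>x. fs i x - f x) \<le> L2_norm M (\<lambda>x. fs i x - f x) + (?d (1, 0) i + ?d (0, 1) i)"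
      using assms(1)
    proof eventually_elim
      case (elim i)
      show ?case
        using H1_norm_le[of "\<lambda>x. fs i x - f x"] grad_norm_le[of "\<lambda>x. fs i x - f x"]
          norm_weak_deriv_diff[OF elim assms(2) axis_simps(1)] norm_weak_deriv_diff[OF elim assms(2) axis_simps(2)]
        by linarith
    qed
  qed (use lim in simp)
qed

lemma H10_iff:
  "p \<in> H10 \<Omega> \<longleftrightarrow> p \<in> H1 \<Omega> \<and> (\<exists>\<phi>. (\<forall>n. \<phi> n \<in> test_fun \<Omega>) \<and> L2_lim sequentially M \<phi> p \<and>
     (\<forall>v. is_axis v \<longrightarrow> L2_lim sequentially M (\<lambda>n. pd v (\<phi> n)) (weak_deriv \<Omega> v p)))"
proof -
  have "(\<lambda>n. H1_norm \<Omega> (\<lambda>x. \<phi> n x - p x)) \<longlonglongrightarrow> 0 \<longleftrightarrow> L2_lim sequentially M \<phi> p \<and>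
     (\<forall>v. is_axis v \<longrightarrow> L2_lim sequentially M (\<lambda>n. pd v (\<phi> n)) (weak_deriv \<Omega> v p))"
    if p: "p \<in> H1 \<Omega>" and \<phi>: "\<forall>n. \<phi> n \<in> test_fun \<Omega>" for \<phi> :: "nat \<Rightarrow> field2"
  proof -
    have s: "smooth (\<phi> n)" for n using \<phi> test_fun_smooth by blast
    have "\<forall>\<^sub>F n in sequentially. \<phi> n \<in> H1 \<Omega>" using H1_smooth[OF s] by simp
    note 1 = H1_norm_lim_iff[OF this p]
    have "L2_lim sequentially M (\<lambda>n. pd v (\<phi> n)) (weak_deriv \<Omega> v p) \<longleftrightarrow>
        L2_lim sequentially M (\<lambda>n. weak_deriv \<Omega> v (\<phi> n)) (weak_deriv \<Omega> v p)" if v: "is_axis v" for v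
    proof
      have L: "pd v (\<phi> n) \<in> L2 M" "weak_deriv \<Omega> v (\<phi> n) \<in> L2 M" for n
        by (intro L2_box_smooth smooth_pd s v, intro H1_weak_L2 H1_smooth s v)
      have ae: "AE x in M. weak_deriv \<Omega> v (\<phi> n) x = pd v (\<phi> n) x"
        "AE x in M. pd v (\<phi> n) x = weak_deriv \<Omega> v (\<phi> n) x" for n
        using weak_deriv_smooth[OF s[of n] v] by auto
      show "L2_lim sequentially M (\<lambda>n. weak_deriv \<Omega> v (\<phi> n)) (weak_deriv \<Omega> v p)"
        if "L2_lim sequentially M (\<lambda>n. pd v (\<phi> n)) (weak_deriv \<Omega> v p)"
        by (rule L2_lim_cong_AE[OF that _ H1_weak_L2[OF p v]]) (use L ae in auto)
      show "L2_lim sequentially M (\<lambda>n. pd v (\<phi> n)) (weak_deriv \<Omega> v p)"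
        if "L2_lim sequentially M (\<lambda>n. weak_deriv \<Omega> v (\<phi> n)) (weak_deriv \<Omega> v p)"
        by (rule L2_lim_cong_AE[OF that _ H1_weak_L2[OF p v]]) (use L ae in auto)
    qed
    with 1 show ?thesis by blast
  qed
  then show ?thesis unfolding H10_def by blast
qed

lemma H10_H1: "p \<in> H10 \<Omega> \<Longrightarrow> p \<in> H1 \<Omega>"
  by (simp add: H10_iff)

lemma H10_scale:
  assumes "p \<in> H10 \<Omega>" shows "(\<lambda>x. c * p x) \<in> H10 \<Omega>"
proof -
  obtain \<phi> where p: "p \<in> H1 \<Omega>" and \<phi>: "\<And>n. \<phi> n \<in> test_fun \<Omega>" and lim: "L2_lim sequentially M \<phi> p"
    "\<And>v. is_axis v \<Longrightarrow> L2_lim sequentially M (\<lambda>n. pd v (\<phi> n)) (weak_deriv \<Omega> v p)"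
    using assms unfolding H10_iff by blast
  have s: "smooth (\<phi> n)" for n using \<phi> test_fun_smooth by blast
  show ?thesis unfolding H10_iff
  proof (intro conjI exI allI impI)
    show "(\<lambda>x. c * p x) \<in> H1 \<Omega>" by (rule H1_scale[OF p])
    show "(\<lambda>x. c * \<phi> n x) \<in> test_fun \<Omega>" for n by (rule test_fun_mult[OF \<phi> smooth_const])
    show "L2_lim sequentially M (\<lambda>n x. c * \<phi> n x) (\<lambda>x. c * p x)" by (rule L2_lim_scale[OF lim(1)])
    fix v assume v: "is_axis v"
    have "L2_lim sequentially M (\<lambda>n x. pd v (\<lambda>x. c * \<phi> n x) x) (\<lambda>x. c * weak_deriv \<Omega> v p x)"
      unfolding smooth_pd_scale[OF s] by (rule L2_lim_scale[OF lim(2)[OF v]])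
    then show "L2_lim sequentially M (\<lambda>n. pd v (\<lambda>x. c * \<phi> n x)) (weak_deriv \<Omega> v (\<lambda>x. c * p x))"
    proof (rule L2_lim_cong_AE)
      show "weak_deriv \<Omega> v (\<lambda>x. c * p x) \<in> L2 M" by (intro H1_weak_L2 H1_scale p v)
      show "AE x in M. weak_deriv \<Omega> v (\<lambda>x. c * p x) x = c * weak_deriv \<Omega> v p x" by (intro weak_deriv_scale p v)
      have "pd v (\<lambda>x. c * \<phi> n x) \<in> L2 M" for n by (intro L2_box_smooth smooth_pd smooth_mult smooth_const s v)
      then show "\<forall>\<^sub>F n in sequentially. pd v (\<lambda>x. c * \<phi> n x) \<in> L2 M \<and>
          (AE x in M. pd v (\<lambda>x. c * \<phi> n x) x = pd v (\<lambda>x. c * \<phi> n x) x)" by simp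
    qed
  qed
qed

lemma H10_diff:
  assumes "p \<in> H10 \<Omega>" "q \<in> H10 \<Omega>" shows "(\<lambda>x. p x - q x) \<in> H10 \<Omega>"
proof -
  obtain \<phi> where p: "p \<in> H1 \<Omega>" and \<phi>: "\<And>n. \<phi> n \<in> test_fun \<Omega>" and lim: "L2_lim sequentially M \<phi> p"
    "\<And>v. is_axis v \<Longrightarrow> L2_lim sequentially M (\<lambda>n. pd v (\<phi> n)) (weak_deriv \<Omega> v p)"
    using assms(1) unfolding H10_iff by blast
  obtain \<psi> where q: "q \<in> H1 \<Omega>" and \<psi>: "\<And>n. \<psi> n \<in> test_fun \<Omega>" and lim': "L2_lim sequentially M \<psi> q"
    "\<And>v. is_axis v \<Longrightarrow> L2_lim sequentially M (\<lambda>n. pd v (\<psi> n)) (weak_deriv \<Omega> v q)"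
    using assms(2) unfolding H10_iff by blast
  have s: "smooth (\<phi> n)" "smooth (\<psi> n)" for n using \<phi> \<psi> test_fun_smooth by blast+
  show ?thesis unfolding H10_iff
  proof (intro conjI exI allI impI)
    show "(\<lambda>x. p x - q x) \<in> H1 \<Omega>" by (rule H1_diff[OF p q])
    show "(\<lambda>x. \<phi> n x - \<psi> n x) \<in> test_fun \<Omega>" for n
      using test_fun_add[OF \<phi> test_fun_mult[OF \<psi> smooth_const[of "-1"]]] by simp
    show "L2_lim sequentially M (\<lambda>n x. \<phi> n x - \<psi> n x) (\<lambda>x. p x - q x)" by (rule L2_lim_diff[OF lim(1) lim'(1)])
    fix v assume v: "is_axis v"
    have "L2_lim sequentially M (\<lambda>n x. pd v (\<lambda>x. \<phi> n x - \<psi> n x) x) (\<lambda>x. weak_deriv \<Omega> v p x - weak_deriv \<Omega> v q x)"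
      unfolding smooth_pd_diff[OF s] by (rule L2_lim_diff[OF lim(2)[OF v] lim'(2)[OF v]])
    then show "L2_lim sequentially M (\<lambda>n. pd v (\<lambda>x. \<phi> n x - \<psi> n x)) (weak_deriv \<Omega> v (\<lambda>x. p x - q x))"
    proof (rule L2_lim_cong_AE)
      show "weak_deriv \<Omega> v (\<lambda>x. p x - q x) \<in> L2 M" by (intro H1_weak_L2 H1_diff p q v)
      show "AE x in M. weak_deriv \<Omega> v (\<lambda>x. p x - q x) x = weak_deriv \<Omega> v p x - weak_deriv \<Omega> v q x"
        by (intro weak_deriv_diff p q v)
      have "pd v (\<lambda>x. \<phi> n x - \<psi> n x) \<in> L2 M" for n by (intro L2_box_smooth smooth_pd smooth_diff s v)
      then show "\<forall>\<^sub>F n in sequentially. pd v (\<lambda>x. \<phi> n x - \<psi> n x) \<in> L2 M \<and>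
          (AE x in M. pd v (\<lambda>x. \<phi> n x - \<psi> n x) x = pd v (\<lambda>x. \<phi> n x - \<psi> n x) x)" by simp
    qed
  qed
qed

lemma H10_divide: "p \<in> H10 \<Omega> \<Longrightarrow> (\<lambda>x. p x / c) \<in> H10 \<Omega>"
  using H10_scale[of p "inverse c"] by (simp add: field_simps)

text \<open>
  For a test function in place of \<open>p\<close> this is the definition of the weak derivative; both sides are
  continuous in \<open>p\<close> with respect to the norm of \<open>H\<^sup>1\<close>.
\<close>

lemma weak_integration_by_parts:
  assumes "has_weak_deriv \<Omega> v f g" "p \<in> H10 \<Omega>" "is_axis v"
  shows "ip M f (weak_deriv \<Omega> v p) = - ip M g p"
proof -
  note L = has_weak_deriv_L2[OF assms(1)]
  obtain \<phi> where \<phi>: "\<And>n. \<phi> n \<in> test_fun \<Omega>" and lim: "L2_lim sequentially M \<phi> p"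
    "L2_lim sequentially M (\<lambda>n. pd v (\<phi> n)) (weak_deriv \<Omega> v p)"
    using assms(2,3) unfolding H10_iff by blast
  have "(\<lambda>n. ip M f (pd v (\<phi> n))) \<longlonglongrightarrow> ip M f (weak_deriv \<Omega> v p)"
    by (rule L2_lim_ip[OF L2_lim_const[OF L(1)] lim(2)])
  moreover have "ip M f (pd v (\<phi> n)) = - ip M g (\<phi> n)" for n
    using assms(1) \<phi> by (simp add: has_weak_deriv_iff_ip)
  moreover have "(\<lambda>n. - ip M g (\<phi> n)) \<longlonglongrightarrow> - ip M g p"
    by (intro tendsto_minus L2_lim_ip[OF L2_lim_const[OF L(2)] lim(1)])
  ultimately show ?thesis using LIMSEQ_unique by simp
qed

text \<open>
  Formally, \<open>D (h |p|\<^sup>2) = |p|\<^sup>2 + 2 Re (p h cnj (D p))\<close> integrates to 0 because \<open>p\<close> vanishes on the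
  boundary.
\<close>

lemma opp_dist_identity:
  assumes "p \<in> H10 \<Omega>"
  shows "Re (ip M p (\<lambda>x. opp_dist a b S x * weak_deriv \<Omega> (side_axis S) p x)) = - (L2_norm M p)\<^sup>2 / 2"
proof -
  let ?v = "side_axis S" and ?h = "opp_dist a b S"
  note p = H10_H1[OF assms]
  note L = H1_L2[OF p] H1_weak_L2[OF p axis_side(1)[of S]]
  have Lh: "(\<lambda>x. ?h x * weak_deriv \<Omega> ?v p x) \<in> L2 M"
    by (intro L2_mult_continuous L smooth_continuous opp_dist_smooth)
  have "has_weak_deriv \<Omega> ?v (\<lambda>x. ?h x * p x) (\<lambda>x. p x + ?h x * weak_deriv \<Omega> ?v p x)"
    using has_weak_deriv_mult_smooth[OF H1D[OF p axis_side(1)[of S]] opp_dist_smooth[of a b S] axis_side(1)]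
    by (simp add: opp_dist_pd_axis)
  from weak_integration_by_parts[OF this assms axis_side(1)]
  have "ip M (\<lambda>x. ?h x * p x) (weak_deriv \<Omega> ?v p) = - ip M p p - ip M (\<lambda>x. ?h x * weak_deriv \<Omega> ?v p x) p"
    by (simp add: ip_add_left L Lh)
  moreover have "ip M (\<lambda>x. ?h x * p x) (weak_deriv \<Omega> ?v p) = ip M p (\<lambda>x. ?h x * weak_deriv \<Omega> ?v p x)"
    by (simp add: ip_def opp_dist_real mult_ac)
  ultimately have "Re (ip M p (\<lambda>x. ?h x * weak_deriv \<Omega> ?v p x)) = - Re (ip M p p) - Re (ip M (\<lambda>x. ?h x * weak_deriv \<Omega> ?v p x) p)"
    by simp
  then show ?thesis
    using Re_ip_sym[of M "\<lambda>x. ?h x * weak_deriv \<Omega> ?v p x" p] Re_ip_self[of M p] by simp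
qed

lemma opp_dist_norm_le:
  assumes "f \<in> L2 M"
  shows "L2_norm M (\<lambda>x. opp_dist a b S x * f x) \<le> side_depth a b S * L2_norm M f"
proof (rule power2_le_imp_le)
  let ?l = "side_depth a b S" and ?h = "opp_dist a b S"
  show "0 \<le> ?l * L2_norm M f" using side_depth_pos[OF a_pos b_pos, of S] by simp
  have "(LINT x|M. (cmod (?h x * f x))\<^sup>2) \<le> (LINT x|M. ?l\<^sup>2 * (cmod (f x))\<^sup>2)"
  proof (rule integral_mono)
    show "integrable M (\<lambda>x. (cmod (?h x * f x))\<^sup>2)"
      by (intro L2_integrable_square L2_mult_continuous assms smooth_continuous opp_dist_smooth)
    show "integrable M (\<lambda>x. ?l\<^sup>2 * (cmod (f x))\<^sup>2)"
      by (intro integrable_mult_right L2_integrable_square assms)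
    fix x assume "x \<in> space M"
    then have "(cmod (?h x))\<^sup>2 \<le> ?l\<^sup>2" by (intro power_mono opp_dist_le) auto
    then show "(cmod (?h x * f x))\<^sup>2 \<le> ?l\<^sup>2 * (cmod (f x))\<^sup>2"
      by (simp add: norm_mult power_mult_distrib mult_right_mono)
  qed
  then show "(L2_norm M (\<lambda>x. ?h x * f x))\<^sup>2 \<le> (?l * L2_norm M f)\<^sup>2"
    by (simp add: L2_norm_power2 power_mult_distrib)
qed

text \<open>
  The preceding identity and the Cauchy-Schwarz inequality, as the multiplier is at most the depth of
  the rectangle. Only the derivative normal to the side enters, which is essential later: it is the
  one that the observation controls.
\<close>

lemma poincare:
  assumes "p \<in> H10 \<Omega>"
  shows "L2_norm M p \<le> 2 * side_depth a b S * L2_norm M (weak_deriv \<Omega> (side_axis S) p)"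
proof -
  note p = H10_H1[OF assms]
  note L = H1_L2[OF p] H1_weak_L2[OF p axis_side(1)[of S]]
  have Lh: "(\<lambda>x. opp_dist a b S x * weak_deriv \<Omega> (side_axis S) p x) \<in> L2 M"
    by (intro L2_mult_continuous L smooth_continuous opp_dist_smooth)
  have "(L2_norm M p)\<^sup>2 \<le> 2 * (L2_norm M p * L2_norm M (\<lambda>x. opp_dist a b S x * weak_deriv \<Omega> (side_axis S) p x))"
    using opp_dist_identity[OF assms, of S] Re_ip_le[OF L(1) Lh] by linarith
  also have "\<dots> \<le> 2 * (L2_norm M p * (side_depth a b S * L2_norm M (weak_deriv \<Omega> (side_axis S) p)))"
    by (intro mult_left_mono opp_dist_norm_le L) auto
  finally have *: "L2_norm M p * L2_norm M p \<le> (2 * side_depth a b S * L2_norm M (weak_deriv \<Omega> (side_axis S) p)) * L2_norm M p"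
    by (simp add: power2_eq_square mult_ac)
  show ?thesis
  proof (cases "L2_norm M p = 0")
    case True
    then show ?thesis using side_depth_pos[OF a_pos b_pos, of S] by simp
  next
    case False
    then have "0 < L2_norm M p" using L2_norm_nonneg[of M p] by linarith
    then show ?thesis using * by simp
  qed
qed

lemma H2_H1: "u \<in> H2 \<Omega> \<Longrightarrow> u \<in> H1 \<Omega>"
  and H2_weak_H1: "u \<in> H2 \<Omega> \<Longrightarrow> is_axis v \<Longrightarrow> weak_deriv \<Omega> v u \<in> H1 \<Omega>"
  by (auto simp: H2_def is_axis_def)

lemma laplacian_L2: "u \<in> H2 \<Omega> \<Longrightarrow> laplacian \<Omega> u \<in> L2 M"
  unfolding laplacian_def by (intro L2_add H1_weak_L2 H2_weak_H1) auto

text \<open>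
  The boundary term vanishes because \<open>p\<close> is a limit of test functions; no trace of \<open>u\<close> is involved.
\<close>

lemma green:
  assumes "u \<in> H2 \<Omega>" "p \<in> H10 \<Omega>"
  shows "ip M (weak_dx \<Omega> u) (weak_dx \<Omega> p) + ip M (weak_dy \<Omega> u) (weak_dy \<Omega> p) = - ip M (laplacian \<Omega> u) p"
proof -
  have "ip M (weak_deriv \<Omega> v u) (weak_deriv \<Omega> v p) = - ip M (weak_deriv \<Omega> v (weak_deriv \<Omega> v u)) p" if "is_axis v" for v
    by (rule weak_integration_by_parts[OF H1D[OF H2_weak_H1[OF assms(1)]] assms(2)]) (rule that)+
  note * = this[OF axis_simps(1)] this[OF axis_simps(2)]
  have "weak_deriv \<Omega> v (weak_deriv \<Omega> v u) \<in> L2 M" if "is_axis v" for v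
    by (intro H1_weak_L2 H2_weak_H1[OF assms(1)] that)
  from this[OF axis_simps(1)] this[OF axis_simps(2)] have
    "ip M (laplacian \<Omega> u) p = ip M (weak_dx \<Omega> (weak_dx \<Omega> u)) p + ip M (weak_dy \<Omega> (weak_dy \<Omega> u)) p"
    unfolding laplacian_def by (rule ip_add_left[OF _ _ H1_L2[OF H10_H1[OF assms(2)]]])
  with * show ?thesis by simp
qed

lemma H2_diff:
  assumes "f \<in> H2 \<Omega>" "g \<in> H2 \<Omega>"
  shows "(\<lambda>x. f x - g x) \<in> H2 \<Omega>"
    "is_axis v \<Longrightarrow> is_axis w \<Longrightarrow> AE x in M. weak_deriv \<Omega> v (weak_deriv \<Omega> w (\<lambda>x. f x - g x)) x =
      weak_deriv \<Omega> v (weak_deriv \<Omega> w f) x - weak_deriv \<Omega> v (weak_deriv \<Omega> w g) x"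
    "AE x in M. laplacian \<Omega> (\<lambda>x. f x - g x) x = laplacian \<Omega> f x - laplacian \<Omega> g x"
proof -
  note f = H2_H1[OF assms(1)] H2_weak_H1[OF assms(1)] and g = H2_H1[OF assms(2)] H2_weak_H1[OF assms(2)]
  note d = H1_diff[OF f(1) g(1)]
  have *: "weak_deriv \<Omega> w (\<lambda>x. f x - g x) \<in> H1 \<Omega>" and
    **: "is_axis v \<Longrightarrow> AE x in M. weak_deriv \<Omega> v (weak_deriv \<Omega> w (\<lambda>x. f x - g x)) x =
      weak_deriv \<Omega> v (weak_deriv \<Omega> w f) x - weak_deriv \<Omega> v (weak_deriv \<Omega> w g) x" if w: "is_axis w" for v w
  proof -
    have ae: "AE x in M. weak_deriv \<Omega> w f x - weak_deriv \<Omega> w g x = weak_deriv \<Omega> w (\<lambda>x. f x - g x) x"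
      using weak_deriv_diff[OF f(1) g(1) w] by auto
    note 1 = H1_cong_AE[OF H1_diff[OF f(2)[OF w] g(2)[OF w]] H1_weak_L2[OF d w] ae]
    show "weak_deriv \<Omega> w (\<lambda>x. f x - g x) \<in> H1 \<Omega>" by (rule 1(1))
    assume v: "is_axis v"
    from 1(2)[OF v] weak_deriv_diff[OF f(2)[OF w] g(2)[OF w] v]
    show "AE x in M. weak_deriv \<Omega> v (weak_deriv \<Omega> w (\<lambda>x. f x - g x)) x =
      weak_deriv \<Omega> v (weak_deriv \<Omega> w f) x - weak_deriv \<Omega> v (weak_deriv \<Omega> w g) x"
      by eventually_elim simp
  qed
  show "(\<lambda>x. f x - g x) \<in> H2 \<Omega>" unfolding H2_def using d * by simp
  show "is_axis v \<Longrightarrow> is_axis w \<Longrightarrow> AE x in M. weak_deriv \<Omega> v (weak_deriv \<Omega> w (\<lambda>x. f x - g x)) x =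
      weak_deriv \<Omega> v (weak_deriv \<Omega> w f) x - weak_deriv \<Omega> v (weak_deriv \<Omega> w g) x" using ** by blast
  show "AE x in M. laplacian \<Omega> (\<lambda>x. f x - g x) x = laplacian \<Omega> f x - laplacian \<Omega> g x"
    using **[OF axis_simps(1) axis_simps(1)] **[OF axis_simps(2) axis_simps(2)]
    by eventually_elim (simp add: laplacian_def)
qed

end

section \<open>Trigonometric polynomials\<close>

text \<open>
  A class of functions that is closed under partial derivatives and in which mixed partial derivatives
  are computed, hence seen to commute, explicitly. All identities with boundary terms are first proved
  for its members.
\<close>

inductive_set trig :: "field2 set" where
  base: "(\<lambda>z. complex_of_real (sin (r * fst z + s)) * complex_of_real (sin (q * snd z + t))) \<in> trig"
| add: "F \<in> trig \<Longrightarrow> G \<in> trig \<Longrightarrow> (\<lambda>z. F z + G z) \<in> trig"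
| scale: "F \<in> trig \<Longrightarrow> (\<lambda>z. c * F z) \<in> trig"

lemma
  assumes "bounded_linear p"
  shows smooth_sin: "smooth (\<lambda>z. complex_of_real (sin (r * p z + s)))"
    and pd_sin: "pd v (\<lambda>z. complex_of_real (sin (r * p z + s))) z = of_real (p v * r) * of_real (sin (r * p z + (s + pi / 2)))"
proof -
  define P where "P n x = complex_of_real (r ^ n) * complex_of_real (sin (r * x + s + real n * (pi / 2)))" for n x
  have P: "(P n has_vector_derivative P (Suc n) x) (at x)" for n x
    unfolding P_def
  proof (rule derivatives_affine[where P="\<lambda>n x. complex_of_real (sin (x + real n * (pi / 2)))"])
    fix n x
    have "((\<lambda>x. sin (x + real n * (pi / 2))) has_real_derivative cos (x + real n * (pi / 2))) (at x)"
      by (auto intro!: derivative_eq_intros)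
    moreover have "cos (x + real n * (pi / 2)) = sin (x + real (Suc n) * (pi / 2))"
      using sin_add[of "x + real n * (pi / 2)" "pi / 2"] by (simp add: algebra_simps add_divide_distrib)
    ultimately show "((\<lambda>x. complex_of_real (sin (x + real n * (pi / 2)))) has_vector_derivative
        complex_of_real (sin (x + real (Suc n) * (pi / 2)))) (at x)"
      by (intro has_vector_derivative_of_real) (simp add: has_real_derivative_iff_has_vector_derivative)
  qed
  have P0: "P 0 x = complex_of_real (sin (r * x + s))"
    and P1: "P (Suc 0) x = of_real r * complex_of_real (sin (r * x + (s + pi / 2)))" for x
    by (simp_all add: P_def add.assoc)
  note c = coordinate_function_smooth[where P=P, OF P assms, of 0, unfolded P0 P1]
  show "smooth (\<lambda>z. complex_of_real (sin (r * p z + s)))" by (rule c(1))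
  show "pd v (\<lambda>z. complex_of_real (sin (r * p z + s))) z = of_real (p v * r) * of_real (sin (r * p z + (s + pi / 2)))"
    using c(2)[of z v] by (simp add: scaleR_conv_of_real)
qed

lemmas sin_affine_smooth = smooth_sin[OF bounded_linear_fst] smooth_sin[OF bounded_linear_snd]
  pd_sin[OF bounded_linear_fst] pd_sin[OF bounded_linear_snd]

lemma pd_trig_base:
  "pd v (\<lambda>z. complex_of_real (sin (r * fst z + s)) * complex_of_real (sin (q * snd z + t))) =
    (\<lambda>z. of_real (fst v * r) * (complex_of_real (sin (r * fst z + (s + pi / 2))) * complex_of_real (sin (q * snd z + t)))
       + of_real (snd v * q) * (complex_of_real (sin (r * fst z + s)) * complex_of_real (sin (q * snd z + (t + pi / 2)))))"
  by (rule ext, subst smooth_pd_mult[OF sin_affine_smooth(1) sin_affine_smooth(2)])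
     (simp only: sin_affine_smooth(3,4), simp add: algebra_simps)

lemma trig_smooth: "F \<in> trig \<Longrightarrow> smooth F"
  by (induction rule: trig.induct) (intro smooth_add smooth_mult smooth_const sin_affine_smooth | assumption)+

lemma trig_pd: "F \<in> trig \<Longrightarrow> pd v F \<in> trig"
proof (induction rule: trig.induct)
  case (base r s q t)
  show ?case unfolding pd_trig_base by (intro trig.intros)
next
  case (add F G)
  then show ?case by (simp add: smooth_pd_add[OF trig_smooth trig_smooth] trig.add)
next
  case (scale F c)
  then show ?case by (simp add: smooth_pd_scale[OF trig_smooth] trig.scale)
qed

lemma trig_pd_commute: "F \<in> trig \<Longrightarrow> pd v (pd w F) = pd w (pd v F)"
proof (induction rule: trig.induct)
  case (base r s q t)
  have s: "smooth (\<lambda>z. complex_of_real (sin (r * fst z + s)) * complex_of_real (sin (q * snd z + t)))" for r s q t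
    by (rule trig_smooth[OF trig.base])
  have lin: "pd v (\<lambda>z. c * F z + d * G z) z = c * pd v F z + d * pd v G z"
    if "smooth F" "smooth G" for F G c d v z
    using that by (simp add: smooth_pd_add smooth_pd_scale smooth_mult smooth_const)
  show ?case
    unfolding pd_trig_base
    by (rule ext, simp only: lin[OF s s] pd_trig_base[THEN fun_cong]) (simp add: algebra_simps)
next
  case (add F G)
  show ?case
    unfolding smooth_pd_add[OF trig_smooth trig_smooth, OF add(1,2)]
      smooth_pd_add[OF trig_smooth trig_smooth, OF trig_pd trig_pd, OF add(1,2)]
    using add(3,4) by metis
next
  case (scale F c)
  show ?case
    unfolding smooth_pd_scale[OF trig_smooth[OF scale(1)]] smooth_pd_scale[OF trig_smooth[OF trig_pd[OF scale(1)]]]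
    using scale(2) by metis
qed

lemma trig_zero: "(\<lambda>z. 0) \<in> trig"
  using trig.scale[OF trig.base, of 0] by simp

lemma trig_sum: "(\<And>i. i \<in> A \<Longrightarrow> F i \<in> trig) \<Longrightarrow> (\<lambda>z. \<Sum>i\<in>A. F i z) \<in> trig"
  by (induction A rule: infinite_finite_induct) (auto intro: trig.add trig_zero)

lemma trig_diff: "F \<in> trig \<Longrightarrow> G \<in> trig \<Longrightarrow> (\<lambda>z. F z - G z) \<in> trig"
  using trig.add[of F "\<lambda>z. -1 * G z"] trig.scale[of G "-1"] by simp

lemma pd_eq_0_along_line:
  assumes "smooth F" "\<And>t. F (z + t *\<^sub>R v) = 0" shows "pd v F z = 0"
  using vector_derivative_unique_at[OF smooth_line_derivative[OF assms(1), of z v 0 UNIV, unfolded assms(2)]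
      has_vector_derivative_const] by simp

text \<open>
  A function that vanishes at the ends of \<open>[0, L]\<close> and is Lipschitz is dominated by \<open>min x (L - x)\<close>.
  Its product with the derivative of the cutoff is therefore bounded uniformly in \<open>n\<close>, although that
  derivative is of the order \<open>n\<close>.
\<close>

lemma cutoff_deriv_bounds:
  assumes "0 < n" "0 \<le> x" "x \<le> L"
  shows "\<bar>min x (L - x) * cutoff_deriv 0 L n x\<bar> \<le> 4"
    and "0 < n * x - 1 \<Longrightarrow> 0 < n * (L - x) - 1 \<Longrightarrow>
      \<bar>min x (L - x) * cutoff_deriv 0 L n x\<bar> \<le> n * x / (n * x - 1)\<^sup>2 + n * (L - x) / (n * (L - x) - 1)\<^sup>2"
proof -
  let ?A = "n * x * flat_deriv 1 (n * x - 1)" and ?B = "n * (L - x) * flat_deriv 1 (n * (L - x) - 1)"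
  let ?m = "min x (L - x)"
  have "\<bar>?m * cutoff_deriv 0 L n x\<bar> =
      \<bar>?m * (n * flat_deriv 1 (n * x - 1)) * flat (n * (L - x) - 1) - ?m * (n * flat_deriv 1 (n * (L - x) - 1)) * flat (n * x - 1)\<bar>"
    by (simp add: cutoff_deriv_def algebra_simps)
  also have "\<dots> \<le> \<bar>?m * (n * flat_deriv 1 (n * x - 1)) * flat (n * (L - x) - 1)\<bar> + \<bar>?m * (n * flat_deriv 1 (n * (L - x) - 1)) * flat (n * x - 1)\<bar>"
    by (rule abs_triangle_ineq4)
  also have "\<dots> \<le> \<bar>?m * (n * flat_deriv 1 (n * x - 1))\<bar> + \<bar>?m * (n * flat_deriv 1 (n * (L - x) - 1))\<bar>"
    using flat_bounds by (intro add_mono) (auto simp: abs_mult intro!: mult_left_le)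
  also have "\<dots> \<le> \<bar>?A\<bar> + \<bar>?B\<bar>"
  proof (intro add_mono)
    have "0 \<le> ?m" "?m \<le> x" "?m \<le> L - x" using assms by auto
    then show "\<bar>?m * (n * flat_deriv 1 (n * x - 1))\<bar> \<le> \<bar>?A\<bar>" "\<bar>?m * (n * flat_deriv 1 (n * (L - x) - 1))\<bar> \<le> \<bar>?B\<bar>"
      using mult_right_mono[of ?m x "n * \<bar>flat_deriv 1 (n * x - 1)\<bar>"]
        mult_right_mono[of ?m "L - x" "n * \<bar>flat_deriv 1 (n * (L - x) - 1)\<bar>"] assms
      by (auto simp: abs_mult mult_ac)
  qed
  finally have *: "\<bar>?m * cutoff_deriv 0 L n x\<bar> \<le> \<bar>?A\<bar> + \<bar>?B\<bar>" .
  have "\<bar>?A\<bar> \<le> 2" "\<bar>?B\<bar> \<le> 2"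
    using flat_derivative_bound(1)[of "n * x - 1"] flat_derivative_bound(1)[of "n * (L - x) - 1"] by simp_all
  with * show "\<bar>min x (L - x) * cutoff_deriv 0 L n x\<bar> \<le> 4" by linarith
  assume p: "0 < n * x - 1" "0 < n * (L - x) - 1"
  have "\<bar>?A\<bar> \<le> n * x / (n * x - 1)\<^sup>2" "\<bar>?B\<bar> \<le> n * (L - x) / (n * (L - x) - 1)\<^sup>2"
    using flat_derivative_bound(2)[OF p(1)] flat_derivative_bound(2)[OF p(2)] by simp_all
  with * show "\<bar>min x (L - x) * cutoff_deriv 0 L n x\<bar> \<le> n * x / (n * x - 1)\<^sup>2 + n * (L - x) / (n * (L - x) - 1)\<^sup>2"
    by linarith
qed

lemma cutoff_deriv_tendsto:
  assumes "0 < x" "x < L"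
  shows "(\<lambda>n. cutoff_deriv 0 L (real n) x) \<longlonglongrightarrow> 0"
proof -
  let ?m = "min x (L - x)"
  let ?b = "\<lambda>n. real n * x / (real n * x - 1)\<^sup>2 + real n * (L - x) / (real n * (L - x) - 1)\<^sup>2"
  have lim: "filterlim (\<lambda>n. real n * y) at_top sequentially" if "0 < y" for y
    by (rule filterlim_at_top_mult_tendsto_pos[OF tendsto_const that filterlim_real_sequentially])
  have s: "((\<lambda>s::real. s / (s - 1)\<^sup>2) \<longlongrightarrow> 0) at_top" by real_asymp
  have b0: "?b \<longlonglongrightarrow> 0 + 0"
    by (intro tendsto_add filterlim_compose[OF s lim]) (use assms in auto)
  have ev: "\<forall>\<^sub>F n in sequentially. norm (?m * cutoff_deriv 0 L (real n) x) \<le> ?b n"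
  proof -
    have "\<forall>\<^sub>F n in sequentially. 1 < real n * x" "\<forall>\<^sub>F n in sequentially. 1 < real n * (L - x)"
      using lim assms by (auto simp: filterlim_at_top_dense)
    with eventually_gt_at_top[of 0] show ?thesis
    proof eventually_elim
      case (elim n)
      then show ?case using cutoff_deriv_bounds(2)[of "real n" x L] assms by simp
    qed
  qed
  have "(\<lambda>n. ?m * cutoff_deriv 0 L (real n) x) \<longlonglongrightarrow> 0"
    by (rule Lim_null_comparison[OF ev b0[unfolded add_0_right]])
  then have "(\<lambda>n. inverse ?m * (?m * cutoff_deriv 0 L (real n) x)) \<longlonglongrightarrow> inverse ?m * 0"
    by (intro tendsto_mult tendsto_const)
  moreover have "inverse ?m * (?m * c) = c" for c using assms by (simp add: min_def)
  ultimately show ?thesis by simp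
qed

context rectangle
begin

text \<open>
  The functions vanish on the entire lines that contain the sides, and not only on the sides. Then
  their derivatives along these lines vanish up to and including the corners.
\<close>

definition dirichlet_trig :: "field2 set" where
  "dirichlet_trig = {F \<in> trig. (\<forall>y. F (0, y) = 0 \<and> F (a * pi, y) = 0) \<and> (\<forall>x. F (x, 0) = 0 \<and> F (x, b * pi) = 0)}"

lemma dirichlet_trig_smooth: "F \<in> dirichlet_trig \<Longrightarrow> smooth F"
  by (simp add: dirichlet_trig_def trig_smooth)

lemma dirichlet_trig_diff: "F \<in> dirichlet_trig \<Longrightarrow> G \<in> dirichlet_trig \<Longrightarrow> (\<lambda>z. F z - G z) \<in> dirichlet_trig"
  by (simp add: dirichlet_trig_def trig_diff)

lemma dirichlet_trig_sum: "(\<And>i. i \<in> A \<Longrightarrow> F i \<in> dirichlet_trig) \<Longrightarrow> (\<lambda>z. \<Sum>i\<in>A. c i * F i z) \<in> dirichlet_trig"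
  by (simp add: dirichlet_trig_def trig_sum trig.scale)

text \<open>
  Lipschitz continuity on the closed rectangle, applied on the segments that are perpendicular to the
  sides.
\<close>

lemma dirichlet_trig_boundary_bound:
  assumes "F \<in> dirichlet_trig"
  obtains C where "0 \<le> C" "\<And>x y. (x, y) \<in> \<Omega> \<Longrightarrow> cmod (F (x, y)) \<le> C * min x (a * pi - x)"
    "\<And>x y. (x, y) \<in> \<Omega> \<Longrightarrow> cmod (F (x, y)) \<le> C * min y (b * pi - y)"
proof -
  note s = dirichlet_trig_smooth[OF assms]
  have der: "(F has_derivative frechet_derivative F (at z)) (at z within A)" for z A
    using smooth_has_derivative[OF s] by (rule has_derivative_at_withinI)
  let ?Q = "cbox (0, 0) (a * pi, b * pi)"
  obtain B1 where B1: "0 \<le> B1" "\<And>z. z \<in> ?Q \<Longrightarrow> cmod (pd (1, 0) F z) \<le> B1"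
    by (rule continuous_bounded_box[OF smooth_continuous[OF smooth_pd[OF s axis_simps(1)]]]) auto
  obtain B2 where B2: "0 \<le> B2" "\<And>z. z \<in> ?Q \<Longrightarrow> cmod (pd (0, 1) F z) \<le> B2"
    by (rule continuous_bounded_box[OF smooth_continuous[OF smooth_pd[OF s axis_simps(2)]]]) auto
  have on: "onorm (frechet_derivative F (at z)) \<le> B1 + B2" if "z \<in> ?Q" for z
  proof (rule onorm_bound)
    fix h :: plane
    note lin = linear_frechet_derivative[OF smooth_differentiable[OF s, of z]]
    have "h = fst h *\<^sub>R (1, 0) + snd h *\<^sub>R (0, 1)" by (simp add: prod_eq_iff)
    then have "frechet_derivative F (at z) h = fst h *\<^sub>R pd (1, 0) F z + snd h *\<^sub>R pd (0, 1) F z"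
      by (metis linear_add[OF lin] linear_scale[OF lin])
    then have "norm (frechet_derivative F (at z) h) \<le> \<bar>fst h\<bar> * norm (pd (1, 0) F z) + \<bar>snd h\<bar> * norm (pd (0, 1) F z)"
      using norm_triangle_ineq[of "fst h *\<^sub>R pd (1, 0) F z" "snd h *\<^sub>R pd (0, 1) F z"] by simp
    also have "\<dots> \<le> norm h * B1 + norm h * B2"
      using B1(2)[OF that] B2(2)[OF that] norm_fst_le[of "fst h" "snd h"] norm_snd_le[of "snd h" "fst h"]
      by (intro add_mono mult_mono) auto
    finally show "norm (frechet_derivative F (at z) h) \<le> (B1 + B2) * norm h" by (simp add: algebra_simps)
  qed (use B1 B2 in simp)
  have lip: "cmod (F z - F w) \<le> (B1 + B2) * norm (z - w)" if "z \<in> ?Q" "w \<in> ?Q" for z w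
    by (rule differentiable_bound[OF convex_box(1) der on]) (use that in auto)
  have near: "cmod (F z) \<le> (B1 + B2) * norm (z - w)" if "z \<in> ?Q" "w \<in> ?Q" "F w = 0" for z w
    using lip[OF that(1,2)] that(3) by simp
  have bd: "F (0, y) = 0" "F (a * pi, y) = 0" "F (x, 0) = 0" "F (x, b * pi) = 0" for x y
    using assms by (auto simp: dirichlet_trig_def)
  show thesis
  proof (rule that[of "B1 + B2"])
    fix x y assume z: "(x, y) \<in> \<Omega>"
    then have Q: "(x, y) \<in> ?Q" "(0, y) \<in> ?Q" "(a * pi, y) \<in> ?Q" "(x, 0) \<in> ?Q" "(x, b * pi) \<in> ?Q"
      using a_pos b_pos by (auto simp: rect_def cbox_Pair_eq)
    show "cmod (F (x, y)) \<le> (B1 + B2) * min x (a * pi - x)"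
      using near[OF Q(1,2) bd(1)] near[OF Q(1,3) bd(2)] z by (auto simp: rect_def norm_Pair min_def)
    show "cmod (F (x, y)) \<le> (B1 + B2) * min y (b * pi - y)"
      using near[OF Q(1,4) bd(3)] near[OF Q(1,5) bd(4)] z by (auto simp: rect_def norm_Pair min_def)
  qed (use B1 B2 in simp)
qed


text \<open>
  Bounded convergence on a set of finite measure. The bound is demanded for positive \<open>n\<close> only, because
  the cutoffs are controlled for positive \<open>n\<close> only.
\<close>

lemma L2_lim_dominated:
  assumes m: "\<And>n. u n \<in> borel_measurable M" and f: "f \<in> borel_measurable M"
    and conv: "\<And>x. x \<in> \<Omega> \<Longrightarrow> (\<lambda>n. u n x) \<longlonglongrightarrow> f x"
    and bound: "\<And>n x. 0 < n \<Longrightarrow> x \<in> \<Omega> \<Longrightarrow> cmod (u n x) \<le> B"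
  shows "L2_lim sequentially M u f"
proof -
  have fb: "cmod (f x) \<le> B" if "x \<in> \<Omega>" for x
    by (rule LIMSEQ_le_const2[OF tendsto_norm[OF conv[OF that]]]) (use bound[OF _ that] in \<open>auto intro!: exI[of _ 1]\<close>)
  have "(\<lambda>n. LINT x|M. (cmod (u (Suc n) x - f x))\<^sup>2) \<longlonglongrightarrow> (LINT x|M. 0)"
  proof (rule integral_dominated_convergence)
    show "integrable M (\<lambda>x. (2 * B)\<^sup>2)"
      using finite_measure.integrable_const[OF finite_measure_box] .
    show "(\<lambda>x. (cmod (u (Suc n) x - f x))\<^sup>2) \<in> borel_measurable M" for n
      using m[of "Suc n"] f by measurable
    show "AE x in M. (\<lambda>n. (cmod (u (Suc n) x - f x))\<^sup>2) \<longlonglongrightarrow> 0"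
    proof (rule AE_I2)
      fix x assume "x \<in> space M"
      then have "(\<lambda>n. (cmod (u (Suc n) x - f x))\<^sup>2) \<longlonglongrightarrow> (cmod (f x - f x))\<^sup>2"
        by (intro tendsto_intros LIMSEQ_Suc conv) simp
      then show "(\<lambda>n. (cmod (u (Suc n) x - f x))\<^sup>2) \<longlonglongrightarrow> 0" by simp
    qed
    show "AE x in M. norm ((cmod (u (Suc n) x - f x))\<^sup>2) \<le> (2 * B)\<^sup>2" for n
    proof (rule AE_I2)
      fix x assume "x \<in> space M"
      then have "cmod (u (Suc n) x - f x) \<le> 2 * B"
        using bound[of "Suc n" x] fb[of x] norm_triangle_ineq4[of "u (Suc n) x" "f x"] by simp
      from power_mono[OF this norm_ge_zero, of 2] show "norm ((cmod (u (Suc n) x - f x))\<^sup>2) \<le> (2 * B)\<^sup>2" by simp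
    qed
  qed simp
  then have "(\<lambda>n. sqrt (LINT x|M. (cmod (u (Suc n) x - f x))\<^sup>2)) \<longlonglongrightarrow> sqrt 0"
    by (intro tendsto_real_sqrt) simp
  then have "(\<lambda>n. L2_norm M (\<lambda>x. u (Suc n) x - f x)) \<longlonglongrightarrow> 0" by (simp add: L2_norm_def)
  then have "(\<lambda>n. L2_norm M (\<lambda>x. u n x - f x)) \<longlonglongrightarrow> 0" by (rule LIMSEQ_imp_Suc)
  moreover have "\<forall>\<^sub>F n in sequentially. u n \<in> L2 M"
    using eventually_gt_at_top[of 0] by eventually_elim (rule L2_box_bounded[OF m bound])
  ultimately show ?thesis using L2_box_bounded[OF f fb] by (simp add: L2_lim_def)
qed

text \<open>
  Multiply by cutoffs. In the derivative of the product the terms with a differentiated cutoff are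
  bounded and tend to 0 pointwise, because \<open>F\<close> is of the order of the distance to the boundary.
\<close>

lemma dirichlet_trig_H10:
  assumes "F \<in> dirichlet_trig"
  shows "F \<in> H10 \<Omega>"
proof -
  note s = dirichlet_trig_smooth[OF assms]
  obtain C where C: "0 \<le> C" "\<And>x y. (x, y) \<in> \<Omega> \<Longrightarrow> cmod (F (x, y)) \<le> C * min x (a * pi - x)"
    "\<And>x y. (x, y) \<in> \<Omega> \<Longrightarrow> cmod (F (x, y)) \<le> C * min y (b * pi - y)"
    using dirichlet_trig_boundary_bound[OF assms] by blast
  obtain D where D: "\<And>z. z \<in> \<Omega> \<Longrightarrow> cmod (F z) \<le> D"
    by (rule continuous_bounded_box[OF smooth_continuous[OF s], of a b]) auto
  define X where "X n = (\<lambda>z::plane. complex_of_real (cutoff 0 (a * pi) (real n) (fst z)))" for n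
  define Y where "Y n = (\<lambda>z::plane. complex_of_real (cutoff 0 (b * pi) (real n) (snd z)))" for n
  define \<phi> where "\<phi> n = (\<lambda>z. F z * (X n z * Y n z))" for n
  have sXY: "smooth (X n)" "smooth (Y n)" "smooth (\<phi> n)" for n
    unfolding \<phi>_def X_def Y_def by (intro smooth_mult cutoff_smooth s)+
  have t: "\<phi> (Suc n) \<in> test_fun \<Omega>" for n
    unfolding \<phi>_def X_def Y_def by (rule cutoff_test_fun[OF s]) (auto simp: rect_def)
  have Xb: "cmod (X n z) \<le> 1" and Yb: "cmod (Y n z) \<le> 1" for n z
    unfolding X_def Y_def using cutoff_bounds by (simp_all add: abs_le_iff)
  have Xl: "(\<lambda>n. X n z) \<longlonglongrightarrow> 1" and Yl: "(\<lambda>n. Y n z) \<longlonglongrightarrow> 1" if "z \<in> \<Omega>" for z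
    using that tendsto_of_real[OF cutoff_tendsto[of 0 "fst z" "a * pi"], where ?'a=complex]
      tendsto_of_real[OF cutoff_tendsto[of 0 "snd z" "b * pi"], where ?'a=complex]
    unfolding X_def Y_def by (auto simp: rect_def)
  have lim: "L2_lim sequentially M \<phi> F"
  proof (rule L2_lim_dominated)
    show "\<phi> n \<in> borel_measurable M" for n by (intro continuous_measurable_box smooth_continuous sXY)
    show "F \<in> borel_measurable M" by (intro continuous_measurable_box smooth_continuous s)
    show "(\<lambda>n. \<phi> n z) \<longlonglongrightarrow> F z" if "z \<in> \<Omega>" for z
      using tendsto_mult[OF tendsto_const[of "F z"] tendsto_mult[OF Xl[OF that] Yl[OF that]]] by (simp add: \<phi>_def)
    show "cmod (\<phi> n z) \<le> D" if "z \<in> \<Omega>" for n z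
      using D[OF that] mult_le_one[OF Xb norm_ge_zero Yb, of n z n z]
        mult_left_le[of "cmod (X n z) * cmod (Y n z)" "cmod (F z)"]
      by (simp add: \<phi>_def norm_mult)
  qed
  have limd: "L2_lim sequentially M (\<lambda>n. pd v (\<phi> n)) (pd v F)" if v: "is_axis v" for v
  proof -
    obtain D' where D': "\<And>z. z \<in> \<Omega> \<Longrightarrow> cmod (pd v F z) \<le> D'"
      by (rule continuous_bounded_box[OF smooth_continuous[OF smooth_pd[OF s v]], of a b]) auto
    define E where "E n z = of_real (fst v * cutoff_deriv 0 (a * pi) (real n) (fst z)) * Y n z
        + X n z * of_real (snd v * cutoff_deriv 0 (b * pi) (real n) (snd z))" for n z
    have pd: "pd v (\<phi> n) z = pd v F z * (X n z * Y n z) + F z * E n z" for n z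
      unfolding \<phi>_def smooth_pd_mult[OF s smooth_mult[OF sXY(1,2)]] smooth_pd_mult[OF sXY(1,2)] E_def
      unfolding X_def Y_def cutoff_smooth(3,4) by (simp add: algebra_simps)
    have El: "(\<lambda>n. E n z) \<longlonglongrightarrow> 0" if "z \<in> \<Omega>" for z
    proof -
      have z: "0 < fst z" "fst z < a * pi" "0 < snd z" "snd z < b * pi" using that by (auto simp: rect_def)
      have "(\<lambda>n. E n z) \<longlonglongrightarrow> of_real (fst v * 0) * 1 + 1 * of_real (snd v * 0)"
        unfolding E_def by (intro tendsto_intros Xl Yl that cutoff_deriv_tendsto z)
      then show ?thesis by simp
    qed
    have Eb: "cmod (F z * E n z) \<le> C * 4 + C * 4" if "z \<in> \<Omega>" "0 < n" for z n
    proof -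
      obtain x y where z: "z = (x, y)" by (cases z)
      have xy: "0 \<le> x" "x \<le> a * pi" "0 \<le> y" "y \<le> b * pi" using that z by (auto simp: rect_def)
      have v1: "\<bar>fst v\<bar> \<le> 1" "\<bar>snd v\<bar> \<le> 1" using v by (auto simp: is_axis_def)
      have n: "0 < real n" using that by simp
      have "cmod (F z) * \<bar>cutoff_deriv 0 (a * pi) (real n) x\<bar> \<le> C * min x (a * pi - x) * \<bar>cutoff_deriv 0 (a * pi) (real n) x\<bar>"
        using C(2) that(1) z by (intro mult_right_mono) auto
      also have "\<dots> = C * \<bar>min x (a * pi - x) * cutoff_deriv 0 (a * pi) (real n) x\<bar>"
        using xy by (simp add: abs_mult)
      also have "\<dots> \<le> C * 4" by (intro mult_left_mono cutoff_deriv_bounds(1) n xy C)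
      finally have 1: "cmod (F z) * \<bar>cutoff_deriv 0 (a * pi) (real n) x\<bar> \<le> C * 4" .
      have "cmod (F z) * \<bar>cutoff_deriv 0 (b * pi) (real n) y\<bar> \<le> C * min y (b * pi - y) * \<bar>cutoff_deriv 0 (b * pi) (real n) y\<bar>"
        using C(3) that(1) z by (intro mult_right_mono) auto
      also have "\<dots> = C * \<bar>min y (b * pi - y) * cutoff_deriv 0 (b * pi) (real n) y\<bar>"
        using xy by (simp add: abs_mult)
      also have "\<dots> \<le> C * 4" by (intro mult_left_mono cutoff_deriv_bounds(1) n xy C)
      finally have 2: "cmod (F z) * \<bar>cutoff_deriv 0 (b * pi) (real n) y\<bar> \<le> C * 4" .
      have "cmod (F z * E n z) \<le> cmod (F z) * (\<bar>fst v\<bar> * \<bar>cutoff_deriv 0 (a * pi) (real n) x\<bar> * cmod (Y n z)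
          + cmod (X n z) * (\<bar>snd v\<bar> * \<bar>cutoff_deriv 0 (b * pi) (real n) y\<bar>))"
        unfolding norm_mult E_def z
        by (intro mult_left_mono order_trans[OF norm_triangle_ineq]) (simp_all add: norm_mult abs_mult)
      also have "\<dots> \<le> cmod (F z) * (1 * \<bar>cutoff_deriv 0 (a * pi) (real n) x\<bar> * 1 + 1 * (1 * \<bar>cutoff_deriv 0 (b * pi) (real n) y\<bar>))"
        by (intro mult_left_mono add_mono mult_mono v1 Xb Yb) auto
      finally show ?thesis using 1 2 by (simp add: algebra_simps)
    qed
    show ?thesis
    proof (rule L2_lim_dominated)
      show "pd v (\<phi> n) \<in> borel_measurable M" for n by (intro continuous_measurable_box smooth_continuous smooth_pd sXY v)
      show "pd v F \<in> borel_measurable M" by (intro continuous_measurable_box smooth_continuous smooth_pd s v)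
      show "(\<lambda>n. pd v (\<phi> n) z) \<longlonglongrightarrow> pd v F z" if "z \<in> \<Omega>" for z
        using tendsto_add[OF tendsto_mult[OF tendsto_const[of "pd v F z"] tendsto_mult[OF Xl[OF that] Yl[OF that]]]
            tendsto_mult[OF tendsto_const[of "F z"] El[OF that]]] by (simp add: pd)
      show "cmod (pd v (\<phi> n) z) \<le> D' + (C * 4 + C * 4)" if "0 < n" "z \<in> \<Omega>" for n z
      proof -
        have "cmod (pd v F z * (X n z * Y n z)) \<le> D'"
          using D'[OF that(2)] mult_le_one[OF Xb norm_ge_zero Yb, of n z n z]
            mult_left_le[of "cmod (X n z) * cmod (Y n z)" "cmod (pd v F z)"]
          by (simp add: norm_mult)
        with Eb[OF that(2,1)] show ?thesis
          unfolding pd using norm_triangle_ineq[of "pd v F z * (X n z * Y n z)" "F z * E n z"] by linarith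
      qed
    qed
  qed
  have L2_lim_Suc: "L2_lim sequentially M (\<lambda>n. u (Suc n)) f" if "L2_lim sequentially M u f" for u :: "nat \<Rightarrow> field2" and f
    using that unfolding L2_lim_def by (auto simp: eventually_sequentially_Suc[of "\<lambda>n. u n \<in> L2 M"] intro: LIMSEQ_Suc)
  show ?thesis unfolding H10_iff
  proof (intro conjI exI allI impI)
    show "F \<in> H1 \<Omega>" by (rule H1_smooth[OF s])
    show "\<phi> (Suc n) \<in> test_fun \<Omega>" for n by (rule t)
    show "L2_lim sequentially M (\<lambda>n. \<phi> (Suc n)) F" by (rule L2_lim_Suc[OF lim])
    fix v assume v: "is_axis v"
    show "L2_lim sequentially M (\<lambda>n. pd v (\<phi> (Suc n))) (weak_deriv \<Omega> v F)"
    proof (rule L2_lim_cong_AE[OF L2_lim_Suc[OF limd[OF v]]])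
      show "weak_deriv \<Omega> v F \<in> L2 M" by (intro H1_weak_L2 H1_smooth s v)
      show "AE x in M. weak_deriv \<Omega> v F x = pd v F x" by (rule weak_deriv_smooth[OF s v])
      have "pd v (\<phi> (Suc n)) \<in> L2 M" for n by (intro L2_box_smooth smooth_pd sXY v)
      then show "\<forall>\<^sub>F n in sequentially. pd v (\<phi> (Suc n)) \<in> L2 M \<and> (AE x in M. pd v (\<phi> (Suc n)) x = pd v (\<phi> (Suc n)) x)"
        by simp
    qed
  qed
qed

lemma ip_dirichlet_trig_deriv:
  assumes "has_weak_deriv \<Omega> v f g" "F \<in> dirichlet_trig" "is_axis v"
  shows "ip M f (pd v F) = - ip M g F"
proof -
  note s = dirichlet_trig_smooth[OF assms(2)]
  have "ip M f (pd v F) = ip M f (weak_deriv \<Omega> v F)"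
    using weak_deriv_smooth[OF s assms(3)] has_weak_deriv_L2(1)[OF assms(1)]
    by (intro ip_cong_AE) (auto intro: H1_weak_L2 H1_smooth L2_box_smooth smooth_pd s assms)
  then show ?thesis using weak_integration_by_parts[OF assms(1) dirichlet_trig_H10[OF assms(2)] assms(3)] by simp
qed

text \<open>
  Two integrations by parts. There is no boundary term in the first one because \<open>F\<close> vanishes on the
  boundary, and none in the second one because \<open>u\<close> does.
\<close>

lemma ip_second_weak_deriv:
  assumes u: "u \<in> H2 \<Omega>" "u \<in> H10 \<Omega>" and F: "F \<in> dirichlet_trig" and v: "is_axis v"
  shows "ip M (weak_deriv \<Omega> v (weak_deriv \<Omega> v u)) F = ip M u (pd v (pd v F))"
proof -
  note s = dirichlet_trig_smooth[OF F]
  have "ip M (weak_deriv \<Omega> v u) (pd v F) = - ip M (weak_deriv \<Omega> v (weak_deriv \<Omega> v u)) F"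
    by (rule ip_dirichlet_trig_deriv[OF H1D[OF H2_weak_H1[OF u(1) v] v] F v])
  moreover have "ip M (pd v F) (weak_deriv \<Omega> v u) = - ip M (pd v (pd v F)) u"
    by (rule weak_integration_by_parts[OF has_weak_deriv_smooth[OF smooth_pd[OF s v] v] u(2) v])
  then have "ip M (weak_deriv \<Omega> v u) (pd v F) = - ip M u (pd v (pd v F))"
    using ip_cnj by (metis complex_cnj_minus)
  ultimately show ?thesis by simp
qed

lemma dirichlet_trig_norm_deriv:
  assumes F: "F \<in> dirichlet_trig" and v: "is_axis v"
  shows "(L2_norm M (pd v F))\<^sup>2 \<le> L2_norm M F * L2_norm M (pd v (pd v F))"
proof -
  note s = dirichlet_trig_smooth[OF F]
  have "ip M (pd v F) (pd v F) = - ip M (pd v (pd v F)) F"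
    by (rule ip_dirichlet_trig_deriv[OF has_weak_deriv_smooth[OF smooth_pd[OF s v] v] F v])
  then have "(L2_norm M (pd v F))\<^sup>2 = - Re (ip M (pd v (pd v F)) F)" by (simp flip: Re_ip_self)
  also have "\<dots> \<le> L2_norm M (pd v (pd v F)) * L2_norm M F"
    using Re_ip_le[of "pd v (pd v F)" M F] L2_box_smooth[OF smooth_pd[OF smooth_pd[OF s v] v]] L2_box_smooth[OF s]
    by simp
  finally show ?thesis by (simp add: mult.commute)
qed


text \<open>
  For functions that are smooth up to the boundary it suffices that the product vanishes on the two
  sides perpendicular to \<open>v\<close>.
\<close>

lemma ip_pd_vanishing_boundary:
  assumes "smooth P" "smooth Q" "is_axis v"
    and "v = (1, 0) \<Longrightarrow> (\<forall>y. P (0, y) * Q (0, y) = 0 \<and> P (a * pi, y) * Q (a * pi, y) = 0)"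
    and "v = (0, 1) \<Longrightarrow> (\<forall>x. P (x, 0) * Q (x, 0) = 0 \<and> P (x, b * pi) * Q (x, b * pi) = 0)"
  shows "ip M P (pd v Q) = - ip M (pd v P) Q"
proof -
  note sc = smooth_cnj[OF assms(2)]
  have "0 = integral\<^sup>L M (pd v (\<lambda>z. P z * cnj (Q z)))"
    by (rule box_integral_pd_eq_0[OF smooth_mult[OF assms(1) sc] a_pos b_pos assms(3), symmetric])
       (use assms(4,5) in auto)
  also have "\<dots> = (LINT z|M. P z * cnj (pd v Q z) + pd v P z * cnj (Q z))"
    by (simp only: smooth_pd_mult[OF assms(1) sc] smooth_pd_cnj[OF assms(2)])
  also have "\<dots> = ip M P (pd v Q) + ip M (pd v P) Q"
    unfolding ip_def
    by (intro Bochner_Integration.integral_add L2_integrable_ip L2_box_smooth smooth_pd assms(1-3))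
  finally show ?thesis by (simp add: eq_neg_iff_add_eq_0)
qed

lemma dirichlet_trig_boundary_deriv:
  assumes "F \<in> dirichlet_trig"
  shows "pd (0, 1) F (0, y) = 0" "pd (0, 1) F (a * pi, y) = 0"
    "pd (1, 0) F (x, 0) = 0" "pd (1, 0) F (x, b * pi) = 0"
    "pd (1, 0) (pd (1, 0) F) (x, 0) = 0" "pd (1, 0) (pd (1, 0) F) (x, b * pi) = 0"
    "pd (0, 1) (pd (0, 1) F) (0, y) = 0" "pd (0, 1) (pd (0, 1) F) (a * pi, y) = 0"
proof -
  note s = dirichlet_trig_smooth[OF assms]
  have bd: "F (0, y) = 0" "F (a * pi, y) = 0" "F (x, 0) = 0" "F (x, b * pi) = 0" for x y
    using assms by (auto simp: dirichlet_trig_def)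
  show 1: "pd (0, 1) F (0, y) = 0" "pd (0, 1) F (a * pi, y) = 0"
    "pd (1, 0) F (x, 0) = 0" "pd (1, 0) F (x, b * pi) = 0" for x y
    by (rule pd_eq_0_along_line[OF s]; simp add: bd)+
  note s' = smooth_pd[OF s axis_simps(1)] smooth_pd[OF s axis_simps(2)]
  show "pd (1, 0) (pd (1, 0) F) (x, 0) = 0" "pd (1, 0) (pd (1, 0) F) (x, b * pi) = 0"
    "pd (0, 1) (pd (0, 1) F) (0, y) = 0" "pd (0, 1) (pd (0, 1) F) (a * pi, y) = 0"
    by (rule pd_eq_0_along_line[OF s'(1)] pd_eq_0_along_line[OF s'(2)]; simp add: 1)+
qed

text \<open>
  Two integrations by parts show that the squared norm of the mixed derivative is the inner product of
  the two pure second derivatives. The boundary terms contain a factor that is differentiated along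
  the side on which it vanishes.
\<close>

lemma dirichlet_trig_norm_mixed:
  assumes F: "F \<in> dirichlet_trig"
  shows "(L2_norm M (pd (1, 0) (pd (0, 1) F)))\<^sup>2 \<le> L2_norm M (pd (0, 1) (pd (0, 1) F)) * L2_norm M (pd (1, 0) (pd (1, 0) F))"
proof -
  let ?x = "(1, 0) :: plane" and ?y = "(0, 1) :: plane"
  have t: "F \<in> trig" using F by (simp add: dirichlet_trig_def)
  note s = trig_smooth trig_pd t
  have c: "pd ?x (pd ?x (pd ?y F)) = pd ?y (pd ?x (pd ?x F))"
    using trig_pd_commute[OF t, of ?x ?y] trig_pd_commute[OF trig_pd[OF t, of ?x], of ?x ?y] by simp
  have "ip M (pd ?y F) (pd ?x (pd ?x (pd ?y F))) = - ip M (pd ?x (pd ?y F)) (pd ?x (pd ?y F))"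
    by (rule ip_pd_vanishing_boundary) (use dirichlet_trig_boundary_deriv[OF F] in \<open>auto intro: s\<close>)
  moreover have "ip M (pd ?y F) (pd ?y (pd ?x (pd ?x F))) = - ip M (pd ?y (pd ?y F)) (pd ?x (pd ?x F))"
    by (rule ip_pd_vanishing_boundary) (use dirichlet_trig_boundary_deriv[OF F] in \<open>auto intro: s\<close>)
  ultimately have "ip M (pd ?x (pd ?y F)) (pd ?x (pd ?y F)) = ip M (pd ?y (pd ?y F)) (pd ?x (pd ?x F))"
    by (simp add: c)
  then have "(L2_norm M (pd ?x (pd ?y F)))\<^sup>2 = Re (ip M (pd ?y (pd ?y F)) (pd ?x (pd ?x F)))"
    by (simp flip: Re_ip_self)
  also have "\<dots> \<le> L2_norm M (pd ?y (pd ?y F)) * L2_norm M (pd ?x (pd ?x F))"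
    by (rule order_trans[OF abs_ge_self Re_ip_le]) (intro L2_box_smooth s)+
  finally show ?thesis .
qed

section \<open>Completeness of the sine system\<close>

text \<open>
  The Dirichlet eigenfunctions of the rectangle. The indices start at 0, where the function is zero.
\<close>

definition sine :: "nat \<times> nat \<Rightarrow> field2" where
  "sine i = (\<lambda>z. complex_of_real (sin (real (fst i) / a * fst z)) * complex_of_real (sin (real (snd i) / b * snd z)))"

definition sine_eigenvalue :: "plane \<Rightarrow> nat \<times> nat \<Rightarrow> real" where
  "sine_eigenvalue v i = (fst v * (real (fst i) / a))\<^sup>2 + (snd v * (real (snd i) / b))\<^sup>2"

lemma sine_dirichlet_trig: "sine i \<in> dirichlet_trig"
proof -
  have "sin (real j / c * (c * pi)) = 0" if "0 < c" for j :: nat and c :: real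
    using that by simp
  then show ?thesis
    using trig.base[of "real (fst i) / a" 0 "real (snd i) / b" 0] a_pos b_pos
    by (auto simp: dirichlet_trig_def sine_def)
qed

lemmas sine_smooth = dirichlet_trig_smooth[OF sine_dirichlet_trig]

lemma sine_pd2:
  assumes "is_axis v"
  shows "pd v (pd v (sine i)) = (\<lambda>z. complex_of_real (- sine_eigenvalue v i) * sine i z)"
proof
  fix z
  define r where "r = real (fst i) / a"
  define q where "q = real (snd i) / b"
  have s: "smooth (\<lambda>z. complex_of_real (sin (r * fst z + s)) * complex_of_real (sin (q * snd z + t)))" for r s q t
    by (rule trig_smooth[OF trig.base])
  have lin: "pd v (\<lambda>z. c * F z + d * G z) z = c * pd v F z + d * pd v G z"
    if "smooth F" "smooth G" for F G c d v z
    using that by (simp add: smooth_pd_add smooth_pd_scale smooth_mult smooth_const)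
  have e: "sine i = (\<lambda>z. complex_of_real (sin (r * fst z + 0)) * complex_of_real (sin (q * snd z + 0)))"
    by (simp add: sine_def r_def q_def)
  have sp: "sin (x + (0 + pi / 2 + pi / 2)) = - sin x" for x :: real by simp
  have v: "fst v = 0 \<or> snd v = 0" using assms by (auto simp: is_axis_def)
  show "pd v (pd v (sine i)) z = complex_of_real (- sine_eigenvalue v i) * sine i z"
    unfolding e pd_trig_base
    by (simp only: lin[OF s s] pd_trig_base[THEN fun_cong] sp sine_eigenvalue_def r_def[symmetric] q_def[symmetric])
       (use v in \<open>auto simp: power2_eq_square algebra_simps\<close>)
qed

text \<open>
  The second derivative is symmetric on functions that vanish on the boundary, and \<open>sine i\<close> is an
  eigenfunction of it.
\<close>

lemma ip_sine_pd2:
  assumes "is_axis v" "F \<in> dirichlet_trig"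
  shows "ip M (pd v (pd v F)) (sine i) = - of_real (sine_eigenvalue v i) * ip M F (sine i)"
proof -
  note s = dirichlet_trig_smooth[OF assms(2)]
  have "ip M (pd v F) (pd v (sine i)) = - ip M (pd v (pd v F)) (sine i)"
    by (rule ip_dirichlet_trig_deriv[OF has_weak_deriv_smooth[OF smooth_pd[OF s assms(1)] assms(1)] sine_dirichlet_trig assms(1)])
  moreover have "ip M (pd v (sine i)) (pd v F) = - ip M (pd v (pd v (sine i))) F"
    by (rule ip_dirichlet_trig_deriv[OF has_weak_deriv_smooth[OF smooth_pd[OF sine_smooth assms(1)] assms(1)] assms(2,1)])
  then have "ip M (pd v F) (pd v (sine i)) = - ip M F (pd v (pd v (sine i)))"
    using ip_cnj by (metis complex_cnj_minus)
  ultimately show ?thesis unfolding sine_pd2[OF assms(1)] ip_scale_right by simp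
qed

text \<open>
  Different indices have different eigenvalues for at least one of the two second derivatives.
\<close>

lemma sine_orthogonal:
  assumes "i \<noteq> i'"
  shows "ip M (sine i) (sine i') = 0"
proof -
  have *: "sine_eigenvalue v i = sine_eigenvalue v i'" if "is_axis v" "ip M (sine i) (sine i') \<noteq> 0" for v
    using ip_sine_pd2[OF that(1) sine_dirichlet_trig, of i i'] that(2)
    unfolding sine_pd2[OF that(1)] ip_scale_left by simp
  show ?thesis
  proof (rule ccontr)
    assume n: "ip M (sine i) (sine i') \<noteq> 0"
    have "real (fst i) / a = real (fst i') / a" "real (snd i) / b = real (snd i') / b"
      using *[OF axis_simps(1) n] *[OF axis_simps(2) n] a_pos b_pos
      by (auto simp: sine_eigenvalue_def power2_eq_iff_nonneg)
    then show False using assms a_pos b_pos by (simp add: prod_eq_iff)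
  qed
qed

text \<open>
  The product formula \<open>2 sin (j t) cos t = sin ((j + 1) t) + sin ((j - 1) t)\<close>: multiplication by a cosine
  preserves the orthogonality to all sine functions.
\<close>

lemma ip_sine_cos:
  assumes h: "h \<in> L2 M" "\<And>i. ip M h (sine i) = 0"
  shows "ip M (\<lambda>z. complex_of_real (cos (fst z / a)) * h z) (sine i) = 0"
    "ip M (\<lambda>z. complex_of_real (cos (snd z / b)) * h z) (sine i) = 0"
proof -
  obtain j k where i: "i = (j, k)" by (cases i)
  have pc': "sin (real j * t) * cos t = (sin (real (Suc j) * t) + sin (real (j - 1) * t)) / 2" if "j \<noteq> 0" for j :: nat and t :: real
  proof -
    have "real (Suc j) * t = real j * t + t" "real (j - 1) * t = real j * t - t"
      using that by (simp_all add: algebra_simps of_nat_diff)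
    then show ?thesis by (simp only: sin_add sin_diff) simp
  qed
  have pc: "complex_of_real (sin (real j / c * t)) * complex_of_real (cos (t / c)) =
      (complex_of_real (sin (real (Suc j) / c * t)) + complex_of_real (sin (real (j - 1) / c * t))) / 2"
    if "j \<noteq> 0" for j :: nat and t c :: real
    using arg_cong[OF pc'[OF that, of "t / c"], of complex_of_real]
    by (simp only: of_real_mult of_real_add of_real_divide of_real_numeral times_divide_eq_left times_divide_eq_right)
  have L: "sine i \<in> L2 M" for i by (rule L2_box_smooth[OF sine_smooth])
  have half: "(\<lambda>z. (sine i z + sine i' z) / 2) = (\<lambda>z. (1/2) * (sine i z + sine i' z))" for i i' by auto
  have z: "ip M h (\<lambda>z. (sine i z + sine i' z) / 2) = 0" for i i'
    unfolding half ip_scale_right by (simp add: ip_add_right L h)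
  have "ip M (\<lambda>z. complex_of_real (cos (fst z / a)) * h z) (sine i) = ip M h (\<lambda>z. complex_of_real (cos (fst z / a)) * sine i z)"
    by (simp add: ip_def mult_ac)
  also have "\<dots> = 0"
  proof (cases "j = 0")
    case True
    then show ?thesis by (simp add: ip_def i sine_def)
  next
    case False
    have "(\<lambda>z. complex_of_real (cos (fst z / a)) * sine i z) = (\<lambda>z. (sine (Suc j, k) z + sine (j - 1, k) z) / 2)"
    proof
      fix z
      show "complex_of_real (cos (fst z / a)) * sine i z = (sine (Suc j, k) z + sine (j - 1, k) z) / 2"
        using pc[OF False, of a "fst z"]
        unfolding i sine_def fst_conv snd_conv by algebra
    qed
    then show ?thesis using z by simp
  qed
  finally show "ip M (\<lambda>z. complex_of_real (cos (fst z / a)) * h z) (sine i) = 0" .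
  have "ip M (\<lambda>z. complex_of_real (cos (snd z / b)) * h z) (sine i) = ip M h (\<lambda>z. complex_of_real (cos (snd z / b)) * sine i z)"
    by (simp add: ip_def mult_ac)
  also have "\<dots> = 0"
  proof (cases "k = 0")
    case True
    then show ?thesis by (simp add: ip_def i sine_def)
  next
    case False
    have "(\<lambda>z. complex_of_real (cos (snd z / b)) * sine i z) = (\<lambda>z. (sine (j, Suc k) z + sine (j, k - 1) z) / 2)"
    proof
      fix z
      show "complex_of_real (cos (snd z / b)) * sine i z = (sine (j, Suc k) z + sine (j, k - 1) z) / 2"
        using pc[OF False, of b "snd z"]
        unfolding i sine_def fst_conv snd_conv by algebra
    qed
    then show ?thesis using z by simp
  qed
  finally show "ip M (\<lambda>z. complex_of_real (cos (snd z / b)) * h z) (sine i) = 0" .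
qed

text \<open>
  The continuous multipliers that preserve the orthogonality to all sine functions form an algebra. It
  contains the constants and the two cosines, which separate the points of the closed rectangle. By
  the Stone-Weierstrass theorem it is uniformly dense in the continuous functions.
\<close>

lemma ip_sine_continuous:
  fixes G :: "plane \<Rightarrow> real"
  assumes h: "h \<in> L2 M" "\<And>i. ip M h (sine i) = 0" and G: "continuous_on UNIV G"
  shows "ip M (\<lambda>z. complex_of_real (G z) * h z) (sine i) = 0"
proof -
  define K where "K = {h \<in> L2 M. \<forall>i. ip M h (sine i) = 0}"
  define P where "P g \<longleftrightarrow> continuous_on UNIV g \<and> (\<forall>h\<in>K. (\<lambda>z. complex_of_real (g z) * h z) \<in> K)" for g :: "plane \<Rightarrow> real"
  have mem: "(\<lambda>z. complex_of_real (g z) * h z) \<in> L2 M" if "continuous_on UNIV g" "h \<in> L2 M" for g h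
    using that by (intro L2_mult_continuous) (auto intro: continuous_intros)
  let ?S = "cbox (0, 0) (a * pi, b * pi)"
  have SW: "\<exists>g. P g \<and> (\<forall>x\<in>?S. \<bar>G x - g x\<bar> < e)" if "0 < e" for e
  proof (rule Stone_Weierstrass_HOL)
    show "compact ?S" by simp
    show "P (\<lambda>x. c)" for c by (auto simp: P_def K_def ip_scale_left L2_scale)
    show "continuous_on ?S f" if "P f" for f using that by (auto simp: P_def intro: continuous_on_subset)
    show "P (\<lambda>x. f x + g x)" if "P f \<and> P g" for f g
      unfolding P_def
    proof (intro conjI ballI)
      show "continuous_on UNIV (\<lambda>x. f x + g x)" using that by (auto simp: P_def intro: continuous_intros)
      fix h assume h: "h \<in> K"
      then have "(\<lambda>z. complex_of_real (f z) * h z) \<in> K" "(\<lambda>z. complex_of_real (g z) * h z) \<in> K"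
        using that by (auto simp: P_def)
      then show "(\<lambda>z. complex_of_real (f z + g z) * h z) \<in> K"
        by (auto simp: K_def distrib_right ip_add_left L2_add L2_box_smooth[OF sine_smooth])
    qed
    show "P (\<lambda>x. f x * g x)" if "P f \<and> P g" for f g
      unfolding P_def
    proof (intro conjI ballI)
      show "continuous_on UNIV (\<lambda>x. f x * g x)" using that by (auto simp: P_def intro: continuous_intros)
      fix h assume h: "h \<in> K"
      then have "(\<lambda>z. complex_of_real (g z) * h z) \<in> K" using that by (auto simp: P_def)
      then have "(\<lambda>z. complex_of_real (f z) * (complex_of_real (g z) * h z)) \<in> K" using that by (auto simp: P_def)
      then show "(\<lambda>z. complex_of_real (f z * g z) * h z) \<in> K" by (simp add: mult.assoc)
    qed
    show "\<exists>f. P f \<and> f x \<noteq> f y" if "x \<in> ?S \<and> y \<in> ?S \<and> x \<noteq> y" for x y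
    proof -
      have c: "continuous_on UNIV (\<lambda>z::plane. cos (fst z / a))" "continuous_on UNIV (\<lambda>z::plane. cos (snd z / b))"
        using a_pos b_pos by (auto intro!: continuous_intros)
      have P1: "P (\<lambda>z. cos (fst z / a))" and P2: "P (\<lambda>z. cos (snd z / b))"
        unfolding P_def K_def using c mem ip_sine_cos by auto
      have inj: "s = t" if "cos (s / c) = cos (t / c)" "0 \<le> s" "s \<le> c * pi" "0 \<le> t" "t \<le> c * pi" "0 < c" for s t c :: real
        using cos_inj_pi[of "s / c" "t / c"] that by (simp add: field_simps)
      show ?thesis
      proof (cases "fst x = fst y")
        case False
        then have "cos (fst x / a) \<noteq> cos (fst y / a)"
          using inj[of "fst x" a "fst y"] that a_pos by (auto simp: cbox_Pair_eq)
        with P1 show ?thesis by blast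
      next
        case True
        then have "snd x \<noteq> snd y" using that by (simp add: prod_eq_iff)
        then have "cos (snd x / b) \<noteq> cos (snd y / b)"
          using inj[of "snd x" b "snd y"] that b_pos by (auto simp: cbox_Pair_eq)
        with P2 show ?thesis by blast
      qed
    qed
    show "continuous_on ?S G" using G by (rule continuous_on_subset) simp
  qed (rule that)
  define C where "C = (LINT z|M. cmod (h z * cnj (sine i z)))"
  have int: "integrable M (\<lambda>z. h z * cnj (sine i z))" by (intro L2_integrable_ip h L2_box_smooth sine_smooth)
  have "cmod (ip M (\<lambda>z. complex_of_real (G z) * h z) (sine i)) \<le> e * C" if e: "0 < e" for e
  proof -
    obtain g where g: "P g" "\<And>x. x \<in> ?S \<Longrightarrow> \<bar>G x - g x\<bar> < e" using SW[OF e] by blast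
    have "ip M (\<lambda>z. complex_of_real (g z) * h z) (sine i) = 0"
    proof -
      have "h \<in> K" using h by (simp add: K_def)
      with g(1) have "(\<lambda>z. complex_of_real (g z) * h z) \<in> K" unfolding P_def by blast
      then show ?thesis unfolding K_def by blast
    qed
    then have "ip M (\<lambda>z. complex_of_real (G z) * h z) (sine i) =
        ip M (\<lambda>z. complex_of_real (G z) * h z - complex_of_real (g z) * h z) (sine i)"
      using g(1) ip_diff_left[OF mem[OF G h(1)] mem[OF _ h(1)] L2_box_smooth[OF sine_smooth], of g i]
      by (simp add: P_def)
    also have "\<dots> = (LINT z|M. complex_of_real (G z - g z) * (h z * cnj (sine i z)))"
      by (simp add: ip_def algebra_simps)
    also have "cmod \<dots> \<le> (LINT z|M. cmod (complex_of_real (G z - g z) * (h z * cnj (sine i z))))"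
      by (rule integral_norm_bound)
    also have "\<dots> \<le> (LINT z|M. e * cmod (h z * cnj (sine i z)))"
    proof (rule integral_mono)
      have "integrable M (\<lambda>z. (complex_of_real (G z - g z) * h z) * cnj (sine i z))"
        using g(1) by (intro L2_integrable_ip mem h L2_box_smooth sine_smooth) (auto intro!: continuous_intros G simp: P_def)
      then show "integrable M (\<lambda>z. cmod (complex_of_real (G z - g z) * (h z * cnj (sine i z))))"
        by (intro integrable_norm) (simp add: mult.assoc)
      show "integrable M (\<lambda>z. e * cmod (h z * cnj (sine i z)))" by (intro integrable_mult_right integrable_norm int)
      fix z assume "z \<in> space M"
      then have "\<bar>G z - g z\<bar> \<le> e"
        using g(2)[of z] box_subset_cbox[of "(0, 0)" "(a * pi, b * pi)"] by (auto simp: rect_eq_box intro: less_imp_le)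
      then show "cmod (complex_of_real (G z - g z) * (h z * cnj (sine i z))) \<le> e * cmod (h z * cnj (sine i z))"
        unfolding norm_mult[of "complex_of_real (G z - g z)"] norm_of_real by (intro mult_right_mono) auto
    qed
    finally show ?thesis by (simp add: C_def)
  qed
  note * = this
  have C: "0 \<le> C" by (simp add: C_def)
  have "cmod (ip M (\<lambda>z. complex_of_real (G z) * h z) (sine i)) \<le> 0 + e" if "0 < e" for e
  proof -
    have "e / (C + 1) * C \<le> e" using C that by (simp add: field_simps)
    with *[of "e / (C + 1)"] C that show ?thesis by simp
  qed
  then have "cmod (ip M (\<lambda>z. complex_of_real (G z) * h z) (sine i)) \<le> 0" using field_le_epsilon by blast
  then show ?thesis by simp
qed

text \<open>
  The product of \<open>h\<close> with the first eigenfunction, which has no zero in the rectangle, is orthogonal to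
  all continuous functions and in particular to all test functions.
\<close>

lemma sine_complete:
  assumes h: "h \<in> L2 M" "\<And>i. ip M h (sine i) = 0"
  shows "AE x in M. h x = 0"
proof -
  let ?e = "sine (1, 1)"
  have L: "(\<lambda>z. ?e z * h z) \<in> L2 M"
    by (intro L2_mult_continuous h smooth_continuous sine_smooth)
  have ecnj: "cnj (?e z) = ?e z" for z by (simp add: sine_def)
  have "AE x in M. ?e x * h x = 0"
  proof (rule fundamental_lemma[OF L])
    fix \<phi> assume "\<phi> \<in> test_fun \<Omega>"
    then have c: "continuous_on UNIV \<phi>" by (intro smooth_continuous test_fun_smooth)
    have R: "ip M (\<lambda>z. complex_of_real (Re (\<phi> z)) * h z) ?e = 0" "ip M (\<lambda>z. complex_of_real (Im (\<phi> z)) * h z) ?e = 0"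
      by (intro ip_sine_continuous h continuous_intros c)+
    have LR: "(\<lambda>z. complex_of_real (Re (\<phi> z)) * h z) \<in> L2 M" "(\<lambda>z. complex_of_real (Im (\<phi> z)) * h z) \<in> L2 M"
      by (intro L2_mult_continuous h continuous_intros c)+
    have cn: "cnj w = complex_of_real (Re w) - \<i> * complex_of_real (Im w)" for w by (simp add: complex_eq_iff)
    have "ip M (\<lambda>z. ?e z * h z) \<phi> = ip M (\<lambda>z. complex_of_real (Re (\<phi> z)) * h z - \<i> * (complex_of_real (Im (\<phi> z)) * h z)) ?e"
      unfolding ip_def ecnj cn[of "\<phi> _"] by (intro Bochner_Integration.integral_cong refl) (simp add: algebra_simps)
    also have "\<dots> = 0"
      using R ip_diff_left[OF LR(1) L2_scale[OF LR(2)] L2_box_smooth[OF sine_smooth], of "\<i>" "(1, 1)"]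
      by (simp add: ip_scale_left)
    finally show "ip M (\<lambda>z. ?e z * h z) \<phi> = 0" .
  qed
  then show ?thesis
  proof (rule AE_mp, intro AE_I2 impI)
    fix z assume z: "z \<in> space M" "?e z * h z = 0"
    have "sin (t / c) \<noteq> 0" if "0 < t" "t < c * pi" "0 < c" for t c :: real
      using sin_gt_zero[of "t / c"] that by (simp add: field_simps)
    then have "?e z \<noteq> 0" using z(1) a_pos b_pos by (auto simp: sine_def rect_def)
    with z(2) show "h z = 0" by simp
  qed
qed


text \<open>
  The limit that the Riesz-Fischer theorem provides has the same coefficients as \<open>f\<close>; by completeness
  of the system it is \<open>f\<close>.
\<close>

lemma sine_expansion:
  assumes f: "f \<in> L2 M"
  shows "L2_lim sequentially M (\<lambda>n z. \<Sum>i\<in>{..n} \<times> {..n}. ip M f (sine i) / ip M (sine i) (sine i) * sine i z) f"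
proof -
  let ?A = "\<lambda>n::nat. {..n} \<times> {..n}"
  have L: "sine i \<in> L2 M" for i by (rule L2_box_smooth[OF sine_smooth])
  have "mono ?A" "\<And>n. finite (?A n)" by (auto simp: mono_def)
  from riesz_fischer[where e=sine and A="?A", OF f L sine_orthogonal this refl] obtain g where
    g: "L2_lim sequentially M (\<lambda>n z. \<Sum>i\<in>?A n. ip M f (sine i) / ip M (sine i) (sine i) * sine i z) g"
    and gi: "\<forall>i\<in>(\<Union>n. ?A n). ip M g (sine i) = ip M f (sine i)" by blast
  have iA: "i \<in> (\<Union>n. ?A n)" for i
  proof (rule UN_I[OF UNIV_I])
    show "i \<in> ?A (max (fst i) (snd i))" by (cases i) simp
  qed
  have gi: "ip M g (sine i) = ip M f (sine i)" for i by (rule bspec[OF gi iA])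
  note gL = L2_limD(1)[OF g]
  have "AE x in M. f x - g x = 0"
    by (rule sine_complete) (auto intro: L2_diff f gL simp: ip_diff_left[OF f gL L] gi)
  then have "AE x in M. f x = g x" by simp
  then show ?thesis
    using L2_limD(2)[OF g] by (intro L2_lim_cong_AE[OF g _ f]) (auto elim: eventually_mono)
qed

end

lemma L2_lim_Cauchy:
  assumes "L2_lim sequentially M u f" "\<And>n. u n \<in> L2 M" "0 < e"
  shows "\<exists>N::nat. \<forall>m\<ge>N. \<forall>n\<ge>N. L2_norm M (\<lambda>x. u m x - u n x) < e"
proof -
  note f = L2_limD(1)[OF assms(1)]
  obtain N where N: "\<And>n. n \<ge> N \<Longrightarrow> L2_norm M (\<lambda>x. u n x - f x) < e / 2"
    using LIMSEQ_D[OF L2_limD(3)[OF assms(1)], of "e / 2"] assms(3) by auto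
  have "L2_norm M (\<lambda>x. u m x - u n x) < e" if "m \<ge> N" "n \<ge> N" for m n
    using L2_norm_triangle_diff[OF assms(2)[of m] f assms(2)[of n]] N[OF that(1)] N[OF that(2)]
      L2_norm_diff_commute[of M f "u n"] by linarith
  then show ?thesis by blast
qed

context rectangle
begin

text \<open>
  The limit of \<open>G\<close> exists by completeness and is the weak derivative of \<open>f\<close> by closedness.
\<close>

lemma weak_deriv_closed:
  fixes F G :: "nat \<Rightarrow> field2"
  assumes FG: "\<And>n. has_weak_deriv \<Omega> v (F n) (G n)" and F: "L2_lim sequentially M F f"
    and G: "\<And>e. 0 < e \<Longrightarrow> \<exists>N::nat. \<forall>m\<ge>N. \<forall>n\<ge>N. L2_norm M (\<lambda>x. G m x - G n x) < e"
    and v: "is_axis v"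
  shows "L2_lim sequentially M G (weak_deriv \<Omega> v f)"
proof -
  have GL: "G n \<in> L2 M" for n by (rule has_weak_deriv_L2(2)[OF FG])
  obtain g where g: "L2_lim sequentially M G g" using L2_complete[OF GL G] by blast
  have "has_weak_deriv \<Omega> v f g" by (rule has_weak_deriv_limit[OF F g _ sequentially_bot v]) (simp add: FG)
  from weak_deriv_eq[OF this] show ?thesis
    using GL by (intro L2_lim_cong_AE[OF g]) (auto intro: has_weak_deriv_L2)
qed

text \<open>
  For \<open>u\<close> in the domain of the Laplacian the pure second derivatives of the partial sums of \<open>u\<close> are the
  partial sums of the pure second derivatives of \<open>u\<close>, so that they converge. The first and the mixed
  derivatives of a difference of partial sums are controlled by its pure second derivatives and its
  norm; hence they converge too, and closedness identifies the limits.
\<close>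

lemma sine_approximation:
  assumes "u \<in> dom_laplacian \<Omega>"
  obtains S :: "nat \<Rightarrow> field2" where "\<And>n. S n \<in> dirichlet_trig" "L2_lim sequentially M S u"
    "\<And>v. is_axis v \<Longrightarrow> L2_lim sequentially M (\<lambda>n. pd v (S n)) (weak_deriv \<Omega> v u)"
    "\<And>v w. is_axis v \<Longrightarrow> is_axis w \<Longrightarrow>
      L2_lim sequentially M (\<lambda>n. pd w (pd v (S n))) (weak_deriv \<Omega> w (weak_deriv \<Omega> v u))"
proof -
  have u: "u \<in> H2 \<Omega>" "u \<in> H10 \<Omega>" using assms by (auto simp: dom_laplacian_def)
  note uL = H1_L2[OF H2_H1[OF u(1)]]
  define c where "c f i = ip M f (sine i) / ip M (sine i) (sine i)" for f i
  define S where "S = (\<lambda>n::nat. \<lambda>z. \<Sum>i\<in>{..n} \<times> {..n}. c u i * sine i z)"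
  have Sd: "S n \<in> dirichlet_trig" for n unfolding S_def by (intro dirichlet_trig_sum sine_dirichlet_trig)
  note Ss = dirichlet_trig_smooth[OF Sd]
  have SL: "S n \<in> L2 M" for n by (rule L2_box_smooth[OF Ss])
  have S0: "L2_lim sequentially M S u" using sine_expansion[OF uL] unfolding S_def c_def .
  have S2: "L2_lim sequentially M (\<lambda>n. pd v (pd v (S n))) (weak_deriv \<Omega> v (weak_deriv \<Omega> v u))" if v: "is_axis v" for v
  proof -
    have L: "weak_deriv \<Omega> v (weak_deriv \<Omega> v u) \<in> L2 M" by (intro H1_weak_L2 H2_weak_H1 u v)
    have ss: "smooth (\<lambda>z. k * sine i z)" "smooth (\<lambda>z. k * pd v (sine i) z)" for k i
      by (intro smooth_mult smooth_const smooth_pd sine_smooth v)+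
    have "pd v (pd v (S n)) = (\<lambda>z. \<Sum>i\<in>{..n} \<times> {..n}. c u i * pd v (pd v (sine i)) z)" for n
      unfolding S_def by (simp only: smooth_pd_sum[OF ss(1)] smooth_pd_scale[OF sine_smooth] smooth_pd_sum[OF ss(2)]
          smooth_pd_scale[OF smooth_pd[OF sine_smooth v]])
    moreover have "c u i * pd v (pd v (sine i)) z = c (weak_deriv \<Omega> v (weak_deriv \<Omega> v u)) i * sine i z" for i z
      unfolding c_def ip_second_weak_deriv[OF u sine_dirichlet_trig v] sine_pd2[OF v] sine_pd2[OF v, THEN fun_cong] ip_scale_right by simp
    ultimately have "pd v (pd v (S n)) = (\<lambda>z. \<Sum>i\<in>{..n} \<times> {..n}. c (weak_deriv \<Omega> v (weak_deriv \<Omega> v u)) i * sine i z)" for n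
      by simp
    then show ?thesis using sine_expansion[OF L, folded c_def] by simp
  qed
  have diff: "(\<lambda>z. S m z - S n z) \<in> dirichlet_trig" for m n by (rule dirichlet_trig_diff[OF Sd Sd])
  have pd1: "pd v (\<lambda>z. S m z - S n z) = (\<lambda>z. pd v (S m) z - pd v (S n) z)" for m n v
    by (rule ext) (rule smooth_pd_diff[OF Ss Ss])
  have pd2: "pd w (pd v (\<lambda>z. S m z - S n z)) = (\<lambda>z. pd w (pd v (S m)) z - pd w (pd v (S n)) z)" if "is_axis v" for m n v w
    unfolding pd1 by (rule ext) (rule smooth_pd_diff[OF smooth_pd[OF Ss that] smooth_pd[OF Ss that]])
  have C0: "\<exists>N. \<forall>m\<ge>N. \<forall>n\<ge>N. L2_norm M (\<lambda>z. S m z - S n z) < e" if "0 < e" for e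
    by (rule L2_lim_Cauchy[OF S0 SL that])
  have C2: "\<exists>N. \<forall>m\<ge>N. \<forall>n\<ge>N. L2_norm M (pd v (pd v (\<lambda>z. S m z - S n z))) < e" if "0 < e" "is_axis v" for e v
    unfolding pd2[OF that(2)]
    by (rule L2_lim_Cauchy[OF S2[OF that(2)] L2_box_smooth[OF smooth_pd[OF smooth_pd[OF Ss that(2)] that(2)]] that(1)])
  have sq: "x < e" if "x\<^sup>2 \<le> y * z" "0 \<le> y" "0 \<le> z" "y < e" "z < e" for x y z e :: real
  proof (rule power2_less_imp_less)
    have "y * z < e * e" using that by (intro mult_strict_mono) auto
    then show "x\<^sup>2 < e\<^sup>2" using that(1) by (simp add: power2_eq_square)
  qed (use that in simp)
  have S1: "L2_lim sequentially M (\<lambda>n. pd v (S n)) (weak_deriv \<Omega> v u)" if v: "is_axis v" for v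
  proof (rule weak_deriv_closed[OF has_weak_deriv_smooth[OF Ss v] S0 _ v])
    fix e :: real assume e: "0 < e"
    obtain N1 N2 where "\<forall>m\<ge>N1. \<forall>n\<ge>N1. L2_norm M (\<lambda>z. S m z - S n z) < e"
      "\<forall>m\<ge>N2. \<forall>n\<ge>N2. L2_norm M (pd v (pd v (\<lambda>z. S m z - S n z))) < e"
      using C0[OF e] C2[OF e v] by blast
    then have "\<forall>m\<ge>max N1 N2. \<forall>n\<ge>max N1 N2. L2_norm M (pd v (\<lambda>z. S m z - S n z)) < e"
      by (auto intro!: sq[OF dirichlet_trig_norm_deriv[OF diff v]])
    then show "\<exists>N. \<forall>m\<ge>N. \<forall>n\<ge>N. L2_norm M (\<lambda>z. pd v (S m) z - pd v (S n) z) < e" unfolding pd1 by blast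
  qed
  have mixed: "\<exists>N. \<forall>m\<ge>N. \<forall>n\<ge>N. L2_norm M (pd (1, 0) (pd (0, 1) (\<lambda>z. S m z - S n z))) < e" if e: "0 < e" for e
  proof -
    obtain N1 N2 where "\<forall>m\<ge>N1. \<forall>n\<ge>N1. L2_norm M (pd (0, 1) (pd (0, 1) (\<lambda>z. S m z - S n z))) < e"
      "\<forall>m\<ge>N2. \<forall>n\<ge>N2. L2_norm M (pd (1, 0) (pd (1, 0) (\<lambda>z. S m z - S n z))) < e"
      using C2[OF e axis_simps(1)] C2[OF e axis_simps(2)] by blast
    then have "\<forall>m\<ge>max N1 N2. \<forall>n\<ge>max N1 N2. L2_norm M (pd (1, 0) (pd (0, 1) (\<lambda>z. S m z - S n z))) < e"
      by (auto intro!: sq[OF dirichlet_trig_norm_mixed[OF diff]])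
    then show ?thesis by blast
  qed
  have S2': "L2_lim sequentially M (\<lambda>n. pd w (pd v (S n))) (weak_deriv \<Omega> w (weak_deriv \<Omega> v u))"
    if v: "is_axis v" and w: "is_axis w" for v w
  proof (cases "v = w")
    case True
    then show ?thesis using S2[OF v] by simp
  next
    case False
    have c: "pd w (pd v (\<lambda>z. S m z - S n z)) = pd (1, 0) (pd (0, 1) (\<lambda>z. S m z - S n z))" for m n
      using v w False trig_pd_commute[of "\<lambda>z. S m z - S n z" "(0, 1)" "(1, 0)"] diff[of m n]
      by (auto simp: is_axis_def dirichlet_trig_def)
    show ?thesis
    proof (rule weak_deriv_closed[OF has_weak_deriv_smooth[OF smooth_pd[OF Ss v] w] S1[OF v] _ w])
      fix e :: real assume e: "0 < e"
      show "\<exists>N. \<forall>m\<ge>N. \<forall>n\<ge>N. L2_norm M (\<lambda>z. pd w (pd v (S m)) z - pd w (pd v (S n)) z) < e"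
        using mixed[OF e] unfolding c[symmetric] pd2[OF v] .
    qed
  qed
  show thesis by (rule that[OF Sd S0 S1 S2'])
qed

section \<open>Traces and the Rellich identity\<close>

abbreviation N :: "side \<Rightarrow> plane measure" where "N S \<equiv> side_measure a b S"

text \<open>
  The divergence theorem for the multiplier, applied to \<open>|\<phi>|\<^sup>2\<close>.
\<close>

lemma side_norm_smooth:
  assumes s: "smooth \<phi>"
  shows "side_depth a b S * (L2_norm (N S) \<phi>)\<^sup>2 =
    (L2_norm M \<phi>)\<^sup>2 + 2 * Re (ip M (pd (side_axis S) \<phi>) (\<lambda>z. opp_dist a b S z * \<phi> z))"
proof -
  let ?v = "side_axis S" and ?h = "opp_dist a b S"
  note sc = smooth_cnj[OF s]
  have sv: "smooth (pd ?v \<phi>)" by (rule smooth_pd[OF s axis_side(1)])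
  have sh: "smooth (\<lambda>z. ?h z * \<phi> z)" by (rule smooth_mult[OF opp_dist_smooth s])
  have L: "\<phi> \<in> L2 M" "pd ?v \<phi> \<in> L2 M" "(\<lambda>z. ?h z * \<phi> z) \<in> L2 M" by (intro L2_box_smooth s sv sh)+
  have "of_real (side_depth a b S) * ip (N S) \<phi> \<phi> = integral\<^sup>L M (pd ?v (\<lambda>z. ?h z * (\<phi> z * cnj (\<phi> z))))"
    unfolding ip_def by (rule box_integral_opp_dist[OF smooth_mult[OF s sc] a_pos b_pos, symmetric])
  also have "\<dots> = (LINT z|M. \<phi> z * cnj (\<phi> z) + (pd ?v \<phi> z * cnj (?h z * \<phi> z) + (?h z * \<phi> z) * cnj (pd ?v \<phi> z)))"
    by (simp only: smooth_pd_mult[OF opp_dist_smooth smooth_mult[OF s sc]] smooth_pd_mult[OF s sc] smooth_pd_cnj[OF s]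
        opp_dist_pd_axis complex_cnj_mult opp_dist_real) (simp add: algebra_simps)
  also have "\<dots> = ip M \<phi> \<phi> + (ip M (pd ?v \<phi>) (\<lambda>z. ?h z * \<phi> z) + ip M (\<lambda>z. ?h z * \<phi> z) (pd ?v \<phi>))"
    unfolding ip_def
    by (simp only: Bochner_Integration.integral_add[OF L2_integrable_ip[OF L(1,1)] Bochner_Integration.integrable_add[OF L2_integrable_ip[OF L(2,3)] L2_integrable_ip[OF L(3,2)]]]
        Bochner_Integration.integral_add[OF L2_integrable_ip[OF L(2,3)] L2_integrable_ip[OF L(3,2)]])
  finally have "of_real (side_depth a b S) * ip (N S) \<phi> \<phi> =
      ip M \<phi> \<phi> + (ip M (pd ?v \<phi>) (\<lambda>z. ?h z * \<phi> z) + ip M (\<lambda>z. ?h z * \<phi> z) (pd ?v \<phi>))" .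
  from arg_cong[OF this, of Re] show ?thesis
    using Re_ip_sym[of M "\<lambda>z. ?h z * \<phi> z" "pd ?v \<phi>"] by (simp add: Re_ip_self)
qed

text \<open>
  Both sides are continuous along the smooth functions that define the trace. Consequently the norm of
  a trace does not depend on the choice that is made in its definition.
\<close>

lemma trace_identity:
  assumes "has_trace a b S f g"
  shows "side_depth a b S * (L2_norm (N S) g)\<^sup>2 =
    (L2_norm M f)\<^sup>2 + 2 * Re (ip M (weak_deriv \<Omega> (side_axis S) f) (\<lambda>z. opp_dist a b S z * f z))"
proof -
  let ?v = "side_axis S" and ?h = "opp_dist a b S"
  obtain \<phi> :: "nat \<Rightarrow> field2" where f: "f \<in> H1 \<Omega>" and g: "g \<in> L2 (N S)" and s: "\<And>n. smooth (\<phi> n)"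
    and 1: "(\<lambda>n. H1_norm \<Omega> (\<lambda>x. \<phi> n x - f x)) \<longlonglongrightarrow> 0"
    and 2: "(\<lambda>n. L2_norm (N S) (\<lambda>x. \<phi> n x - g x)) \<longlonglongrightarrow> 0"
    using assms unfolding has_trace_def by blast
  have "\<forall>\<^sub>F n in sequentially. \<phi> n \<in> H1 \<Omega>" by (simp add: H1_smooth s)
  from H1_norm_lim_iff[OF this f] 1 have lim: "L2_lim sequentially M \<phi> f"
    "L2_lim sequentially M (\<lambda>n. weak_deriv \<Omega> ?v (\<phi> n)) (weak_deriv \<Omega> ?v f)" using axis_side(1) by blast+
  have "L2_lim sequentially M (\<lambda>n. pd ?v (\<phi> n)) (weak_deriv \<Omega> ?v f)"
  proof (rule L2_lim_cong_AE[OF lim(2)])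
    have "pd ?v (\<phi> n) \<in> L2 M" "AE x in M. pd ?v (\<phi> n) x = weak_deriv \<Omega> ?v (\<phi> n) x" for n
      using weak_deriv_smooth[OF s[of n] axis_side(1)[of S]] by (intro L2_box_smooth smooth_pd s axis_side, auto)
    then show "\<forall>\<^sub>F n in sequentially. pd ?v (\<phi> n) \<in> L2 M \<and> (AE x in M. pd ?v (\<phi> n) x = weak_deriv \<Omega> ?v (\<phi> n) x)"
      by simp
  qed (auto intro: H1_weak_L2 f)
  note r = tendsto_Re[OF L2_lim_ip[OF this L2_lim_mult_continuous[OF lim(1) smooth_continuous[OF opp_dist_smooth[of a b S]]]]]
  have "L2_lim sequentially (N S) \<phi> g"
    unfolding L2_lim_def using g 2 side_continuous(1)[OF smooth_continuous[OF s]] by simp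
  from L2_lim_norm[OF this] have "(\<lambda>n. side_depth a b S * (L2_norm (N S) (\<phi> n))\<^sup>2) \<longlonglongrightarrow> side_depth a b S * (L2_norm (N S) g)\<^sup>2"
    by (intro tendsto_intros)
  moreover have "(\<lambda>n. side_depth a b S * (L2_norm (N S) (\<phi> n))\<^sup>2) \<longlonglongrightarrow>
      (L2_norm M f)\<^sup>2 + 2 * Re (ip M (weak_deriv \<Omega> ?v f) (\<lambda>z. ?h z * f z))"
    unfolding side_norm_smooth[OF s] by (intro tendsto_intros r L2_lim_norm lim)
  ultimately show ?thesis by (rule LIMSEQ_unique)
qed

lemma side_norm_smooth_le:
  assumes "smooth \<phi>"
  shows "side_depth a b S * (L2_norm (N S) \<phi>)\<^sup>2 \<le>
    (L2_norm M \<phi>)\<^sup>2 + 2 * (L2_norm M (pd (side_axis S) \<phi>) * (side_depth a b S * L2_norm M \<phi>))"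
proof -
  let ?v = "side_axis S" and ?h = "opp_dist a b S"
  have L: "\<phi> \<in> L2 M" "pd ?v \<phi> \<in> L2 M" "(\<lambda>z. ?h z * \<phi> z) \<in> L2 M"
    by (intro L2_box_smooth smooth_pd smooth_mult opp_dist_smooth assms axis_side)+
  have "Re (ip M (pd ?v \<phi>) (\<lambda>z. ?h z * \<phi> z)) \<le> L2_norm M (pd ?v \<phi>) * L2_norm M (\<lambda>z. ?h z * \<phi> z)"
    using Re_ip_le[OF L(2,3)] by linarith
  also have "\<dots> \<le> L2_norm M (pd ?v \<phi>) * (side_depth a b S * L2_norm M \<phi>)"
    by (intro mult_left_mono opp_dist_norm_le L) simp
  finally show ?thesis using side_norm_smooth[OF assms, of S] by linarith
qed

text \<open>
  The identity for smooth functions bounds the norm on the side by the norm of \<open>H\<^sup>1\<close>, so that the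
  restrictions of an approximating sequence form a Cauchy sequence on the side.
\<close>

lemma trace_exists:
  fixes \<phi> :: "nat \<Rightarrow> field2"
  assumes f: "f \<in> H1 \<Omega>" and s: "\<And>n. smooth (\<phi> n)" and 0: "L2_lim sequentially M \<phi> f"
    and 1: "\<And>v. is_axis v \<Longrightarrow> L2_lim sequentially M (\<lambda>n. pd v (\<phi> n)) (weak_deriv \<Omega> v f)"
  shows "has_trace a b S f (trace a b S f)"
proof -
  let ?v = "side_axis S" and ?l = "side_depth a b S"
  have l: "0 < ?l" by (rule side_depth_pos[OF a_pos b_pos])
  have sL: "\<phi> n \<in> L2 (N S)" for n by (rule side_continuous(1)[OF smooth_continuous[OF s]])
  have "\<exists>g. L2_lim sequentially (N S) \<phi> g"
  proof (rule L2_complete[OF sL])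
    fix e :: real assume e: "0 < e"
    \<comment> \<open>When both norms inside the rectangle are below \<open>d\<close>, the bound on the side is \<open>(1 + 2 l) d\<^sup>2\<close>; it has to be \<open>l e\<^sup>2\<close>.\<close>
    define d where "d = e * sqrt (?l / (1 + 2 * ?l))"
    have d: "0 < d" using e l by (simp add: d_def)
    have d2: "d\<^sup>2 * (1 + 2 * ?l) = e\<^sup>2 * ?l" using l by (simp add: d_def power_mult_distrib field_simps)
    obtain N1 N2 where N: "\<forall>m\<ge>N1. \<forall>n\<ge>N1. L2_norm M (\<lambda>z. \<phi> m z - \<phi> n z) < d"
      "\<forall>m\<ge>N2. \<forall>n\<ge>N2. L2_norm M (\<lambda>z. pd ?v (\<phi> m) z - pd ?v (\<phi> n) z) < d"
      using L2_lim_Cauchy[OF 0 L2_box_smooth[OF s] d]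
        L2_lim_Cauchy[OF 1[OF axis_side(1)] L2_box_smooth[OF smooth_pd[OF s axis_side(1)]] d] by blast
    have "L2_norm (N S) (\<lambda>z. \<phi> m z - \<phi> n z) < e" if "m \<ge> max N1 N2" "n \<ge> max N1 N2" for m n
    proof (rule power2_less_imp_less)
      let ?A = "L2_norm M (\<lambda>z. \<phi> m z - \<phi> n z)" and ?B = "L2_norm M (\<lambda>z. pd ?v (\<phi> m) z - pd ?v (\<phi> n) z)"
      have AB: "?A < d" "?B < d" using N that by auto
      have "?l * (L2_norm (N S) (\<lambda>z. \<phi> m z - \<phi> n z))\<^sup>2 \<le> ?A\<^sup>2 + 2 * (?B * (?l * ?A))"
        using side_norm_smooth_le[OF smooth_diff[OF s s], of S m n] by (simp only: smooth_pd_diff[OF s s])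
      also have "\<dots> < d\<^sup>2 + 2 * (d * (?l * d))"
        using AB l d by (intro add_less_le_mono power_strict_mono mult_left_mono mult_mono) auto
      also have "\<dots> = ?l * e\<^sup>2" using d2 by (simp add: algebra_simps power2_eq_square)
      finally show "(L2_norm (N S) (\<lambda>z. \<phi> m z - \<phi> n z))\<^sup>2 < e\<^sup>2" using l by simp
    qed (use e in simp)
    then show "\<exists>N'. \<forall>m\<ge>N'. \<forall>n\<ge>N'. L2_norm (N S) (\<lambda>z. \<phi> m z - \<phi> n z) < e" by blast
  qed
  then obtain g where g: "L2_lim sequentially (N S) \<phi> g" by blast
  have H: "\<forall>\<^sub>F n in sequentially. \<phi> n \<in> H1 \<Omega>" by (simp add: H1_smooth s)
  have "L2_lim sequentially M (\<lambda>n. weak_deriv \<Omega> v (\<phi> n)) (weak_deriv \<Omega> v f)" if v: "is_axis v" for v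
  proof (rule L2_lim_cong_AE[OF 1[OF v]])
    have "weak_deriv \<Omega> v (\<phi> n) \<in> L2 M \<and> (AE x in M. weak_deriv \<Omega> v (\<phi> n) x = pd v (\<phi> n) x)" for n
      by (intro conjI H1_weak_L2 H1_smooth s v weak_deriv_smooth)
    then show "\<forall>\<^sub>F n in sequentially. weak_deriv \<Omega> v (\<phi> n) \<in> L2 M \<and> (AE x in M. weak_deriv \<Omega> v (\<phi> n) x = pd v (\<phi> n) x)"
      by simp
  qed (auto intro: H1_weak_L2 f v)
  with H1_norm_lim_iff[OF H f] 0 have "(\<lambda>n. H1_norm \<Omega> (\<lambda>x. \<phi> n x - f x)) \<longlonglongrightarrow> 0" by blast
  with f s L2_limD(1,3)[OF g] have "has_trace a b S f g" unfolding has_trace_def by blast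
  then show ?thesis unfolding trace_def using someI[of "has_trace a b S f" g] by simp
qed

text \<open>
  In the first integration by parts, in the tangential direction, \<open>D F\<close> vanishes on the two adjacent
  sides. In the second one, in the normal direction, the tangential derivative of \<open>F\<close> vanishes on the
  side and on the opposite one.
\<close>

lemma rellich_tangential:
  assumes F: "F \<in> dirichlet_trig"
  shows "2 * Re (ip M (pd (side_tangent S) (pd (side_tangent S) F)) (\<lambda>z. opp_dist a b S z * pd (side_axis S) F z)) =
    (L2_norm M (pd (side_tangent S) F))\<^sup>2"
proof -
  let ?v = "side_axis S" and ?w = "side_tangent S" and ?h = "opp_dist a b S"
  have t: "F \<in> trig" using F by (simp add: dirichlet_trig_def)
  note s = trig_smooth trig_pd t
  have sh: "smooth (\<lambda>z. ?h z * pd v F z)" for v by (intro smooth_mult opp_dist_smooth s)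
  have bd: "F (0, y) = 0" "F (a * pi, y) = 0" "F (x, 0) = 0" "F (x, b * pi) = 0" for x y
    using F by (auto simp: dirichlet_trig_def)
  have L: "pd v F \<in> L2 M" "(\<lambda>z. ?h z * pd v (pd w F) z) \<in> L2 M" for v w
    by (intro L2_box_smooth smooth_mult opp_dist_smooth s)+
  have "ip M (\<lambda>z. ?h z * pd ?v F z) (pd ?w (pd ?w F)) = - ip M (pd ?w (\<lambda>z. ?h z * pd ?v F z)) (pd ?w F)"
    by (rule ip_pd_vanishing_boundary[OF sh])
       (use dirichlet_trig_boundary_deriv[OF F] in \<open>cases S; auto intro: s\<close>)+
  also have "pd ?w (\<lambda>z. ?h z * pd ?v F z) = (\<lambda>z. ?h z * pd ?v (pd ?w F) z)"
    by (rule ext, subst smooth_pd_mult[OF opp_dist_smooth trig_smooth[OF trig_pd[OF t]]])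
       (simp add: opp_dist_pd_tangent trig_pd_commute[OF t, of ?w ?v, THEN fun_cong])
  finally have 1: "ip M (\<lambda>z. ?h z * pd ?v F z) (pd ?w (pd ?w F)) = - ip M (\<lambda>z. ?h z * pd ?v (pd ?w F) z) (pd ?w F)" .
  have "ip M (\<lambda>z. ?h z * pd ?w F z) (pd ?v (pd ?w F)) = - ip M (pd ?v (\<lambda>z. ?h z * pd ?w F z)) (pd ?w F)"
    by (rule ip_pd_vanishing_boundary[OF sh])
       (use dirichlet_trig_boundary_deriv[OF F] in \<open>cases S; auto intro: s\<close>)+
  also have "pd ?v (\<lambda>z. ?h z * pd ?w F z) = (\<lambda>z. ?h z * pd ?v (pd ?w F) z + pd ?w F z)"
    by (rule ext, subst smooth_pd_mult[OF opp_dist_smooth trig_smooth[OF trig_pd[OF t]]])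
       (simp add: opp_dist_pd_axis)
  also have "ip M \<dots> (pd ?w F) = ip M (\<lambda>z. ?h z * pd ?v (pd ?w F) z) (pd ?w F) + ip M (pd ?w F) (pd ?w F)"
    by (rule ip_add_left[OF L(2) L(1) L(1)])
  also have "ip M (\<lambda>z. ?h z * pd ?w F z) (pd ?v (pd ?w F)) = cnj (ip M (\<lambda>z. ?h z * pd ?v (pd ?w F) z) (pd ?w F))"
    unfolding ip_cnj by (simp add: ip_def opp_dist_real mult_ac)
  finally have "2 * Re (ip M (\<lambda>z. ?h z * pd ?v (pd ?w F) z) (pd ?w F)) = - (L2_norm M (pd ?w F))\<^sup>2"
    by (simp add: complex_eq_iff Re_ip_self)
  with 1 show ?thesis using Re_ip_sym[of M "pd ?w (pd ?w F)" "\<lambda>z. ?h z * pd ?v F z"] by simp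
qed

lemma normal_deriv_eq:
  obtains \<sigma> :: complex where "\<sigma> = 1 \<or> \<sigma> = -1"
    "\<And>u. normal_deriv a b S u = trace a b S (\<lambda>x. \<sigma> * weak_deriv \<Omega> (side_axis S) u x)"
proof (cases S)
  case Bottom then show thesis using that[of "-1"] by (simp add: normal_deriv_def)
next
  case Top then show thesis using that[of 1] by (simp add: normal_deriv_def)
next
  case Left then show thesis using that[of "-1"] by (simp add: normal_deriv_def)
next
  case Right then show thesis using that[of 1] by (simp add: normal_deriv_def)
qed

text \<open>
  The contribution of the normal second derivative is the trace identity for \<open>D u\<close>. The contribution of
  the tangential one has no boundary term; it is the limit of \<open>rellich_tangential\<close> along the sine
  approximation, which also provides the trace.
\<close>

theorem rellich:
  assumes u: "u \<in> dom_laplacian \<Omega>"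
  shows "side_depth a b S * (L2_norm (N S) (normal_deriv a b S u))\<^sup>2 =
    (L2_norm M (weak_deriv \<Omega> (side_axis S) u))\<^sup>2 - (L2_norm M (weak_deriv \<Omega> (side_tangent S) u))\<^sup>2
    + 2 * Re (ip M (laplacian \<Omega> u) (\<lambda>z. opp_dist a b S z * weak_deriv \<Omega> (side_axis S) u z))"
proof -
  let ?v = "side_axis S" and ?w = "side_tangent S" and ?h = "opp_dist a b S"
  let ?D = "\<lambda>v. weak_deriv \<Omega> v u" and ?DD = "\<lambda>v. weak_deriv \<Omega> v (weak_deriv \<Omega> v u)"
  have u2: "u \<in> H2 \<Omega>" using u by (simp add: dom_laplacian_def)
  obtain T :: "nat \<Rightarrow> field2" where T: "\<And>n. T n \<in> dirichlet_trig" "L2_lim sequentially M T u"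
    "\<And>v. is_axis v \<Longrightarrow> L2_lim sequentially M (\<lambda>n. pd v (T n)) (?D v)"
    "\<And>v w. is_axis v \<Longrightarrow> is_axis w \<Longrightarrow> L2_lim sequentially M (\<lambda>n. pd w (pd v (T n))) (weak_deriv \<Omega> w (?D v))"
    by (rule sine_approximation[OF u]) blast
  note Ts = dirichlet_trig_smooth[OF T(1)]
  obtain \<sigma> :: complex where \<sigma>: "\<sigma> = 1 \<or> \<sigma> = -1" "\<And>u. normal_deriv a b S u = trace a b S (\<lambda>x. \<sigma> * weak_deriv \<Omega> ?v u x)"
    by (rule normal_deriv_eq[of S]) blast
  have Dv: "?D ?v \<in> H1 \<Omega>" by (rule H2_weak_H1[OF u2 axis_side(1)])
  have f: "(\<lambda>x. \<sigma> * ?D ?v x) \<in> H1 \<Omega>" by (rule H1_scale[OF Dv])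
  have wd: "AE x in M. weak_deriv \<Omega> v (\<lambda>x. \<sigma> * ?D ?v x) x = \<sigma> * weak_deriv \<Omega> v (?D ?v) x" if "is_axis v" for v
    by (rule weak_deriv_scale[OF Dv that])
  have tr: "has_trace a b S (\<lambda>x. \<sigma> * ?D ?v x) (normal_deriv a b S u)"
    unfolding \<sigma>(2)
  proof (rule trace_exists[OF f])
    show "smooth (\<lambda>z. \<sigma> * pd ?v (T n) z)" for n by (intro smooth_mult smooth_const smooth_pd Ts axis_side)
    show "L2_lim sequentially M (\<lambda>n z. \<sigma> * pd ?v (T n) z) (\<lambda>x. \<sigma> * ?D ?v x)"
      by (intro L2_lim_scale T axis_side)
    fix v assume v: "is_axis v"
    have "L2_lim sequentially M (\<lambda>n z. pd v (\<lambda>z. \<sigma> * pd ?v (T n) z) z) (\<lambda>x. \<sigma> * weak_deriv \<Omega> v (?D ?v) x)"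
      unfolding smooth_pd_scale[OF smooth_pd[OF Ts axis_side(1)]] by (intro L2_lim_scale T axis_side v)
    then show "L2_lim sequentially M (\<lambda>n. pd v (\<lambda>z. \<sigma> * pd ?v (T n) z)) (weak_deriv \<Omega> v (\<lambda>x. \<sigma> * ?D ?v x))"
    proof (rule L2_lim_cong_AE[OF _ _ H1_weak_L2[OF f v] wd[OF v]])
      have "pd v (\<lambda>z. \<sigma> * pd ?v (T n) z) \<in> L2 M" for n
        by (intro L2_box_smooth smooth_mult smooth_const smooth_pd Ts axis_side v)
      then show "\<forall>\<^sub>F n in sequentially. pd v (\<lambda>z. \<sigma> * pd ?v (T n) z) \<in> L2 M \<and>
          (AE x in M. pd v (\<lambda>z. \<sigma> * pd ?v (T n) z) x = pd v (\<lambda>z. \<sigma> * pd ?v (T n) z) x)" by simp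
    qed
  qed
  have L: "?D v \<in> L2 M" "?DD v \<in> L2 M" if "is_axis v" for v
    using that by (auto intro: H1_weak_L2 H2_weak_H1[OF u2] H2_H1[OF u2])
  have Lh: "(\<lambda>z. ?h z * ?D ?v z) \<in> L2 M"
    by (intro L2_mult_continuous smooth_continuous opp_dist_smooth L axis_side)
  have s2: "\<sigma> * cnj \<sigma> = 1" "cmod \<sigma> = 1" using \<sigma>(1) by auto
  have "ip M (weak_deriv \<Omega> ?v (\<lambda>x. \<sigma> * ?D ?v x)) (\<lambda>z. ?h z * (\<sigma> * ?D ?v z)) =
      ip M (\<lambda>x. \<sigma> * ?DD ?v x) (\<lambda>z. \<sigma> * (?h z * ?D ?v z))"
  proof (rule ip_cong_AE)
    show "(\<lambda>z. ?h z * (\<sigma> * ?D ?v z)) \<in> L2 M" using L2_scale[OF Lh, of \<sigma>] by (simp add: mult.left_commute)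
  qed (use wd[OF axis_side(1)[of S]] in \<open>auto intro!: H1_weak_L2[OF f] L2_scale L Lh AE_I2 simp: mult.left_commute\<close>)
  also have "\<dots> = ip M (?DD ?v) (\<lambda>z. ?h z * ?D ?v z)"
    using s2(1) unfolding ip_scale_left ip_scale_right by (simp flip: mult.assoc)
  finally have A: "side_depth a b S * (L2_norm (N S) (normal_deriv a b S u))\<^sup>2 =
      (L2_norm M (?D ?v))\<^sup>2 + 2 * Re (ip M (?DD ?v) (\<lambda>z. ?h z * ?D ?v z))"
    using trace_identity[OF tr] by (simp add: L2_norm_scale s2(2))
  have B: "2 * Re (ip M (?DD ?w) (\<lambda>z. ?h z * ?D ?v z)) = (L2_norm M (?D ?w))\<^sup>2"
  proof (rule LIMSEQ_unique)
    show "(\<lambda>n. (L2_norm M (pd ?w (T n)))\<^sup>2) \<longlonglongrightarrow> (L2_norm M (?D ?w))\<^sup>2"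
      by (intro tendsto_power L2_lim_norm T axis_side)
    show "(\<lambda>n. (L2_norm M (pd ?w (T n)))\<^sup>2) \<longlonglongrightarrow> 2 * Re (ip M (?DD ?w) (\<lambda>z. ?h z * ?D ?v z))"
      unfolding rellich_tangential[OF T(1), symmetric]
      by (intro tendsto_mult tendsto_const tendsto_Re L2_lim_ip L2_lim_mult_continuous smooth_continuous opp_dist_smooth T axis_side)
  qed
  have "laplacian \<Omega> u = (\<lambda>x. ?DD ?v x + ?DD ?w x)"
    by (cases S) (auto simp: laplacian_def add.commute)
  then have "ip M (laplacian \<Omega> u) (\<lambda>z. ?h z * ?D ?v z) = ip M (?DD ?v) (\<lambda>z. ?h z * ?D ?v z) + ip M (?DD ?w) (\<lambda>z. ?h z * ?D ?v z)"
    by (simp add: ip_add_left L Lh)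
  with A B show ?thesis by simp
qed

end

section \<open>Curves in the space of square integrable functions\<close>

text \<open>
  Differentiability of a curve in the norm of \<open>L\<^sup>2\<close>, one-sided at time 0.
\<close>

definition L2_deriv :: "'a measure \<Rightarrow> (real \<Rightarrow> 'a \<Rightarrow> complex) \<Rightarrow> ('a \<Rightarrow> complex) \<Rightarrow> real \<Rightarrow> bool" where
  "L2_deriv M f f' t \<longleftrightarrow> L2_lim (at t within {0..}) M (\<lambda>s x. (f s x - f t x) / complex_of_real (s - t)) f'"

lemma eventually_time: "\<forall>\<^sub>F s in at t within {0::real..}. 0 \<le> s \<and> s \<noteq> t"
  by (auto simp: eventually_at_filter)

lemma L2_deriv_continuous:
  assumes f: "\<And>s. 0 \<le> s \<Longrightarrow> f s \<in> L2 M" and d: "L2_deriv M f f' t" and t: "0 \<le> t"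
  shows "L2_lim (at t within {0..}) M f (f t)"
proof (rule L2_lim_bound[OF f[OF t]])
  let ?q = "\<lambda>s x. (f s x - f t x) / complex_of_real (s - t)"
  note lim = d[unfolded L2_deriv_def]
  show "\<forall>\<^sub>F s in at t within {0..}. f s \<in> L2 M" using eventually_time by eventually_elim (auto intro: f)
  show "\<forall>\<^sub>F s in at t within {0..}. L2_norm M (\<lambda>x. f s x - f t x) \<le> \<bar>s - t\<bar> * L2_norm M (?q s)"
    using eventually_time
  proof eventually_elim
    case (elim s)
    have "L2_norm M (\<lambda>x. f s x - f t x) = L2_norm M (\<lambda>x. complex_of_real (s - t) * ?q s x)"
      using elim by simp
    then show ?case by (simp only: L2_norm_scale norm_of_real order_refl)
  qed
  have "((\<lambda>s. \<bar>s - t\<bar> * L2_norm M (?q s)) \<longlongrightarrow> \<bar>t - t\<bar> * L2_norm M f') (at t within {0..})"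
    by (intro tendsto_intros L2_lim_norm[OF lim])
  then show "((\<lambda>s. \<bar>s - t\<bar> * L2_norm M (?q s)) \<longlongrightarrow> 0) (at t within {0..})" by simp
qed

lemma Re_ip_has_derivative:
  assumes f: "\<And>s. 0 \<le> s \<Longrightarrow> f s \<in> L2 M" "L2_deriv M f f' t"
    and g: "\<And>s. 0 \<le> s \<Longrightarrow> g s \<in> L2 M" "L2_deriv M g g' t" and t: "0 \<le> t"
  shows "((\<lambda>s. Re (ip M (f s) (g s))) has_real_derivative Re (ip M f' (g t)) + Re (ip M (f t) g')) (at t within {0..})"
  unfolding has_field_derivative_iff
proof (rule Lim_transform_eventually)
  let ?q = "\<lambda>f s x. (f s x - f t x) / complex_of_real (s - t)"
  show "((\<lambda>s. Re (ip M (?q f s) (g s)) + Re (ip M (f t) (?q g s))) \<longlongrightarrow> Re (ip M f' (g t)) + Re (ip M (f t) g')) (at t within {0..})"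
    using f(2) g(2) unfolding L2_deriv_def
    by (intro tendsto_add tendsto_Re L2_lim_ip L2_lim_const f(1)[OF t] L2_deriv_continuous[OF g t])
  show "\<forall>\<^sub>F s in at t within {0..}. Re (ip M (?q f s) (g s)) + Re (ip M (f t) (?q g s)) =
      (Re (ip M (f s) (g s)) - Re (ip M (f t) (g t))) / (s - t)"
    using eventually_time
  proof eventually_elim
    case (elim s)
    have L: "f s \<in> L2 M" "f t \<in> L2 M" "g s \<in> L2 M" "g t \<in> L2 M" using elim t f(1) g(1) by auto
    define r where "r = inverse (s - t)"
    have q: "?q h s = (\<lambda>x. complex_of_real r * (h s x - h t x))" for h :: "real \<Rightarrow> 'a \<Rightarrow> complex"
      by (simp add: r_def divide_inverse mult.commute)
    have inv: "X / (s - t) = r * X" for X :: real by (simp add: r_def divide_inverse mult.commute)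
    show ?case
      unfolding q inv ip_scale_left ip_scale_right complex_cnj_complex_of_real
      using L by (simp add: ip_diff_left ip_diff_right algebra_simps)
  qed
qed

lemma L2_deriv_diff:
  assumes "L2_deriv M f f' t" "L2_deriv M g g' t"
  shows "L2_deriv M (\<lambda>s x. f s x - g s x) (\<lambda>x. f' x - g' x) t"
proof -
  have "(f s x - g s x - (f t x - g t x)) / c = (f s x - f t x) / c - (g s x - g t x) / c" for s x c
    by (simp add: diff_divide_distrib)
  then show ?thesis using L2_lim_diff[OF assms[unfolded L2_deriv_def]] unfolding L2_deriv_def by simp
qed

lemma L2_deriv_shift:
  assumes "L2_deriv M f f' (t + h)" "0 \<le> h"
  shows "L2_deriv M (\<lambda>s. f (s + h)) f' t"
proof -
  have "filterlim (\<lambda>s. s + h) (at (t + h) within {0..}) (at t within {0..})"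
    unfolding filterlim_at
  proof
    show "\<forall>\<^sub>F s in at t within {0..}. s + h \<in> {0..} \<and> s + h \<noteq> t + h"
      using eventually_time by eventually_elim (use assms(2) in simp)
    show "((\<lambda>s. s + h) \<longlongrightarrow> t + h) (at t within {0..})" by (intro tendsto_intros)
  qed
  note fl = this
  note l = L2_limD[OF assms(1)[unfolded L2_deriv_def]]
  have "\<forall>\<^sub>F s in at t within {0..}. (\<lambda>x. (f (s + h) x - f (t + h) x) / complex_of_real (s + h - (t + h))) \<in> L2 M"
    using fl l(2) by (rule eventually_compose_filterlim[rotated])
  moreover from filterlim_compose[OF l(3) fl]
  have "((\<lambda>s. L2_norm M (\<lambda>x. (f (s + h) x - f (t + h) x) / complex_of_real (s + h - (t + h)) - f' x)) \<longlongrightarrow> 0) (at t within {0..})" .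
  ultimately show ?thesis using l(1) unfolding L2_deriv_def L2_lim_def by simp
qed

lemma L2_deriv_mult_bounded:
  assumes "L2_deriv M f f' t" "h \<in> borel_measurable M" "\<And>x. x \<in> space M \<Longrightarrow> cmod (h x) \<le> B"
  shows "L2_deriv M (\<lambda>s x. h x * f s x) (\<lambda>x. h x * f' x) t"
  using L2_lim_mult_bounded[OF assms(1)[unfolded L2_deriv_def] assms(2,3)] unfolding L2_deriv_def
  by (simp add: algebra_simps)

section \<open>Solutions of the wave equation\<close>

context rectangle
begin

text \<open>
  A solution together with its first and second time derivatives. The differentiability of \<open>u\<close> in the
  norm of the gradient is recorded as that of its two partial derivatives in \<open>L\<^sup>2\<close>; in this form the
  notion is stable under time shifts and differences.
\<close>

definition wave_curve :: "(real \<Rightarrow> field2) \<Rightarrow> (real \<Rightarrow> field2) \<Rightarrow> (real \<Rightarrow> field2) \<Rightarrow> bool" where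
  "wave_curve u v w \<longleftrightarrow>
     (\<forall>t\<ge>0. u t \<in> dom_laplacian \<Omega> \<and> v t \<in> H10 \<Omega> \<and> w t \<in> L2 M) \<and>
     (\<forall>t\<ge>0. \<forall>d. is_axis d \<longrightarrow> L2_deriv M (\<lambda>s. weak_deriv \<Omega> d (u s)) (weak_deriv \<Omega> d (v t)) t) \<and>
     (\<forall>t\<ge>0. L2_deriv M v (w t) t) \<and>
     (\<forall>t\<ge>0. AE x in M. w t x = laplacian \<Omega> (u t) x)"

lemma wave_curveD:
  assumes "wave_curve u v w" "0 \<le> t"
  shows "u t \<in> dom_laplacian \<Omega>" "u t \<in> H2 \<Omega>" "u t \<in> H10 \<Omega>" "u t \<in> H1 \<Omega>" "u t \<in> L2 M"
    "v t \<in> H10 \<Omega>" "v t \<in> H1 \<Omega>" "v t \<in> L2 M" "w t \<in> L2 M"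
    "is_axis d \<Longrightarrow> L2_deriv M (\<lambda>s. weak_deriv \<Omega> d (u s)) (weak_deriv \<Omega> d (v t)) t"
    "L2_deriv M v (w t) t" "AE x in M. w t x = laplacian \<Omega> (u t) x"
    "is_axis d \<Longrightarrow> weak_deriv \<Omega> d (u t) \<in> L2 M" "is_axis d \<Longrightarrow> weak_deriv \<Omega> d (v t) \<in> L2 M"
    "laplacian \<Omega> (u t) \<in> L2 M"
proof -
  show *: "u t \<in> dom_laplacian \<Omega>" "v t \<in> H10 \<Omega>" "w t \<in> L2 M"
    "is_axis d \<Longrightarrow> L2_deriv M (\<lambda>s. weak_deriv \<Omega> d (u s)) (weak_deriv \<Omega> d (v t)) t"
    "L2_deriv M v (w t) t" "AE x in M. w t x = laplacian \<Omega> (u t) x"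
    using assms unfolding wave_curve_def by blast+
  show 2: "u t \<in> H2 \<Omega>" "u t \<in> H10 \<Omega>" using *(1) by (auto simp: dom_laplacian_def)
  show 3: "u t \<in> H1 \<Omega>" "v t \<in> H1 \<Omega>" by (rule H2_H1[OF 2(1)], rule H10_H1[OF *(2)])
  show "u t \<in> L2 M" "v t \<in> L2 M" by (intro H1_L2 3)+
  show "is_axis d \<Longrightarrow> weak_deriv \<Omega> d (u t) \<in> L2 M" "is_axis d \<Longrightarrow> weak_deriv \<Omega> d (v t) \<in> L2 M"
    by (intro H1_weak_L2 3; assumption)+
  show "laplacian \<Omega> (u t) \<in> L2 M" by (rule laplacian_L2[OF 2(1)])
qed

definition wave_energy :: "(real \<Rightarrow> field2) \<Rightarrow> (real \<Rightarrow> field2) \<Rightarrow> real \<Rightarrow> real" where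
  "wave_energy u v t = (grad_norm \<Omega> (u t))\<^sup>2 + (L2_norm M (v t))\<^sup>2"

lemma ip_w_laplacian:
  assumes "wave_curve u v w" "0 \<le> t" "p \<in> L2 M"
  shows "ip M (w t) p = ip M (laplacian \<Omega> (u t)) p"
  using wave_curveD[OF assms(1,2)] assms(3) by (intro ip_cong_AE) auto

text \<open>
  By Green's formula the derivative \<open>2 Re (<\<nabla>u, \<nabla>v> + <\<Delta>u, v>)\<close> vanishes.
\<close>

lemma wave_energy_constant:
  assumes W: "wave_curve u v w" and t: "0 \<le> t"
  shows "wave_energy u v t = wave_energy u v 0"
proof -
  have "\<exists>c. \<forall>t\<in>{0..}. wave_energy u v t = c"
  proof (rule has_field_derivative_zero_constant)
    fix t :: real assume "t \<in> {0..}"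
    then have t: "0 \<le> t" by simp
    note D = wave_curveD[OF W]
    let ?X = "\<lambda>d t. weak_deriv \<Omega> d (u t)" and ?V = "\<lambda>d t. weak_deriv \<Omega> d (v t)"
    have e: "wave_energy u v = (\<lambda>s. Re (ip M (?X (1, 0) s) (?X (1, 0) s)) + Re (ip M (?X (0, 1) s) (?X (0, 1) s)) + Re (ip M (v s) (v s)))"
      by (rule ext) (simp add: wave_energy_def Re_ip_self grad_norm_power2)
    have dX: "((\<lambda>s. Re (ip M (?X d s) (?X d s))) has_real_derivative Re (ip M (?V d t) (?X d t)) + Re (ip M (?X d t) (?V d t))) (at t within {0..})"
      if "is_axis d" for d
      by (rule Re_ip_has_derivative) (use D that t in auto)
    have dv: "((\<lambda>s. Re (ip M (v s) (v s))) has_real_derivative Re (ip M (w t) (v t)) + Re (ip M (v t) (w t))) (at t within {0..})"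
      by (rule Re_ip_has_derivative) (use D t in auto)
    have "ip M (?X (1, 0) t) (?V (1, 0) t) + ip M (?X (0, 1) t) (?V (0, 1) t) = - ip M (w t) (v t)"
      using green[OF D(2)[OF t] D(6)[OF t]] ip_w_laplacian[OF W t D(8)[OF t]] by simp
    from arg_cong[OF this, of Re]
    have z: "(Re (ip M (?V (1, 0) t) (?X (1, 0) t)) + Re (ip M (?X (1, 0) t) (?V (1, 0) t)))
        + (Re (ip M (?V (0, 1) t) (?X (0, 1) t)) + Re (ip M (?X (0, 1) t) (?V (0, 1) t)))
        + (Re (ip M (w t) (v t)) + Re (ip M (v t) (w t))) = 0"
      using Re_ip_sym[of M "?V (1, 0) t" "?X (1, 0) t"] Re_ip_sym[of M "?V (0, 1) t" "?X (0, 1) t"]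
        Re_ip_sym[of M "v t" "w t"] by simp
    show "(wave_energy u v has_field_derivative 0) (at t within {0..})"
      using DERIV_add[OF DERIV_add[OF dX[OF axis_simps(1)] dX[OF axis_simps(2)]] dv] unfolding e z .
  qed simp
  then show ?thesis using t by force
qed

lemma L2_deriv_cong_AE:
  assumes "L2_deriv M f f' t" "0 \<le> t" "\<And>s. 0 \<le> s \<Longrightarrow> g s \<in> L2 M" "\<And>s. 0 \<le> s \<Longrightarrow> AE x in M. g s x = f s x"
    "g' \<in> L2 M" "AE x in M. g' x = f' x"
  shows "L2_deriv M g g' t"
  unfolding L2_deriv_def
proof (rule L2_lim_cong_AE[OF assms(1)[unfolded L2_deriv_def] _ assms(5,6)])
  show "\<forall>\<^sub>F s in at t within {0..}. (\<lambda>x. (g s x - g t x) / complex_of_real (s - t)) \<in> L2 M \<and>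
      (AE x in M. (g s x - g t x) / complex_of_real (s - t) = (f s x - f t x) / complex_of_real (s - t))"
    using eventually_time
  proof eventually_elim
    case (elim s)
    have "AE x in M. (g s x - g t x) / complex_of_real (s - t) = (f s x - f t x) / complex_of_real (s - t)"
    proof -
      from elim have "AE x in M. g s x = f s x" using assms(4) by blast
      with assms(4)[OF assms(2)] show ?thesis by eventually_elim simp
    qed
    moreover have "(\<lambda>x. (g s x - g t x) / complex_of_real (s - t)) \<in> L2 M"
      using elim assms(2) by (intro L2_divide L2_diff assms(3)) auto
    ultimately show ?case by blast
  qed
qed

lemma wave_curve_shift_diff:
  assumes W: "wave_curve u v w" and h: "0 \<le> h"
  shows "wave_curve (\<lambda>s x. u (s + h) x - u s x) (\<lambda>s x. v (s + h) x - v s x) (\<lambda>s x. w (s + h) x - w s x)"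
  unfolding wave_curve_def
proof (intro conjI allI impI)
  note D = wave_curveD[OF W]
  fix t :: real assume t: "0 \<le> t"
  have th: "0 \<le> s + h" if "0 \<le> s" for s using that h by simp
  show "(\<lambda>x. u (t + h) x - u t x) \<in> dom_laplacian \<Omega>"
    unfolding dom_laplacian_def using D(2,3)[OF th[OF t]] D(2,3)[OF t] by (auto intro: H2_diff H10_diff)
  show v: "(\<lambda>x. v (t + h) x - v t x) \<in> H10 \<Omega>" by (rule H10_diff[OF D(6)[OF th[OF t]] D(6)[OF t]])
  show "(\<lambda>x. w (t + h) x - w t x) \<in> L2 M" by (rule L2_diff[OF D(9)[OF th[OF t]] D(9)[OF t]])
  show "L2_deriv M (\<lambda>s x. v (s + h) x - v s x) (\<lambda>x. w (t + h) x - w t x) t"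
    by (rule L2_deriv_diff[OF L2_deriv_shift[OF D(11)[OF th[OF t]] h] D(11)[OF t]])
  show "AE x in M. w (t + h) x - w t x = laplacian \<Omega> (\<lambda>x. u (t + h) x - u t x) x"
    using H2_diff(3)[OF D(2)[OF th[OF t]] D(2)[OF t]] D(12)[OF th[OF t]] D(12)[OF t] by eventually_elim simp
  fix d assume d: "is_axis d"
  show "L2_deriv M (\<lambda>s. weak_deriv \<Omega> d (\<lambda>x. u (s + h) x - u s x)) (weak_deriv \<Omega> d (\<lambda>x. v (t + h) x - v t x)) t"
  proof (rule L2_deriv_cong_AE[OF L2_deriv_diff[OF L2_deriv_shift[OF D(10)[OF th[OF t] d] h] D(10)[OF t d]] t])
    show "weak_deriv \<Omega> d (\<lambda>x. v (t + h) x - v t x) \<in> L2 M" by (intro H1_weak_L2 H10_H1 v d)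
    show "AE x in M. weak_deriv \<Omega> d (\<lambda>x. v (t + h) x - v t x) x = weak_deriv \<Omega> d (v (t + h)) x - weak_deriv \<Omega> d (v t) x"
      by (rule weak_deriv_diff[OF D(7)[OF th[OF t]] D(7)[OF t] d])
    fix s :: real assume s: "0 \<le> s"
    show "AE x in M. weak_deriv \<Omega> d (\<lambda>x. u (s + h) x - u s x) x = weak_deriv \<Omega> d (u (s + h)) x - weak_deriv \<Omega> d (u s) x"
      by (rule weak_deriv_diff[OF D(4)[OF th[OF s]] D(4)[OF s] d])
    show "weak_deriv \<Omega> d (\<lambda>x. u (s + h) x - u s x) \<in> L2 M"
      by (intro H1_weak_L2 H1_diff D(4) th s d)
  qed
qed

definition wave_energy2 :: "(real \<Rightarrow> field2) \<Rightarrow> (real \<Rightarrow> field2) \<Rightarrow> real \<Rightarrow> real" where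
  "wave_energy2 u v t = (laplacian_norm \<Omega> (u t))\<^sup>2 + (grad_norm \<Omega> (v t))\<^sup>2"

text \<open>
  This cannot be obtained by differentiation, since \<open>v\<close> has no second derivatives. Instead, the
  difference quotient of \<open>u\<close> with step \<open>h\<close> is a solution, whose energy \<open>Q h\<close> is conserved. As \<open>h\<close> tends to 0,
  \<open>Q h\<close> converges to \<open>\<parallel>\<nabla>v\<parallel>\<^sup>2 + \<parallel>w\<parallel>\<^sup>2\<close>, and \<open>w = \<Delta>u\<close>.
\<close>

lemma wave_energy2_constant:
  assumes W: "wave_curve u v w" and t: "0 \<le> t"
  shows "wave_energy2 u v t = wave_energy2 u v 0"
proof -
  note D = wave_curveD[OF W]
  have lap: "laplacian_norm \<Omega> (u t) = L2_norm M (w t)" if t: "0 \<le> t" for t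
    unfolding laplacian_norm_def using D(12)[OF t] D(9,15)[OF t]
    by (intro L2_norm_cong_AE L2_measurable) auto
  define Q where "Q h t = wave_energy (\<lambda>s x. u (s + h) x - u s x) (\<lambda>s x. v (s + h) x - v s x) t / h\<^sup>2" for h t :: real
  have lim: "((\<lambda>h. Q h t) \<longlongrightarrow> wave_energy2 u v t) (at_right 0)" if t: "0 \<le> t" for t
  proof -
    let ?q = "\<lambda>f h x. (f (t + h) x - f t x) / complex_of_real h"
    have fl: "filterlim (\<lambda>h. t + h) (at t within {0..}) (at_right 0)"
      unfolding filterlim_at
    proof
      have "((\<lambda>h. t + h) \<longlongrightarrow> t + 0) (at_right 0)" by (intro tendsto_intros)
      then show "((\<lambda>h. t + h) \<longlongrightarrow> t) (at_right 0)" by simp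
      show "\<forall>\<^sub>F h in at_right 0. t + h \<in> {0..} \<and> t + h \<noteq> t"
        using eventually_at_right_less[of 0] by eventually_elim (use t in simp)
    qed
    have n: "((\<lambda>h. L2_norm M (?q f h)) \<longlongrightarrow> L2_norm M f') (at_right 0)" if "L2_deriv M f f' t" for f f'
      using filterlim_compose[OF L2_lim_norm[OF that[unfolded L2_deriv_def]] fl] by simp
    let ?U = "\<lambda>d s. weak_deriv \<Omega> d (u s)"
    have "((\<lambda>h. (L2_norm M (?q (?U (1, 0)) h))\<^sup>2 + (L2_norm M (?q (?U (0, 1)) h))\<^sup>2 + (L2_norm M (?q v h))\<^sup>2)
        \<longlongrightarrow> (L2_norm M (weak_dx \<Omega> (v t)))\<^sup>2 + (L2_norm M (weak_dy \<Omega> (v t)))\<^sup>2 + (L2_norm M (w t))\<^sup>2) (at_right 0)"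
      by (intro tendsto_add tendsto_power n D(10,11)[OF t] axis_simps)
    moreover have "\<forall>\<^sub>F h in at_right 0. (L2_norm M (?q (?U (1, 0)) h))\<^sup>2 + (L2_norm M (?q (?U (0, 1)) h))\<^sup>2 + (L2_norm M (?q v h))\<^sup>2 = Q h t"
      using eventually_at_right_less[of 0]
    proof eventually_elim
      case (elim h)
      have th: "0 \<le> t + h" using elim t by simp
      have nq: "(L2_norm M (?q f h))\<^sup>2 = (L2_norm M (\<lambda>x. f (t + h) x - f t x))\<^sup>2 / h\<^sup>2" for f
        using L2_norm_scale[of M "inverse (complex_of_real h)" "\<lambda>x. f (t + h) x - f t x"] elim
        by (simp add: divide_inverse mult.commute norm_inverse power_mult_distrib power_inverse)
      show ?case
        unfolding nq[of "?U (1, 0)"] nq[of "?U (0, 1)"] nq[of v] Q_def wave_energy_def grad_norm_power2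
        by (simp add: norm_weak_deriv_diff[OF D(4)[OF th] D(4)[OF t]] add_divide_distrib)
    qed
    ultimately have "((\<lambda>h. Q h t) \<longlongrightarrow> (L2_norm M (weak_dx \<Omega> (v t)))\<^sup>2 + (L2_norm M (weak_dy \<Omega> (v t)))\<^sup>2 + (L2_norm M (w t))\<^sup>2) (at_right 0)"
      by (rule Lim_transform_eventually)
    then show ?thesis by (simp add: wave_energy2_def lap[OF t] grad_norm_power2 add.commute)
  qed
  have "\<forall>\<^sub>F h in at_right 0. Q h 0 = Q h t"
    using eventually_at_right_less[of 0]
    by eventually_elim (use wave_energy_constant[OF wave_curve_shift_diff[OF W] t] in \<open>simp add: Q_def\<close>)
  from Lim_transform_eventually[OF lim[OF order_refl] this]
  have "((\<lambda>h. Q h t) \<longlongrightarrow> wave_energy2 u v 0) (at_right 0)" .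
  with lim[OF t] show ?thesis using tendsto_unique[of "at_right (0::real)"] by simp
qed

text \<open>
  The Poincare inequality turns differentiability in the norm of the gradient into differentiability
  in \<open>L\<^sup>2\<close>.
\<close>

lemma wave_curve_deriv_u:
  assumes W: "wave_curve u v w" and t: "0 \<le> t"
  shows "L2_deriv M u (v t) t"
  unfolding L2_deriv_def
proof (rule L2_lim_bound)
  note D = wave_curveD[OF W]
  let ?q = "\<lambda>f s x. (f s x - f t x) / complex_of_real (s - t)" and ?U = "\<lambda>s. weak_deriv \<Omega> (0, 1) (u s)"
  show "v t \<in> L2 M" by (rule D(8)[OF t])
  show "\<forall>\<^sub>F s in at t within {0..}. ?q u s \<in> L2 M"
    using eventually_time by eventually_elim (rule L2_divide, rule L2_diff, auto intro: D(5) t)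
  show "\<forall>\<^sub>F s in at t within {0..}. L2_norm M (\<lambda>x. ?q u s x - v t x) \<le>
      2 * side_depth a b Bottom * L2_norm M (\<lambda>x. ?q ?U s x - weak_deriv \<Omega> (0, 1) (v t) x)"
    using eventually_time
  proof eventually_elim
    case (elim s)
    have s: "0 \<le> s" using elim by simp
    have H: "?q u s \<in> H10 \<Omega>" by (intro H10_divide H10_diff D(3) s t)
    note H1 = H10_H1[OF H]
    have ae: "AE x in M. weak_deriv \<Omega> (0, 1) (?q u s) x = ?q ?U s x"
      using weak_deriv_scale[OF H1_diff[OF D(4)[OF s] D(4)[OF t]] axis_simps(2), of "inverse (complex_of_real (s - t))"]
        weak_deriv_diff[OF D(4)[OF s] D(4)[OF t] axis_simps(2)]
      by (simp only: divide_inverse mult.commute[of _ "inverse _"], eventually_elim) simp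
    have "L2_norm M (weak_deriv \<Omega> (0, 1) (\<lambda>x. ?q u s x - v t x)) = L2_norm M (\<lambda>x. weak_deriv \<Omega> (0, 1) (?q u s) x - weak_deriv \<Omega> (0, 1) (v t) x)"
      by (rule norm_weak_deriv_diff[OF H1 D(7)[OF t] axis_simps(2)])
    also have "\<dots> = L2_norm M (\<lambda>x. ?q ?U s x - weak_deriv \<Omega> (0, 1) (v t) x)"
    proof (rule L2_norm_cong_AE)
      show "AE x in M. weak_deriv \<Omega> (0, 1) (?q u s) x - weak_deriv \<Omega> (0, 1) (v t) x = ?q ?U s x - weak_deriv \<Omega> (0, 1) (v t) x"
        using ae by eventually_elim simp
    qed (intro L2_measurable L2_diff L2_divide H1_weak_L2[OF H1] D(13,14) s t axis_simps)+
    finally show ?case using poincare[OF H10_diff[OF H D(6)[OF t]], of Bottom] by simp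
  qed
  have "((\<lambda>s. 2 * side_depth a b Bottom * L2_norm M (\<lambda>x. ?q ?U s x - weak_deriv \<Omega> (0, 1) (v t) x)) \<longlongrightarrow> 2 * side_depth a b Bottom * 0) (at t within {0..})"
    by (intro tendsto_mult tendsto_const L2_limD(3)[OF D(10)[OF t axis_simps(2), unfolded L2_deriv_def]])
  then show "((\<lambda>s. 2 * side_depth a b Bottom * L2_norm M (\<lambda>x. ?q ?U s x - weak_deriv \<Omega> (0, 1) (v t) x)) \<longlongrightarrow> 0) (at t within {0..})"
    by simp
qed


text \<open>
  The product rule gives \<open>Re <\<Delta>u, h D u> + Re <v, h D v> + (Re <\<Delta>u, u> + \<parallel>v\<parallel>\<^sup>2) / 2\<close>. The first term is
  given by the Rellich identity, the second one is \<open>- \<parallel>v\<parallel>\<^sup>2 / 2\<close>, and \<open>Re <\<Delta>u, u> = - \<parallel>\<nabla>u\<parallel>\<^sup>2\<close>. The term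
  \<open>Re <v, u> / 2\<close> in the differentiated quantity is there to cancel \<open>\<parallel>v\<parallel>\<^sup>2\<close> and the tangential derivative.
\<close>

lemma wave_boundary_identity:
  fixes S :: side
  assumes W: "wave_curve u v w" and t: "0 \<le> t"
  defines "R \<equiv> \<lambda>t. Re (ip M (v t) (\<lambda>z. opp_dist a b S z * weak_deriv \<Omega> (side_axis S) (u t) z)) + Re (ip M (v t) (u t)) / 2"
  shows "(R has_real_derivative side_depth a b S / 2 * (L2_norm (N S) (normal_deriv a b S (u t)))\<^sup>2
      - (L2_norm M (weak_deriv \<Omega> (side_axis S) (u t)))\<^sup>2) (at t within {0..})"
proof -
  note D = wave_curveD[OF W]
  let ?h = "opp_dist a b S" and ?U = "\<lambda>t. weak_deriv \<Omega> (side_axis S) (u t)" and ?V = "\<lambda>t. weak_deriv \<Omega> (side_axis S) (v t)"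
    and ?T = "\<lambda>t. weak_deriv \<Omega> (side_tangent S) (u t)"
  have hL: "(\<lambda>z. ?h z * f z) \<in> L2 M" if "f \<in> L2 M" for f
    by (intro L2_mult_continuous that smooth_continuous opp_dist_smooth)
  have dh: "L2_deriv M (\<lambda>s z. ?h z * ?U s z) (\<lambda>z. ?h z * ?V t z) t"
    using D(10)[OF t axis_side(1)] opp_dist_le
    by (intro L2_deriv_mult_bounded continuous_measurable_box smooth_continuous opp_dist_smooth) auto
  have d1: "((\<lambda>s. Re (ip M (v s) (\<lambda>z. ?h z * ?U s z))) has_real_derivative
      Re (ip M (w t) (\<lambda>z. ?h z * ?U t z)) + Re (ip M (v t) (\<lambda>z. ?h z * ?V t z))) (at t within {0..})"
    by (rule Re_ip_has_derivative[OF D(8) D(11)[OF t] hL[OF D(13)] dh t]) (auto simp: axis_side)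
  have d2: "((\<lambda>s. Re (ip M (v s) (u s))) has_real_derivative Re (ip M (w t) (u t)) + Re (ip M (v t) (v t))) (at t within {0..})"
    by (rule Re_ip_has_derivative[OF D(8) D(11)[OF t] D(5) wave_curve_deriv_u[OF W t] t])
  have 1: "ip M (w t) (\<lambda>z. ?h z * ?U t z) = ip M (laplacian \<Omega> (u t)) (\<lambda>z. ?h z * ?U t z)"
    by (rule ip_w_laplacian[OF W t hL[OF D(13)[OF t axis_side(1)]]])
  have 2: "Re (ip M (v t) (\<lambda>z. ?h z * ?V t z)) = - (L2_norm M (v t))\<^sup>2 / 2"
    by (rule opp_dist_identity[OF D(6)[OF t]])
  have sum: "(L2_norm M (weak_dx \<Omega> (u t)))\<^sup>2 + (L2_norm M (weak_dy \<Omega> (u t)))\<^sup>2 = (L2_norm M (?U t))\<^sup>2 + (L2_norm M (?T t))\<^sup>2"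
    by (cases S) simp_all
  have "ip M (weak_dx \<Omega> (u t)) (weak_dx \<Omega> (u t)) + ip M (weak_dy \<Omega> (u t)) (weak_dy \<Omega> (u t)) = - ip M (w t) (u t)"
    using green[OF D(2)[OF t] D(3)[OF t]] ip_w_laplacian[OF W t D(5)[OF t]] by simp
  from arg_cong[OF this, of Re] have 3: "Re (ip M (w t) (u t)) = - (L2_norm M (?U t))\<^sup>2 - (L2_norm M (?T t))\<^sup>2"
    using sum by (simp add: Re_ip_self)
  have 4: "Re (ip M (v t) (v t)) = (L2_norm M (v t))\<^sup>2" by (rule Re_ip_self)
  have "(R has_real_derivative (Re (ip M (w t) (\<lambda>z. ?h z * ?U t z)) + Re (ip M (v t) (\<lambda>z. ?h z * ?V t z)))
      + (Re (ip M (w t) (u t)) + Re (ip M (v t) (v t))) / 2) (at t within {0..})"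
    unfolding R_def by (intro DERIV_add DERIV_cdivide d1 d2)
  moreover have "(Re (ip M (w t) (\<lambda>z. ?h z * ?U t z)) + Re (ip M (v t) (\<lambda>z. ?h z * ?V t z)))
      + (Re (ip M (w t) (u t)) + Re (ip M (v t) (v t))) / 2 =
      side_depth a b S / 2 * (L2_norm (N S) (normal_deriv a b S (u t)))\<^sup>2 - (L2_norm M (?U t))\<^sup>2"
    using rellich[OF D(1)[OF t], of S] unfolding 1 2 3 4 by (simp add: field_simps)
  ultimately show ?thesis by simp
qed

lemma grad_norm_power2_side: "(grad_norm \<Omega> f)\<^sup>2 = (L2_norm M (weak_deriv \<Omega> (side_axis S) f))\<^sup>2 + (L2_norm M (weak_deriv \<Omega> (side_tangent S) f))\<^sup>2"
  unfolding grad_norm_power2 by (cases S) simp_all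

lemma ip_le_wave_energy:
  assumes W: "wave_curve u v w" and t: "0 \<le> t"
  shows "\<bar>Re (ip M (v t) (u t))\<bar> \<le> side_depth a b S * wave_energy u v t"
    "\<bar>Re (ip M (v t) (\<lambda>z. opp_dist a b S z * weak_deriv \<Omega> (side_axis S) (u t) z))\<bar> \<le> side_depth a b S / 2 * wave_energy u v t"
proof -
  note D = wave_curveD[OF W t]
  let ?l = "side_depth a b S" and ?n = "L2_norm M (weak_deriv \<Omega> (side_axis S) (u t))" and ?m = "L2_norm M (v t)"
  have l: "0 < ?l" by (rule side_depth_pos[OF a_pos b_pos])
  have amgm: "2 * (?m * ?n) \<le> wave_energy u v t"
    using sum_squares_bound[of ?m ?n] unfolding wave_energy_def grad_norm_power2_side[of _ S]
    using zero_le_power2[of "L2_norm M (weak_deriv \<Omega> (side_tangent S) (u t))"] by linarith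
  have "\<bar>Re (ip M (v t) (u t))\<bar> \<le> ?m * L2_norm M (u t)" by (rule Re_ip_le[OF D(8) D(5)])
  also have "\<dots> \<le> ?m * (2 * ?l * ?n)" by (intro mult_left_mono poincare[OF D(3)]) simp
  also have "\<dots> = ?l * (2 * (?m * ?n))" by simp
  also have "\<dots> \<le> ?l * wave_energy u v t" using l amgm by (intro mult_left_mono) auto
  finally show "\<bar>Re (ip M (v t) (u t))\<bar> \<le> ?l * wave_energy u v t" .
  have "\<bar>Re (ip M (v t) (\<lambda>z. opp_dist a b S z * weak_deriv \<Omega> (side_axis S) (u t) z))\<bar> \<le>
      ?m * L2_norm M (\<lambda>z. opp_dist a b S z * weak_deriv \<Omega> (side_axis S) (u t) z)"
    by (intro Re_ip_le D(8) L2_mult_continuous D(13) axis_side smooth_continuous opp_dist_smooth)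
  also have "\<dots> \<le> ?m * (?l * ?n)" by (intro mult_left_mono opp_dist_norm_le D(13) axis_side) simp
  also have "\<dots> = ?l / 2 * (2 * (?m * ?n))" by simp
  also have "\<dots> \<le> ?l / 2 * wave_energy u v t" using l amgm by (intro mult_left_mono) auto
  finally show "\<bar>Re (ip M (v t) (\<lambda>z. opp_dist a b S z * weak_deriv \<Omega> (side_axis S) (u t) z))\<bar> \<le> ?l / 2 * wave_energy u v t" .
qed

text \<open>
  The right-hand side dominates \<open>\<parallel>\<nabla>u\<parallel>\<^sup>4\<close>, and the left-hand side is the tangent to the square at
  \<open>\<parallel>\<nabla>u\<parallel>\<^sup>2 = E / 4\<close>. This linear minorant can be integrated in time by means of the equipartition of
  energy.
\<close>

lemma pointwise_lower_bound:
  assumes W: "wave_curve u v w" and t: "0 \<le> t"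
  defines "E \<equiv> wave_energy u v 0" and "F \<equiv> wave_energy2 u v 0"
  shows "E / 2 * (grad_norm \<Omega> (u t))\<^sup>2 - E\<^sup>2 / 16 \<le>
    4 * (side_depth a b S)\<^sup>2 * F * (L2_norm M (weak_deriv \<Omega> (side_axis S) (u t)))\<^sup>2"
proof -
  note D = wave_curveD[OF W t]
  let ?l = "side_depth a b S" and ?n = "L2_norm M (weak_deriv \<Omega> (side_axis S) (u t))" and ?g = "(grad_norm \<Omega> (u t))\<^sup>2"
  have "ip M (weak_dx \<Omega> (u t)) (weak_dx \<Omega> (u t)) + ip M (weak_dy \<Omega> (u t)) (weak_dy \<Omega> (u t)) = - ip M (laplacian \<Omega> (u t)) (u t)"
    by (rule green[OF D(2) D(3)])
  from arg_cong[OF this, of Re] have "?g = - Re (ip M (laplacian \<Omega> (u t)) (u t))"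
    by (simp add: Re_ip_self grad_norm_power2)
  then have "?g \<le> laplacian_norm \<Omega> (u t) * L2_norm M (u t)"
    using Re_ip_le[OF D(15) D(5)] unfolding laplacian_norm_def by linarith
  then have "?g\<^sup>2 \<le> (laplacian_norm \<Omega> (u t) * L2_norm M (u t))\<^sup>2" by (rule power_mono) simp
  also have "\<dots> = (laplacian_norm \<Omega> (u t))\<^sup>2 * (L2_norm M (u t))\<^sup>2" by (rule power_mult_distrib)
  also have "\<dots> \<le> F * (2 * ?l * ?n)\<^sup>2"
  proof (rule mult_mono)
    show "(laplacian_norm \<Omega> (u t))\<^sup>2 \<le> F"
      using wave_energy2_constant[OF W t] unfolding F_def wave_energy2_def by (metis le_add_same_cancel1 zero_le_power2)
    show "(L2_norm M (u t))\<^sup>2 \<le> (2 * ?l * ?n)\<^sup>2" by (intro power_mono poincare[OF D(3)]) simp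
  qed (auto simp: F_def wave_energy2_def)
  also have "\<dots> = 4 * ?l\<^sup>2 * F * ?n\<^sup>2" by (simp add: power_mult_distrib)
  finally have "?g\<^sup>2 \<le> 4 * ?l\<^sup>2 * F * ?n\<^sup>2" .
  moreover have "E / 2 * ?g - E\<^sup>2 / 16 \<le> ?g\<^sup>2"
    using zero_le_power2[of "?g - E / 4"] by (simp add: power2_diff power_divide algebra_simps)
  ultimately show ?thesis by linarith
qed

text \<open>
  The Rellich identity expresses the observation by quantities inside the rectangle that are continuous
  in time.
\<close>

lemma boundary_energy_continuous:
  assumes W: "wave_curve u v w" and c: "time_continuous (laplacian_norm \<Omega>) u"
  shows "continuous_on {0..} (\<lambda>t. (L2_norm (N S) (normal_deriv a b S (u t)))\<^sup>2)"
  unfolding continuous_on_def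
proof
  fix t :: real assume "t \<in> {0..}"
  then have t: "0 \<le> t" by simp
  note D = wave_curveD[OF W]
  let ?U = "\<lambda>d t. weak_deriv \<Omega> d (u t)"
  have "L2_lim (at t within {0..}) M (\<lambda>s. laplacian \<Omega> (u s)) (laplacian \<Omega> (u t))"
  proof (rule L2_lim_bound[OF D(15)[OF t]])
    show "\<forall>\<^sub>F s in at t within {0..}. laplacian \<Omega> (u s) \<in> L2 M"
      using eventually_time by eventually_elim (use D(15) in blast)
    show "((\<lambda>s. laplacian_norm \<Omega> (\<lambda>x. u s x - u t x)) \<longlongrightarrow> 0) (at t within {0..})"
      using c t unfolding time_continuous_def by blast
    show "\<forall>\<^sub>F s in at t within {0..}. L2_norm M (\<lambda>x. laplacian \<Omega> (u s) x - laplacian \<Omega> (u t) x) \<le> laplacian_norm \<Omega> (\<lambda>x. u s x - u t x)"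
      using eventually_time
    proof eventually_elim
      case (elim s)
      then have s: "0 \<le> s" by simp
      have "L2_norm M (\<lambda>x. laplacian \<Omega> (u s) x - laplacian \<Omega> (u t) x) = laplacian_norm \<Omega> (\<lambda>x. u s x - u t x)"
        unfolding laplacian_norm_def
      proof (rule L2_norm_cong_AE)
        show "AE x in M. laplacian \<Omega> (u s) x - laplacian \<Omega> (u t) x = laplacian \<Omega> (\<lambda>x. u s x - u t x) x"
          using H2_diff(3)[OF D(2)[OF s] D(2)[OF t]] by eventually_elim simp
      qed (intro L2_measurable L2_diff D(15) s t laplacian_L2 H2_diff(1) D(2))+
      then show ?case by simp
    qed
  qed
  moreover have U: "L2_lim (at t within {0..}) M (\<lambda>s. ?U d s) (?U d t)" if "is_axis d" for d
    by (rule L2_deriv_continuous[OF D(13)[OF _ that] D(10)[OF t that] t])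
  ultimately have lim: "((\<lambda>s. ((L2_norm M (?U (side_axis S) s))\<^sup>2 - (L2_norm M (?U (side_tangent S) s))\<^sup>2
      + 2 * Re (ip M (laplacian \<Omega> (u s)) (\<lambda>z. opp_dist a b S z * ?U (side_axis S) s z))) / side_depth a b S) \<longlongrightarrow>
      ((L2_norm M (?U (side_axis S) t))\<^sup>2 - (L2_norm M (?U (side_tangent S) t))\<^sup>2
      + 2 * Re (ip M (laplacian \<Omega> (u t)) (\<lambda>z. opp_dist a b S z * ?U (side_axis S) t z))) / side_depth a b S) (at t within {0..})"
    using side_depth_pos[OF a_pos b_pos, of S]
    by (intro tendsto_divide tendsto_add tendsto_diff tendsto_power tendsto_mult tendsto_const tendsto_Re L2_lim_ip
        L2_lim_norm L2_lim_mult_continuous smooth_continuous opp_dist_smooth U axis_side) auto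
  have eq: "((L2_norm M (?U (side_axis S) s))\<^sup>2 - (L2_norm M (?U (side_tangent S) s))\<^sup>2
      + 2 * Re (ip M (laplacian \<Omega> (u s)) (\<lambda>z. opp_dist a b S z * ?U (side_axis S) s z))) / side_depth a b S
      = (L2_norm (N S) (normal_deriv a b S (u s)))\<^sup>2" if "0 \<le> s" for s
    using rellich[OF D(1)[OF that], of S] side_depth_pos[OF a_pos b_pos, of S] by (simp add: field_simps)
  show "((\<lambda>s. (L2_norm (N S) (normal_deriv a b S (u s)))\<^sup>2) \<longlongrightarrow> (L2_norm (N S) (normal_deriv a b S (u t)))\<^sup>2) (at t within {0..})"
    using lim unfolding eq[OF t]
  proof (rule Lim_transform_eventually)
    show "\<forall>\<^sub>F s in at t within {0..}. ((L2_norm M (?U (side_axis S) s))\<^sup>2 - (L2_norm M (?U (side_tangent S) s))\<^sup>2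
      + 2 * Re (ip M (laplacian \<Omega> (u s)) (\<lambda>z. opp_dist a b S z * ?U (side_axis S) s z))) / side_depth a b S
      = (L2_norm (N S) (normal_deriv a b S (u s)))\<^sup>2"
      using eventually_time by eventually_elim (use eq in blast)
  qed
qed

text \<open>
  The pointwise lower bound is integrated over \<open>[0, T]\<close>, with \<open>\<parallel>\<nabla>u\<parallel>\<^sup>2\<close> replaced by means of
  \<open>d/dt Re <v, u> = E - 2 \<parallel>\<nabla>u\<parallel>\<^sup>2\<close> and \<open>\<parallel>D u\<parallel>\<^sup>2\<close> replaced by means of the boundary identity. The boundary
  values at the times 0 and \<open>T\<close> are bounded by multiples of the energy.
\<close>

lemma integrated_boundary_estimate:
  fixes S :: side
  assumes W: "wave_curve u v w" and c: "time_continuous (laplacian_norm \<Omega>) u" and T: "0 \<le> T"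
  defines "E \<equiv> wave_energy u v 0" and "F \<equiv> wave_energy2 u v 0" and "l \<equiv> side_depth a b S"
    and "I \<equiv> integral {0..T} (\<lambda>t. (L2_norm (N S) (normal_deriv a b S (u t)))\<^sup>2)"
  shows "3 / 16 * E\<^sup>2 * T - l * E\<^sup>2 / 2 \<le> 4 * l\<^sup>2 * F * (l / 2 * I + 2 * l * E)"
proof -
  note D = wave_curveD[OF W]
  let ?B = "\<lambda>t. (L2_norm (N S) (normal_deriv a b S (u t)))\<^sup>2"
  let ?Q = "\<lambda>t. Re (ip M (v t) (u t))"
  let ?n = "\<lambda>t. (L2_norm M (weak_deriv \<Omega> (side_axis S) (u t)))\<^sup>2"
  define R where "R = (\<lambda>t. Re (ip M (v t) (\<lambda>z. opp_dist a b S z * weak_deriv \<Omega> (side_axis S) (u t) z)) + Re (ip M (v t) (u t)) / 2)"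
  have E0: "0 \<le> E" "0 \<le> F" by (auto simp: E_def F_def wave_energy_def wave_energy2_def)
  have l: "0 < l" unfolding l_def by (rule side_depth_pos[OF a_pos b_pos])
  have dR: "(R has_real_derivative l / 2 * ?B t - ?n t) (at t within {0..})" if "0 \<le> t" for t
    unfolding R_def l_def by (rule wave_boundary_identity[OF W that])
  have dQ: "(?Q has_real_derivative E - 2 * (grad_norm \<Omega> (u t))\<^sup>2) (at t within {0..})" if t: "0 \<le> t" for t
  proof -
    have "(?Q has_real_derivative Re (ip M (w t) (u t)) + Re (ip M (v t) (v t))) (at t within {0..})"
      by (rule Re_ip_has_derivative[OF D(8) D(11)[OF t] D(5) wave_curve_deriv_u[OF W t] t])
    moreover have "ip M (weak_dx \<Omega> (u t)) (weak_dx \<Omega> (u t)) + ip M (weak_dy \<Omega> (u t)) (weak_dy \<Omega> (u t)) = - ip M (w t) (u t)"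
      using green[OF D(2)[OF t] D(3)[OF t]] ip_w_laplacian[OF W t D(5)[OF t]] by simp
    from arg_cong[OF this, of Re] have "Re (ip M (w t) (u t)) = - (grad_norm \<Omega> (u t))\<^sup>2"
      by (simp add: Re_ip_self grad_norm_power2)
    moreover have "Re (ip M (v t) (v t)) = E - (grad_norm \<Omega> (u t))\<^sup>2"
      using wave_energy_constant[OF W t] unfolding E_def wave_energy_def by (simp add: Re_ip_self)
    ultimately show ?thesis by simp
  qed
  have IR: "((\<lambda>t. l / 2 * ?B t - ?n t) has_integral R T - R 0) {0..T}"
  proof (rule fundamental_theorem_of_calculus[OF T])
    fix t assume "t \<in> {0..T}"
    then show "(R has_vector_derivative l / 2 * ?B t - ?n t) (at t within {0..T})"
      using DERIV_subset[OF dR, of t "{0..T}"] by (simp flip: has_real_derivative_iff_has_vector_derivative)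
  qed
  have IQ: "((\<lambda>t. E - 2 * (grad_norm \<Omega> (u t))\<^sup>2) has_integral ?Q T - ?Q 0) {0..T}"
  proof (rule fundamental_theorem_of_calculus[OF T])
    fix t assume "t \<in> {0..T}"
    then show "(?Q has_vector_derivative E - 2 * (grad_norm \<Omega> (u t))\<^sup>2) (at t within {0..T})"
      using DERIV_subset[OF dQ, of t "{0..T}"] by (simp flip: has_real_derivative_iff_has_vector_derivative)
  qed
  have "?B integrable_on {0..T}"
    by (intro integrable_continuous_interval continuous_on_subset[OF boundary_energy_continuous[OF W c]]) auto
  then have IB: "(?B has_integral I) {0..T}" unfolding I_def by (rule integrable_integral)
  have IC: "((\<lambda>t. 3 / 16 * E\<^sup>2) has_integral T * (3 / 16 * E\<^sup>2)) {0..T}"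
    using has_integral_const_real[of "3 / 16 * E\<^sup>2" 0 T] T by simp
  \<comment> \<open>The linear minorant \<open>E/2 \<parallel>\<nabla>u\<parallel>\<^sup>2 - E\<^sup>2/16\<close>, written in terms of \<open>E - 2 \<parallel>\<nabla>u\<parallel>\<^sup>2\<close>, the time derivative of \<open>?Q\<close>.\<close>
  have left: "((\<lambda>t. 3 / 16 * E\<^sup>2 - E / 4 * (E - 2 * (grad_norm \<Omega> (u t))\<^sup>2)) has_integral
      T * (3 / 16 * E\<^sup>2) - E / 4 * (?Q T - ?Q 0)) {0..T}"
    by (intro has_integral_diff has_integral_mult_right IC IQ)
  have right: "((\<lambda>t. 4 * l\<^sup>2 * F * (l / 2 * ?B t - (l / 2 * ?B t - ?n t))) has_integral
      4 * l\<^sup>2 * F * (l / 2 * I - (R T - R 0))) {0..T}"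
    by (intro has_integral_diff has_integral_mult_right IB IR)
  have "T * (3 / 16 * E\<^sup>2) - E / 4 * (?Q T - ?Q 0) \<le> 4 * l\<^sup>2 * F * (l / 2 * I - (R T - R 0))"
  proof (rule has_integral_le[OF left right])
    fix t assume "t \<in> {0..T}"
    then have t: "0 \<le> t" by simp
    show "3 / 16 * E\<^sup>2 - E / 4 * (E - 2 * (grad_norm \<Omega> (u t))\<^sup>2) \<le> 4 * l\<^sup>2 * F * (l / 2 * ?B t - (l / 2 * ?B t - ?n t))"
      using pointwise_lower_bound[OF W t, of S] unfolding E_def[symmetric] F_def[symmetric] l_def[symmetric]
      by (simp add: algebra_simps power2_eq_square)
  qed
  moreover have en: "wave_energy u v t = E" if "0 \<le> t" for t
    unfolding E_def by (rule wave_energy_constant[OF W that])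
  have "\<bar>?Q t\<bar> \<le> l * E" "\<bar>R t\<bar> \<le> l * E" if "0 \<le> t" for t
    using ip_le_wave_energy[OF W that, of S] unfolding en[OF that] l_def[symmetric] R_def by (auto simp: abs_le_iff)
  from this[OF T] this[OF order_refl] have Q: "?Q T - ?Q 0 \<le> 2 * (l * E)" and R: "- (R T - R 0) \<le> 2 * (l * E)"
    by linarith+
  have "E / 4 * (?Q T - ?Q 0) \<le> E / 4 * (2 * (l * E))" using E0 by (intro mult_left_mono Q) auto
  moreover have "4 * l\<^sup>2 * F * (l / 2 * I - (R T - R 0)) \<le> 4 * l\<^sup>2 * F * (l / 2 * I + 2 * (l * E))"
    using E0 R by (intro mult_left_mono) auto
  ultimately show ?thesis by (simp add: algebra_simps power2_eq_square)
qed

text \<open>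
  If the observation were smaller than \<open>E\<close>, the integrated estimate would give
  \<open>T \<le> 64 l\<^sup>3 \<Lambda> + 8 l / 3\<close>, and \<open>64 l\<^sup>3 \<Lambda> \<le> \<Lambda>\<^sup>2 + (32 l\<^sup>3)\<^sup>2\<close>. This is the origin of the constant
  \<open>1024 d\<^sup>6 + 3 d\<close>.
\<close>

lemma observability_estimate:
  assumes W: "wave_curve u v w" and c: "time_continuous (laplacian_norm \<Omega>) u"
    and d: "side_depth a b S \<le> d" and T: "1024 * d ^ 6 + 3 * d + (wave_energy2 u v 0 / wave_energy u v 0)\<^sup>2 \<le> T"
  shows "wave_energy u v 0 \<le> integral {0..T} (\<lambda>t. (L2_norm (N S) (normal_deriv a b S (u t)))\<^sup>2)"
proof -
  define E where "E = wave_energy u v 0"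
  define F where "F = wave_energy2 u v 0"
  define l where "l = side_depth a b S"
  define I where "I = integral {0..T} (\<lambda>t. (L2_norm (N S) (normal_deriv a b S (u t)))\<^sup>2)"
  have E0: "0 \<le> E" "0 \<le> F" by (auto simp: E_def F_def wave_energy_def wave_energy2_def)
  have l: "0 < l" unfolding l_def by (rule side_depth_pos[OF a_pos b_pos])
  have ld: "l \<le> d" using d unfolding l_def .
  have I0: "0 \<le> I" unfolding I_def
    by (intro integral_nonneg integrable_continuous_interval continuous_on_subset[OF boundary_energy_continuous[OF W c]]) auto
  have "l ^ 6 \<le> d ^ 6" using l ld by (intro power_mono) auto
  then have T': "1024 * l ^ 6 + 3 * l + (F / E)\<^sup>2 \<le> T" using T ld unfolding E_def F_def by linarith
  have T0: "0 \<le> T" using T' l by (smt (verit) zero_le_power2 zero_le_power)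
  have est: "3 / 16 * E\<^sup>2 * T - l * E\<^sup>2 / 2 \<le> 4 * l\<^sup>2 * F * (l / 2 * I + 2 * l * E)"
    using integrated_boundary_estimate[OF W c T0, of S] unfolding E_def F_def l_def I_def .
  have "E \<le> I"
  proof (rule ccontr)
    assume "\<not> E \<le> I"
    then have IE: "I < E" by simp
    then have E: "0 < E" using I0 by simp
    define L where "L = F / E"
    have L0: "0 \<le> L" unfolding L_def using E0 by simp
    have "4 * l\<^sup>2 * F * (l / 2 * I + 2 * l * E) \<le> 4 * l\<^sup>2 * F * (l * E + 2 * l * E)"
      using IE I0 l E0 by (intro mult_left_mono add_right_mono) auto
    also have "\<dots> = (12 * l ^ 3 * L) * E\<^sup>2" using E by (simp add: L_def field_simps power2_eq_square power3_eq_cube)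
    finally have "(3 / 16 * T - l / 2) * E\<^sup>2 \<le> (12 * l ^ 3 * L) * E\<^sup>2" using est by (simp add: algebra_simps)
    then have "3 / 16 * T - l / 2 \<le> 12 * l ^ 3 * L" using E by simp
    then have "T \<le> 64 * l ^ 3 * L + 8 / 3 * l" by simp
    moreover have "64 * l ^ 3 * L \<le> L\<^sup>2 + 1024 * l ^ 6"
      using zero_le_power2[of "L - 32 * l ^ 3"] by (simp add: power2_diff power_mult_distrib algebra_simps flip: power_mult)
    ultimately show False using T' l unfolding L_def[symmetric] by linarith
  qed
  then show ?thesis unfolding E_def I_def .
qed


lemma wave_solution_curve:
  assumes "wave_solution \<Omega> u0 u1 u"
  obtains v w where "wave_curve u v w" "time_continuous (laplacian_norm \<Omega>) u"
    "AE x in M. u 0 x = u0 x" "AE x in M. v 0 x = u1 x"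
proof -
  obtain v w where mem: "\<And>t. 0 \<le> t \<Longrightarrow> u t \<in> dom_laplacian \<Omega> \<and> v t \<in> H10 \<Omega> \<and> w t \<in> L2 M"
    and c: "time_continuous (laplacian_norm \<Omega>) u"
    and du: "has_time_deriv (grad_norm \<Omega>) u v" and dv: "has_time_deriv (L2_norm M) v w"
    and eq: "\<And>t. 0 \<le> t \<Longrightarrow> AE x in M. w t x - laplacian \<Omega> (u t) x = 0"
    and ini: "AE x in M. u 0 x = u0 x" "AE x in M. v 0 x = u1 x"
    using assms unfolding wave_solution_def by blast
  have u1: "u t \<in> H1 \<Omega>" and v1: "v t \<in> H1 \<Omega>" if "0 \<le> t" for t
    using mem[OF that] by (auto simp: dom_laplacian_def intro: H10_H1)
  have vL: "v t \<in> L2 M" if "0 \<le> t" for t by (rule H1_L2[OF v1[OF that]])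
  have "wave_curve u v w" unfolding wave_curve_def
  proof (intro conjI allI impI)
    fix t :: real assume t: "0 \<le> t"
    show "u t \<in> dom_laplacian \<Omega>" "v t \<in> H10 \<Omega>" "w t \<in> L2 M" using mem[OF t] by auto
    show "AE x in M. w t x = laplacian \<Omega> (u t) x" using eq[OF t] by simp
    show "L2_deriv M v (w t) t"
      unfolding L2_deriv_def L2_lim_def
    proof (intro conjI)
      show "w t \<in> L2 M" using mem[OF t] by simp
      show "\<forall>\<^sub>F s in at t within {0..}. (\<lambda>x. (v s x - v t x) / complex_of_real (s - t)) \<in> L2 M"
        using eventually_time by eventually_elim (rule L2_divide, rule L2_diff, auto intro: vL t)
      show "((\<lambda>s. L2_norm M (\<lambda>x. (v s x - v t x) / complex_of_real (s - t) - w t x)) \<longlongrightarrow> 0) (at t within {0..})"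
        using dv t unfolding has_time_deriv_def by blast
    qed
    fix d assume d: "is_axis d"
    let ?q = "\<lambda>f s x. (f s x - f t x) / complex_of_real (s - t)"
    have q1: "?q u s \<in> H1 \<Omega>" if "0 \<le> s" for s by (intro H1_divide H1_diff u1 that t)
    have "L2_lim (at t within {0..}) M (\<lambda>s. weak_deriv \<Omega> d (?q u s)) (weak_deriv \<Omega> d (v t))"
    proof (rule grad_lim[OF _ v1[OF t] _ d])
      show "\<forall>\<^sub>F s in at t within {0..}. ?q u s \<in> H1 \<Omega>"
        using eventually_time by eventually_elim (use q1 in blast)
      show "((\<lambda>s. grad_norm \<Omega> (\<lambda>x. ?q u s x - v t x)) \<longlongrightarrow> 0) (at t within {0..})"
        using du t unfolding has_time_deriv_def by blast
    qed
    then show "L2_deriv M (\<lambda>s. weak_deriv \<Omega> d (u s)) (weak_deriv \<Omega> d (v t)) t"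
      unfolding L2_deriv_def
    proof (rule L2_lim_cong_AE)
      show "\<forall>\<^sub>F s in at t within {0..}. ?q (\<lambda>s. weak_deriv \<Omega> d (u s)) s \<in> L2 M \<and>
          (AE x in M. ?q (\<lambda>s. weak_deriv \<Omega> d (u s)) s x = weak_deriv \<Omega> d (?q u s) x)"
        using eventually_time
      proof eventually_elim
        case (elim s)
        then have s: "0 \<le> s" by simp
        have "AE x in M. ?q (\<lambda>s. weak_deriv \<Omega> d (u s)) s x = weak_deriv \<Omega> d (?q u s) x"
          using weak_deriv_scale[OF H1_diff[OF u1[OF s] u1[OF t]] d, of "inverse (complex_of_real (s - t))"]
            weak_deriv_diff[OF u1[OF s] u1[OF t] d]
          by (simp only: divide_inverse mult.commute[of _ "inverse _"], eventually_elim) simp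
        moreover have "?q (\<lambda>s. weak_deriv \<Omega> d (u s)) s \<in> L2 M"
          by (intro L2_divide L2_diff H1_weak_L2 u1 s t d)
        ultimately show ?case by blast
      qed
    qed (auto intro: H1_weak_L2 v1 t d)
  qed
  with c ini show thesis by (intro that)
qed

text \<open>
  A solution takes its initial values only almost everywhere, whereas \<open>weak_deriv\<close> is applied to
  representatives.
\<close>

lemma laplacian_norm_cong_AE:
  assumes f: "f \<in> H2 \<Omega>" and g: "g \<in> H2 \<Omega>" and ae: "AE x in M. f x = g x"
  shows "laplacian_norm \<Omega> f = laplacian_norm \<Omega> g" "grad_norm \<Omega> f = grad_norm \<Omega> g"
proof -
  have 1: "AE x in M. weak_deriv \<Omega> v g x = weak_deriv \<Omega> v f x" if "is_axis v" for v
    by (rule H1_cong_AE(2)[OF H2_H1[OF f] H1_L2[OF H2_H1[OF g]] ae that])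
  have 2: "AE x in M. weak_deriv \<Omega> v (weak_deriv \<Omega> v g) x = weak_deriv \<Omega> v (weak_deriv \<Omega> v f) x" if v: "is_axis v" for v
  proof (rule H1_cong_AE(2)[OF H2_weak_H1[OF f v] H1_L2[OF H2_weak_H1[OF g v]] _ v])
    show "AE x in M. weak_deriv \<Omega> v f x = weak_deriv \<Omega> v g x" using 1[OF v] by eventually_elim simp
  qed
  have "AE x in M. laplacian \<Omega> f x = laplacian \<Omega> g x"
    using 2[OF axis_simps(1)] 2[OF axis_simps(2)] by eventually_elim (simp add: laplacian_def)
  then show "laplacian_norm \<Omega> f = laplacian_norm \<Omega> g"
    unfolding laplacian_norm_def by (intro L2_norm_cong_AE L2_measurable laplacian_L2 f g)
  have "L2_norm M (weak_deriv \<Omega> v f) = L2_norm M (weak_deriv \<Omega> v g)" if v: "is_axis v" for v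
  proof (rule L2_norm_cong_AE)
    show "AE x in M. weak_deriv \<Omega> v f x = weak_deriv \<Omega> v g x" using 1[OF v] by eventually_elim simp
  qed (intro L2_measurable H1_weak_L2 H2_H1 f g v)+
  then show "grad_norm \<Omega> f = grad_norm \<Omega> g" unfolding grad_norm_def by simp
qed

lemma grad_norm_cong_AE:
  assumes f: "f \<in> H1 \<Omega>" and g: "g \<in> H1 \<Omega>" and ae: "AE x in M. f x = g x"
  shows "grad_norm \<Omega> f = grad_norm \<Omega> g"
proof -
  have "L2_norm M (weak_deriv \<Omega> v f) = L2_norm M (weak_deriv \<Omega> v g)" if v: "is_axis v" for v
  proof (rule L2_norm_cong_AE)
    show "AE x in M. weak_deriv \<Omega> v f x = weak_deriv \<Omega> v g x"
      using H1_cong_AE(2)[OF f H1_L2[OF g] ae v] by eventually_elim simp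
  qed (intro L2_measurable H1_weak_L2 f g v)+
  then show ?thesis unfolding grad_norm_def by simp
qed

text \<open>
  The constants of the theorem may depend on the rectangle as a set only; its diameter bounds the depth
  from every side.
\<close>

lemma side_depth_le_diameter: "side_depth a b S \<le> diameter \<Omega>"
proof -
  have ne: "box (0, 0) (a * pi, b * pi) \<noteq> {}"
    unfolding rect_eq_box[symmetric] rect_def using mult_pos_pos[OF a_pos pi_gt_zero] mult_pos_pos[OF b_pos pi_gt_zero] by auto
  have cl: "closure \<Omega> = cbox (0, 0) (a * pi, b * pi)" unfolding rect_eq_box by (rule closure_box[OF ne])
  have "(0, 0) \<in> closure \<Omega>" "(a * pi, 0) \<in> closure \<Omega>" "(0, b * pi) \<in> closure \<Omega>"
    unfolding cl cbox_Pair_eq using a_pos b_pos by auto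
  moreover have bd: "bounded \<Omega>" unfolding rect_eq_box by (rule bounded_box)
  moreover note diameter_bounded_bound[OF bounded_closure[OF bd]]
  ultimately have "dist (a * pi, 0::real) (0, 0) \<le> diameter \<Omega>" "dist (0::real, b * pi) (0, 0) \<le> diameter \<Omega>"
    by (simp_all add: diameter_closure)
  then show ?thesis using a_pos b_pos by (cases S) (simp_all add: dist_Pair_Pair)
qed

lemma wave_solution_observability:
  assumes u0: "u0 \<in> dom_laplacian \<Omega>" and u1: "u1 \<in> H10 \<Omega>" and sol: "wave_solution \<Omega> u0 u1 u"
    and T: "1024 * diameter \<Omega> ^ 6 + 3 * diameter \<Omega> + (Lam \<Omega> u0 u1)\<^sup>2 \<le> T"
  shows "energy \<Omega> u0 u1 \<le> (LINT t:{0..T}|lborel. LINT x|N S. (cmod (normal_deriv a b S (u t) x))\<^sup>2)"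
proof -
  obtain v w where W: "wave_curve u v w" and c: "time_continuous (laplacian_norm \<Omega>) u"
    and ini: "AE x in M. u 0 x = u0 x" "AE x in M. v 0 x = u1 x"
    by (rule wave_solution_curve[OF sol])
  note D = wave_curveD[OF W order_refl]
  have u02: "u0 \<in> H2 \<Omega>" using u0 by (simp add: dom_laplacian_def)
  note u11 = H10_H1[OF u1]
  note n0 = laplacian_norm_cong_AE[OF D(2) u02 ini(1)] grad_norm_cong_AE[OF D(7) u11 ini(2)]
  have n1: "L2_norm M (v 0) = L2_norm M u1"
    by (intro L2_norm_cong_AE L2_measurable D(8) H1_L2[OF u11] ini(2))
  have E: "wave_energy u v 0 = energy \<Omega> u0 u1" and F: "wave_energy2 u v 0 / wave_energy u v 0 = Lam \<Omega> u0 u1"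
    by (simp_all add: wave_energy_def wave_energy2_def energy_def Lam_def n0 n1)
  let ?B = "\<lambda>t. (L2_norm (N S) (normal_deriv a b S (u t)))\<^sup>2"
  have cont: "continuous_on {0..T} ?B"
    by (rule continuous_on_subset[OF boundary_energy_continuous[OF W c]]) auto
  have "set_integrable lborel {0..T} ?B" by (rule borel_integrable_atLeastAtMost'[OF cont])
  from set_borel_integral_eq_integral(2)[OF this]
  have "(LINT t:{0..T}|lborel. LINT x|N S. (cmod (normal_deriv a b S (u t) x))\<^sup>2) = integral {0..T} ?B"
    by (simp add: L2_norm_power2)
  with observability_estimate[OF W c side_depth_le_diameter, of T S, unfolded F, unfolded E, OF T] show ?thesis
    by simp
qed

end

theorem theorem4p2:
  shows "\<exists>c2>0. \<exists>c1 c3 c4 :: plane set \<Rightarrow> plane set \<Rightarrow> real \<Rightarrow> real.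
    \<forall>a b :: real. \<forall>S :: side. 0 < a \<longrightarrow> 0 < b \<longrightarrow>
      (let \<Omega> = rect a b; \<Gamma> = side_set a b S; N = obs_norm a b S;
           k1 = c1 \<Gamma> \<Omega> N; k3 = c3 \<Gamma> \<Omega> N; k4 = c4 \<Gamma> \<Omega> N
       in 0 < k1 \<and> 0 < k3 \<and> 0 < k4 \<and>
          weakly_observable a b S (\<lambda>l. k4 / (k3 + c2 * l\<^sup>2)) (\<lambda>l. k1 + c2 * l\<^sup>2))"
proof (intro exI conjI allI impI)
  \<comment> \<open>The constants are \<open>c\<^sub>2 = c\<^sub>3 = c\<^sub>4 = 1\<close> and \<open>c\<^sub>1 = 1024 d\<^sup>6 + 3 d\<close>, where \<open>d\<close> is the diameter of the rectangle.\<close>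
  show "(0::real) < 1" by simp
  fix a b :: real and S :: side
  assume "0 < a" "0 < b"
  then interpret rectangle a b by unfold_locales
  let ?k = "1024 * diameter (rect a b) ^ 6 + 3 * diameter (rect a b)"
  have dp: "0 < diameter (rect a b)"
    using side_depth_le_diameter[of S] side_depth_pos[OF a_pos b_pos, of S] by linarith
  have sq: "x\<^sup>2 \<le> y\<^sup>2" if "0 \<le> x" "x \<le> y" for x y :: real using that by (rule power_mono[rotated])
  have pos: "0 < 1 + 1 * x\<^sup>2" for x :: real by (rule add_pos_nonneg) auto
  have "(\<lambda>l. 1 / (1 + 1 * l\<^sup>2)) \<in> Sigma_d"
    unfolding Sigma_d_def
  proof (intro CollectI conjI allI)
    show "continuous_on UNIV (\<lambda>l::real. 1 / (1 + 1 * l\<^sup>2))"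
      by (intro continuous_intros) (use pos in \<open>auto simp: less_imp_neq[symmetric]\<close>)
    show "antimono_on {0..} (\<lambda>l::real. 1 / (1 + 1 * l\<^sup>2))"
      by (rule monotone_onI, rule divide_left_mono) (use sq pos in auto)
  qed (use pos in auto)
  moreover have "(\<lambda>l. ?k + 1 * l\<^sup>2) \<in> Sigma_i"
    unfolding Sigma_i_def
  proof (intro CollectI conjI allI)
    show "0 < ?k + 1 * x\<^sup>2" for x using dp by (intro add_pos_nonneg add_nonneg_pos) auto
    show "continuous_on UNIV (\<lambda>l::real. ?k + 1 * l\<^sup>2)" by (intro continuous_intros)
    show "mono_on {0..} (\<lambda>l::real. ?k + 1 * l\<^sup>2)" by (rule monotone_onI) (use sq in auto)
  qed simp
  moreover have "1 / (1 + 1 * (Lam (rect a b) u0 u1)\<^sup>2) * energy (rect a b) u0 u1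
      \<le> (LINT t:{0..T}|lborel. LINT x|side_measure a b S. (cmod (normal_deriv a b S (u t) x))\<^sup>2)"
    if "u0 \<in> dom_laplacian (rect a b)" "u1 \<in> H10 (rect a b)" "wave_solution (rect a b) u0 u1 u"
      "?k + 1 * (Lam (rect a b) u0 u1)\<^sup>2 \<le> T" for u0 u1 u T
  proof -
    have "1 / (1 + 1 * (Lam (rect a b) u0 u1)\<^sup>2) * energy (rect a b) u0 u1 \<le> 1 * energy (rect a b) u0 u1"
      using pos by (intro mult_right_mono) (auto simp: energy_def field_simps)
    also have "\<dots> \<le> (LINT t:{0..T}|lborel. LINT x|side_measure a b S. (cmod (normal_deriv a b S (u t) x))\<^sup>2)"
      using wave_solution_observability[OF that(1-3), of T S] that(4) by simp
    finally show ?thesis .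
  qed
  ultimately have "weakly_observable a b S (\<lambda>l. 1 / (1 + 1 * l\<^sup>2)) (\<lambda>l. ?k + 1 * l\<^sup>2)"
    unfolding weakly_observable_def by blast
  with dp show "let \<Omega> = rect a b; \<Gamma> = side_set a b S; N = obs_norm a b S;
        k1 = (\<lambda>\<Gamma> \<Omega> N. 1024 * diameter \<Omega> ^ 6 + 3 * diameter \<Omega>) \<Gamma> \<Omega> N;
        k3 = (\<lambda>\<Gamma> \<Omega> N. 1) \<Gamma> \<Omega> N; k4 = (\<lambda>\<Gamma> \<Omega> N. 1) \<Gamma> \<Omega> N
       in 0 < k1 \<and> 0 < k3 \<and> 0 < k4 \<and>
          weakly_observable a b S (\<lambda>l. k4 / (k3 + 1 * l\<^sup>2)) (\<lambda>l. k1 + 1 * l\<^sup>2)"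
    by (simp add: Let_def add_pos_pos)
qed

end
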